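(* Let $G_\star\in\{G,G_\infty\}$. For every $f_0\in\mathcal M_+([0,\infty])$ there exists a unique weak solution $f$ of $$\partial_t f(V,t)=\int_0^V G_\star(v)\big((V-v)^{1/3}+v^{1/3}\big)^2f(V-v,t)\,dv-\int_0^\infty G_\star(v)\big(V^{1/3}+v^{1/3}\big)^2 dv\, f(V,t),\qquad f(\cdot,0)=f_0 .$$ Moreover, if $f_0(\{\infty\})=0$, then $f(\{\infty\},t)=0$ for every $t\ge 0$.
   Context: Standing assumptions: $\frac53<\sigma<2$; $G:(0,\infty)\to[0,\infty)$ satisfies $G\in L^1(0,\infty)$, $G(v)\le C_0v^{-\sigma}$ for all $v>0$ (some $C_0>0$), and $\lim_{v\to\infty}v^\sigma G(v)=1$; $G_\infty(v):=v^{-\sigma}$. $[0,\infty]$ is the compactified half-line and $C([0,\infty])$ carries the supremum norm. $\mathcal M_+([0,\infty])$ is the set of nonnegative Radon measures on $[0,\infty]$, with the weak topology given by duality with $C([0,\infty])$; $\int\psi(V) f(V)\,dV$ denotes integration of $\psi$ against the measure $f$. For $M>0$ let $X_M=\{\varphi\in C([0,\infty]):\varphi \text{ is constant on }[M,\infty]\}$ and $\mathcal X=\bigcup_{M>0}X_M$. $C^\infty([0,\infty])$ is the set of $\psi\in C^\infty([0,\infty))$ such that $\lim_{v\to\infty}\partial_v^k\psi(v)$ exists for every $k\ge0$. Weak solution: $f\in C([0,T];\mathcal M_+([0,\infty]))$ (for each $T>0$) with $f(\cdot,0)=f_0$ such that for every test function $\varphi\in C^1([0,T];C^\infty([0,\infty])\cap\mathcal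 X)$ (with $\varphi(\cdot,t)\in X_M$ for a common $M$) $$\int_{[0,\infty]}f(V,T)\varphi(V,T)dV-\int_{[0,\infty]}f(V,0)\varphi(V,0)dV-\int_0^T\!\!\int_{[0,\infty]}f(V,t)\partial_t\varphi(V,t)\,dV\,dt$$ $$=\int_0^T\!\!\int_{[0,\infty]}\int_0^\infty G_\star(v)(V^{1/3}+v^{1/3})^2 f(V,t)\big(\varphi(V+v,t)-\varphi(V,t)\big)\,dv\,dV\,dt,$$ where the inner $v$-integral is a continuous function of $V\in[0,\infty]$ vanishing for large $V$ (in particular it is $0$ at $V=\infty$). *)

theory Defs
  imports "HOL-Analysis.Analysis"
begin

text \<open>
  The compactified half-line \<open>[0,\<infinity>]\<close> is the type \<^typ>\<open>ennreal\<close>. Points of \<open>[0,\<infinity>)\<close> are written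
  \<open>ennreal v\<close> with \<open>v \<ge> 0\<close>.
\<close>

definition C_compact :: "(ennreal \<Rightarrow> real) set" where
  "C_compact = {\<psi>. continuous_on UNIV \<psi>}"

text \<open>
  \<open>[0,\<infinity>]\<close> is compact and metrizable, so its nonnegative Radon measures are exactly the finite
  Borel measures.
\<close>

definition radon_measures :: "ennreal measure set" where
  "radon_measures = {\<mu>. sets \<mu> = sets borel \<and> finite_measure \<mu>}"

text \<open>
  The coarsest topology on the set of nonnegative Radon measures that makes
  \<open>\<mu> \<mapsto> \<integral>\<psi> d\<mu>\<close> continuous for every \<open>\<psi> \<in> C([0,\<infinity>])\<close>.
\<close>

definition weak_topology :: "ennreal measure topology" where
  "weak_topology =
     pullback_topology radon_measures
       (\<lambda>\<mu>. \<lambda>\<psi>\<in>C_compact. \<integral>V. \<psi> V \<partial>\<mu>)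
       (product_topology (\<lambda>_. euclideanreal) C_compact)"

lemma continuous_map_weak_topology_iff:
  "continuous_map S weak_topology f \<longleftrightarrow>
     f \<in> topspace S \<rightarrow> radon_measures \<and>
     (\<forall>\<psi>\<in>C_compact. continuous_map S euclideanreal (\<lambda>t. \<integral>V. \<psi> V \<partial>f t))"
proof
  assume L: "continuous_map S weak_topology f"
  have "f \<in> topspace S \<rightarrow> topspace weak_topology"
    using L by (rule continuous_map_funspace)
  then have "f \<in> topspace S \<rightarrow> radon_measures"
    by (auto simp: weak_topology_def topspace_pullback_topology)
  moreover have "continuous_map weak_topology (product_topology (\<lambda>_. euclideanreal) C_compact)
      (\<lambda>\<mu>. \<lambda>\<psi>\<in>C_compact. \<integral>V. \<psi> V \<partial>\<mu>)"
    using continuous_map_pullback[OF continuous_map_id]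
    by (simp add: weak_topology_def)
  from continuous_map_compose[OF L this]
  have "\<forall>\<psi>\<in>C_compact. continuous_map S euclideanreal (\<lambda>t. \<integral>V. \<psi> V \<partial>f t)"
    by (auto simp: continuous_map_componentwise o_def cong: restrict_cong)
  ultimately show "f \<in> topspace S \<rightarrow> radon_measures \<and>
     (\<forall>\<psi>\<in>C_compact. continuous_map S euclideanreal (\<lambda>t. \<integral>V. \<psi> V \<partial>f t))" by blast
next
  assume R: "f \<in> topspace S \<rightarrow> radon_measures \<and>
     (\<forall>\<psi>\<in>C_compact. continuous_map S euclideanreal (\<lambda>t. \<integral>V. \<psi> V \<partial>f t))"
  show "continuous_map S weak_topology f"
    unfolding weak_topology_def
    by (rule continuous_map_pullback')
       (use R in \<open>auto simp: continuous_map_componentwise o_def\<close>)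
qed

definition X_space :: "real \<Rightarrow> (ennreal \<Rightarrow> real) set" where
  "X_space M = {\<phi> \<in> C_compact. \<phi> constant_on {ennreal M..}}"

text \<open>
  The \<open>k\<close>-th derivative on \<open>[0,\<infinity>)\<close>, one-sided at \<open>0\<close>. Only its values on \<open>{0..}\<close> are meaningful.
\<close>

definition halfline_deriv :: "nat \<Rightarrow> (ennreal \<Rightarrow> real) \<Rightarrow> real \<Rightarrow> real" where
  "halfline_deriv k \<psi> =
     ((\<lambda>g v. vector_derivative g (at v within {0..})) ^^ k) (\<lambda>v. \<psi> (ennreal v))"

text \<open>
  The smooth functions on \<open>[0,\<infinity>)\<close> all of whose derivatives have a limit at \<open>\<infinity>\<close>, extended to
  \<open>[0,\<infinity>]\<close> by continuity.
\<close>

definition C_infty_compact :: "(ennreal \<Rightarrow> real) set" where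
  "C_infty_compact =
     {\<psi> \<in> C_compact. \<forall>k.
        (\<forall>v\<ge>0. halfline_deriv k \<psi> differentiable (at v within {0..})) \<and>
        (\<exists>l. (halfline_deriv k \<psi> \<longlongrightarrow> l) at_top)}"

text \<open>
  Convergence in the Frechet topology given by the seminorms
  \<open>\<psi> \<mapsto> sup\<^sub>v \<bar>\<partial>\<^sub>v\<^sup>k \<psi>(v)\<bar>\<close>, \<open>k \<ge> 0\<close>.
\<close>

definition smooth_tendsto ::
    "('a \<Rightarrow> ennreal \<Rightarrow> real) \<Rightarrow> (ennreal \<Rightarrow> real) \<Rightarrow> 'a filter \<Rightarrow> bool" where
  "smooth_tendsto \<Phi> \<psi> F \<longleftrightarrow>
     (\<forall>k. uniform_limit {0..} (\<lambda>s. halfline_deriv k (\<Phi> s)) (halfline_deriv k \<psi>) F)"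

text \<open>
  \<open>\<phi>\<close> is a curve in \<open>C\<^sup>1([0,T]; C\<^sup>\<infinity>([0,\<infinity>]) \<inter> X)\<close> with \<open>\<phi>(\<cdot>,t) \<in> X\<^sub>M\<close> for a common \<open>M\<close>, and
  \<open>\<phi>'\<close> is its time derivative. The time argument comes first.
\<close>

definition test_function ::
    "real \<Rightarrow> (real \<Rightarrow> ennreal \<Rightarrow> real) \<Rightarrow> (real \<Rightarrow> ennreal \<Rightarrow> real) \<Rightarrow> bool" where
  "test_function T \<phi> \<phi>' \<longleftrightarrow>
     (\<exists>M>0. \<forall>t\<in>{0..T}. \<phi> t \<in> C_infty_compact \<inter> X_space M \<and>
                       \<phi>' t \<in> C_infty_compact \<inter> X_space M) \<and>
     (\<forall>t\<in>{0..T}.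
        smooth_tendsto (\<lambda>s V. (\<phi> s V - \<phi> t V) / (s - t)) (\<phi>' t) (at t within {0..T}) \<and>
        smooth_tendsto \<phi>' (\<phi>' t) (at t within {0..T}))"

definition G_infty :: "real \<Rightarrow> real \<Rightarrow> real" where
  "G_infty \<sigma> v = v powr (- \<sigma>)"

text \<open>
  At \<open>V = \<infinity>\<close> the increment \<open>\<phi>(V + v) - \<phi>(V)\<close> is \<open>0\<close>, so the value of \<^const>\<open>enn2real\<close> there
  plays no role. Lebesgue rather than Borel measurability is used for the \<open>v\<close>-integral because
  \<open>G\<close> is only an \<open>L\<^sup>1\<close> function.
\<close>

definition jump_operator :: "(real \<Rightarrow> real) \<Rightarrow> (ennreal \<Rightarrow> real) \<Rightarrow> ennreal \<Rightarrow> real" where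
  "jump_operator G \<phi> V =
     (LINT v:{0<..}|lebesgue.
        G v * (root 3 (enn2real V) + root 3 v)\<^sup>2 * (\<phi> (V + ennreal v) - \<phi> V))"

text \<open>
  A solution is a function of \<open>t \<ge> 0\<close>; the values at negative times are irrelevant.
\<close>

definition weak_solution ::
    "(real \<Rightarrow> real) \<Rightarrow> ennreal measure \<Rightarrow> (real \<Rightarrow> ennreal measure) \<Rightarrow> bool" where
  "weak_solution G f0 f \<longleftrightarrow>
     f 0 = f0 \<and>
     (\<forall>T>0.
        continuous_map (top_of_set {0..T}) weak_topology f \<and>
        (\<forall>\<phi> \<phi>'. test_function T \<phi> \<phi>' \<longrightarrow>
           (\<integral>V. \<phi> T V \<partial>f T) - (\<integral>V. \<phi> 0 V \<partial>f 0)
             - (LBINT t:{0..T}. (\<integral>V. \<phi>' t V \<partial>f t))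
           = (LBINT t:{0..T}. (\<integral>V. jump_operator G (\<phi> t) V \<partial>f t))))"

end

theory Submission
  imports Defs "HOL-Probability.Helly_Selection"
begin

text \<open>
  Jumps only increase the volume, so the generator \<open>L\<close> preserves the functions that are constant on
  \<open>[M, \<infinity>]\<close>.  Approximate \<open>L\<close> by bounded jump generators \<open>A\<^sub>n\<close>, whose semigroups \<open>S\<^sub>n\<close> are Poisson
  mixtures of Markov steps.  Comparing a weak solution with \<open>S\<^sub>n\<close> by Duhamel's formula, uniqueness and,
  via a Cauchy argument and the Riesz representation theorem, existence reduce to the uniform
  convergence \<open>(L - A\<^sub>n) S\<^sub>n \<phi> \<rightarrow> 0\<close> for a dense set of \<open>\<phi>\<close>.
  For an integrable kernel, \<open>L = A\<^sub>n\<close> on the functions that are constant on \<open>[M, \<infinity>]\<close> once \<open>n \<ge> M\<close>.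
  For the power kernel, the singularity at \<open>v = 0\<close> and the roughness of the cube root at \<open>V = 0\<close> are
  absorbed by the modulus \<open>h(V) = (min V (2 * M)) powr \<alpha>\<close> with \<open>\<alpha>\<close> slightly above \<open>\<sigma> - 5/3\<close>: by
  scaling, \<open>A\<^sub>n h\<close> is nonincreasing in \<open>V\<close>, so a monotone coupling of two jump processes propagates
  the \<open>h\<close>-modulus of \<open>S\<^sub>n \<phi>\<close> uniformly in \<open>n\<close>.
  No mass reaches infinity because \<open>L\<close> maps \<open>(min V M) / M\<close> to a function of order \<open>M powr (5/3 - \<sigma>)\<close>.
\<close>

section \<open>Markov steps and the Duhamel comparison\<close>

text \<open>The weak formulation admits only smooth test functions, while
  \<open>S\<^sub>n \<phi>\<close> need not be smooth: the cube root in the rate is not even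
  Lipschitz at V = 0. The identity is therefore first extended to classes \<open>D i\<close> that
  the semigroups leave invariant, each with its own constant; invariance with the same constant,
  uniformly in n, is what makes the generator error vanish in Duhamel's formula. For the power
  kernel the modulus is forced from two sides. From V = 0 a jump of size v has rate of order v powr
  (2/3 - \<sigma>), so the generator is finite on V powr \<alpha> only for \<alpha> > \<sigma> -
  5/3. For such \<alpha> the integral over large jumps of the pure power diverges, hence the cap at
  2 * M. With \<eta> = \<alpha> - (\<sigma> - 5/3), the capped integral is to leading order ((2 * M)
  powr \<eta> - V powr \<eta>) / \<eta> plus a constant, which decreases in V. The conditions on
  \<eta> and on the cutoff fraction \<nu> protect this sign against lower-order terms.\<close>

lemma C_compact_const [simp]: "(\<lambda>_. c) \<in> C_compact"
  by (simp add: C_compact_def)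

lemma C_compact_lin: "\<phi> \<in> C_compact \<Longrightarrow> \<psi> \<in> C_compact \<Longrightarrow> (\<lambda>V. a * \<phi> V + b * \<psi> V) \<in> C_compact"
  by (auto simp: C_compact_def intro!: continuous_intros)

lemma C_compact_diff: "\<phi> \<in> C_compact \<Longrightarrow> \<psi> \<in> C_compact \<Longrightarrow> (\<lambda>V. \<phi> V - \<psi> V) \<in> C_compact"
  by (auto simp: C_compact_def intro!: continuous_intros)

lemma C_compact_cmult: "\<phi> \<in> C_compact \<Longrightarrow> (\<lambda>V. a * \<phi> V) \<in> C_compact"
  by (auto simp: C_compact_def intro!: continuous_intros)

lemma C_compact_sum: "(\<And>k. k \<in> I \<Longrightarrow> \<phi> k \<in> C_compact) \<Longrightarrow> (\<lambda>V. \<Sum>k\<in>I. a k * \<phi> k V) \<in> C_compact"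
  by (auto simp: C_compact_def intro!: continuous_intros)

lemma C_compact_bounded:
  assumes "\<phi> \<in> C_compact"
  obtains c where "c \<ge> 0" "\<And>V. \<bar>\<phi> V\<bar> \<le> c"
proof -
  have "compact (range \<phi>)"
    using assms compact_UNIV by (intro compact_continuous_image) (auto simp: C_compact_def)
  then have "bounded (range \<phi>)" by (rule compact_imp_bounded)
  then obtain c where "\<And>V. \<bar>\<phi> V\<bar> \<le> c" unfolding bounded_iff by auto
  moreover from this[of 0] have "c \<ge> 0" by linarith
  ultimately show ?thesis using that by blast
qed

lemma C_compact_uniform_limit:
  assumes "\<And>n. f n \<in> C_compact" "uniform_limit UNIV f g sequentially"
  shows "g \<in> C_compact"
  using uniform_limit_theorem[OF _ assms(2)] assms(1)
  by (auto simp: C_compact_def)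

lemma bounded_by_nonneg:
  fixes \<phi> :: "ennreal \<Rightarrow> real"
  assumes "\<And>V. \<bar>\<phi> V\<bar> \<le> c"
  shows "0 \<le> c"
  using assms[of 0] by linarith

text \<open>Uniformization: a jump generator with total rate at most \<open>lam\<close> is
  \<open>lam\<close> times (transition operator minus identity). The gain from working with
  \<open>P\<close> is that \<open>S\<close> is a convex combination of its iterates, so positivity,
  contraction, constancy beyond a point and bounds on increments pass from one step to the
  semigroup.\<close>

locale markov_step =
  fixes P :: "(ennreal \<Rightarrow> real) \<Rightarrow> ennreal \<Rightarrow> real" and lam :: real
  assumes lam_pos: "lam > 0"
    and P_C: "\<phi> \<in> C_compact \<Longrightarrow> P \<phi> \<in> C_compact"
    and P_lin: "\<phi> \<in> C_compact \<Longrightarrow> \<psi> \<in> C_compact \<Longrightarrow>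
      P (\<lambda>V. a * \<phi> V + b * \<psi> V) = (\<lambda>V. a * P \<phi> V + b * P \<psi> V)"
    and P_pos: "\<phi> \<in> C_compact \<Longrightarrow> (\<And>V. 0 \<le> \<phi> V) \<Longrightarrow> 0 \<le> P \<phi> V"
    and P_one: "P (\<lambda>_. 1) V = 1"
begin

text \<open>Positivity applied to c - \<phi> and c + \<phi>, together with \<open>P 1 = 1\<close>,
  makes \<open>P\<close> a contraction in the sup norm.\<close>

lemma P_bound:
  assumes "\<phi> \<in> C_compact" "\<And>V. \<bar>\<phi> V\<bar> \<le> c"
  shows "\<bar>P \<phi> V\<bar> \<le> c"
proof -
  have 1: "P (\<lambda>V. c * 1 + (-1) * \<phi> V) V = c - P \<phi> V"
    using P_lin[of "\<lambda>_. 1" \<phi> c "-1"] assms(1) by (simp add: P_one)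
  have 2: "P (\<lambda>V. c * 1 + 1 * \<phi> V) V = c + P \<phi> V"
    using P_lin[of "\<lambda>_. 1" \<phi> c 1] assms(1) by (simp add: P_one)
  have "0 \<le> P (\<lambda>V. c * 1 + (-1) * \<phi> V) V"
    using assms by (intro P_pos C_compact_lin) (auto simp: abs_le_iff)
  moreover have "0 \<le> P (\<lambda>V. c * 1 + 1 * \<phi> V) V"
  proof (intro P_pos C_compact_lin)
    show "0 \<le> c * 1 + 1 * \<phi> V" for V using assms(2)[of V] by linarith
  qed (use assms in auto)
  ultimately show ?thesis using 1 2 by linarith
qed

lemma Pk_C: "\<phi> \<in> C_compact \<Longrightarrow> (P ^^ k) \<phi> \<in> C_compact"
  by (induction k) (auto intro: P_C)

lemma Pk_lin:
  "\<phi> \<in> C_compact \<Longrightarrow> \<psi> \<in> C_compact \<Longrightarrow>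
      (P ^^ k) (\<lambda>V. a * \<phi> V + b * \<psi> V) = (\<lambda>V. a * (P ^^ k) \<phi> V + b * (P ^^ k) \<psi> V)"
proof (induction k)
  case (Suc k)
  then show ?case using P_lin[of "(P ^^ k) \<phi>" "(P ^^ k) \<psi>" a b, OF Pk_C[OF Suc.prems(1)] Pk_C[OF Suc.prems(2)]] by simp
qed simp

lemma Pk_bound:
  "\<phi> \<in> C_compact \<Longrightarrow> (\<And>V. \<bar>\<phi> V\<bar> \<le> c) \<Longrightarrow> \<bar>(P ^^ k) \<phi> V\<bar> \<le> c"
proof (induction k arbitrary: V)
  case (Suc k)
  show ?case using P_bound[OF Pk_C[OF Suc.prems(1)] Suc.IH[OF Suc.prems]] by simp
qed simp

text \<open>Written as a power series in \<open>lam * t\<close> so that termwise differentiation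
  applies; \<open>S_sums\<close> rewrites it with the Poisson weights \<open>wt\<close>.\<close>

definition S :: "real \<Rightarrow> (ennreal \<Rightarrow> real) \<Rightarrow> ennreal \<Rightarrow> real" where
  "S t \<phi> V = exp (- (lam * t)) * (\<Sum>k. (P ^^ k) \<phi> V / fact k * (lam * t) ^ k)"

definition A :: "(ennreal \<Rightarrow> real) \<Rightarrow> ennreal \<Rightarrow> real" where
  "A \<phi> V = lam * (P \<phi> V - \<phi> V)"

definition wt :: "real \<Rightarrow> nat \<Rightarrow> real" where
  "wt t k = exp (- (lam * t)) * ((lam * t) ^ k / fact k)"

lemma wt_sums: "wt t sums 1"
proof -
  have "(\<lambda>k. (lam * t) ^ k /\<^sub>R fact k) sums exp (lam * t)" by (rule exp_converges)
  from sums_mult[OF this, of "exp (- (lam * t))"] show ?thesis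
    by (simp add: wt_def[abs_def] divide_inverse mult.commute exp_minus)
qed

lemma wt_nonneg: "0 \<le> t \<Longrightarrow> 0 \<le> wt t k"
  using lam_pos by (simp add: wt_def)

lemma summable_S:
  assumes "\<phi> \<in> C_compact"
  shows "summable (\<lambda>k. (P ^^ k) \<phi> V / fact k * x ^ k)"
proof -
  obtain c where c: "c \<ge> 0" "\<And>V. \<bar>\<phi> V\<bar> \<le> c" using C_compact_bounded[OF assms] by blast
  have s: "summable (\<lambda>k. c * (\<bar>x\<bar> ^ k /\<^sub>R fact k))"
    by (intro summable_mult sums_summable[OF exp_converges])
  show ?thesis
  proof (rule summable_comparison_test'[OF s])
    fix n :: nat
    have "\<bar>(P ^^ n) \<phi> V\<bar> * (\<bar>x\<bar> ^ n / fact n) \<le> c * (\<bar>x\<bar> ^ n / fact n)"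
      by (intro mult_right_mono Pk_bound assms c) auto
    then show "norm ((P ^^ n) \<phi> V / fact n * x ^ n) \<le> c * (\<bar>x\<bar> ^ n /\<^sub>R fact n)"
      by (simp add: abs_mult divide_inverse power_abs mult_ac)
  qed
qed

lemma S_sums:
  assumes "\<phi> \<in> C_compact"
  shows "(\<lambda>k. wt t k * (P ^^ k) \<phi> V) sums S t \<phi> V"
proof -
  have "(\<lambda>k. exp (- (lam * t)) * ((P ^^ k) \<phi> V / fact k * (lam * t) ^ k)) sums S t \<phi> V"
    unfolding S_def by (intro sums_mult summable_sums summable_S assms)
  then show ?thesis by (simp add: wt_def mult_ac)
qed

lemma S_0: "S 0 \<phi> = \<phi>"
proof
  fix V
  have "(\<Sum>k. (P ^^ k) \<phi> V / fact k * (0::real) ^ k) = (P ^^ 0) \<phi> V / fact 0"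
    using powser_sums_zero[of "\<lambda>k. (P ^^ k) \<phi> V / fact k"] by (simp add: sums_iff)
  then show "S 0 \<phi> V = \<phi> V" by (simp add: S_def)
qed

text \<open>The remainder is a weighted sum of iterates, each bounded by \<open>c\<close>, so it
  costs \<open>c\<close> times the missing Poisson mass. The bound does not depend on
  \<open>V\<close>, which is what carries continuity over to \<open>S t \<phi>\<close>.\<close>

lemma S_partial:
  assumes "\<phi> \<in> C_compact" "\<And>V. \<bar>\<phi> V\<bar> \<le> c" "0 \<le> t"
  shows "\<bar>S t \<phi> V - (\<Sum>k<n. wt t k * (P ^^ k) \<phi> V)\<bar> \<le> c * (1 - (\<Sum>k<n. wt t k))"
proof -
  have 1: "(\<lambda>k. wt t (k + n) * (P ^^ (k + n)) \<phi> V) sums (S t \<phi> V - (\<Sum>k<n. wt t k * (P ^^ k) \<phi> V))"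
    by (rule sums_split_initial_segment[OF S_sums[OF assms(1)]])
  have 2: "(\<lambda>k. c * wt t (k + n)) sums (c * (1 - (\<Sum>k<n. wt t k)))"
    by (intro sums_mult sums_split_initial_segment[OF wt_sums])
  have 3: "\<bar>wt t (k + n) * (P ^^ (k + n)) \<phi> V\<bar> \<le> c * wt t (k + n)" for k
    using mult_left_mono[OF Pk_bound[OF assms(1,2), of "k+n" V] wt_nonneg[OF assms(3), of "k+n"]]
    by (simp add: abs_mult wt_nonneg[OF assms(3)] mult.commute)
  have "S t \<phi> V - (\<Sum>k<n. wt t k * (P ^^ k) \<phi> V) \<le> c * (1 - (\<Sum>k<n. wt t k))"
    using 3 by (intro sums_le[OF _ 1 2]) (auto simp: abs_le_iff)
  moreover have "- (S t \<phi> V - (\<Sum>k<n. wt t k * (P ^^ k) \<phi> V)) \<le> c * (1 - (\<Sum>k<n. wt t k))"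
    using 3 by (intro sums_le[OF _ sums_minus[OF 1] 2]) (auto simp: abs_le_iff)
  ultimately show ?thesis by linarith
qed

lemma S_uniform:
  assumes "\<phi> \<in> C_compact" "0 \<le> t"
  shows "uniform_limit UNIV (\<lambda>n V. \<Sum>k<n. wt t k * (P ^^ k) \<phi> V) (S t \<phi>) sequentially"
proof -
  obtain c where c: "c \<ge> 0" "\<And>V. \<bar>\<phi> V\<bar> \<le> c" using C_compact_bounded[OF assms(1)] by blast
  have "(\<lambda>n. c * (1 - (\<Sum>k<n. wt t k))) \<longlonglongrightarrow> c * (1 - 1)"
    using wt_sums[of t] unfolding sums_def by (intro tendsto_intros)
  then have l: "(\<lambda>n. c * (1 - (\<Sum>k<n. wt t k))) \<longlonglongrightarrow> 0" by simp
  show ?thesis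
  proof (rule uniform_limitI)
    fix e :: real assume "e > 0"
    have "\<forall>\<^sub>F n in sequentially. c * (1 - (\<Sum>k<n. wt t k)) < e"
      using order_tendstoD(2)[OF l \<open>e > 0\<close>] .
    then show "\<forall>\<^sub>F n in sequentially. \<forall>V\<in>UNIV. dist (\<Sum>k<n. wt t k * (P ^^ k) \<phi> V) (S t \<phi> V) < e"
    proof eventually_elim
      case (elim n)
      then show ?case using S_partial[OF assms(1) c(2) assms(2), of _ n]
        by (auto simp: dist_real_def abs_minus_commute intro: le_less_trans)
    qed
  qed
qed

lemma S_C: "\<phi> \<in> C_compact \<Longrightarrow> 0 \<le> t \<Longrightarrow> S t \<phi> \<in> C_compact"
  by (rule C_compact_uniform_limit[OF _ S_uniform]) (auto intro!: C_compact_sum Pk_C)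

lemma S_bound:
  assumes "\<phi> \<in> C_compact" "\<And>V. \<bar>\<phi> V\<bar> \<le> c" "0 \<le> t"
  shows "\<bar>S t \<phi> V\<bar> \<le> c"
  using S_partial[OF assms, of V 0] by simp

lemma S_lin:
  assumes "\<phi> \<in> C_compact" "\<psi> \<in> C_compact"
  shows "S t (\<lambda>V. a * \<phi> V + b * \<psi> V) = (\<lambda>V. a * S t \<phi> V + b * S t \<psi> V)"
proof
  fix V
  have "(\<lambda>k. a * (wt t k * (P ^^ k) \<phi> V) + b * (wt t k * (P ^^ k) \<psi> V)) sums
        (a * S t \<phi> V + b * S t \<psi> V)"
    by (intro sums_add sums_mult S_sums assms)
  moreover have "(\<lambda>k. wt t k * (P ^^ k) (\<lambda>V. a * \<phi> V + b * \<psi> V) V) sums S t (\<lambda>V. a * \<phi> V + b * \<psi> V) V"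
    by (intro S_sums C_compact_lin assms)
  ultimately show "S t (\<lambda>V. a * \<phi> V + b * \<psi> V) V = a * S t \<phi> V + b * S t \<psi> V"
    by (simp add: Pk_lin[OF assms] algebra_simps sums_iff)
qed

lemma S_pos:
  assumes "\<phi> \<in> C_compact" "\<And>V. 0 \<le> \<phi> V" "0 \<le> t"
  shows "0 \<le> S t \<phi> V"
proof -
  have "0 \<le> (P ^^ k) \<phi> V" for k V
    using assms(1,2) by (induction k arbitrary: V) (auto intro: P_pos Pk_C)
  then show ?thesis
    using wt_nonneg[OF assms(3)]
    by (intro sums_le[OF _ sums_zero S_sums[OF assms(1)]]) auto
qed

lemma A_C: "\<phi> \<in> C_compact \<Longrightarrow> A \<phi> \<in> C_compact"
  unfolding A_def by (intro C_compact_cmult C_compact_diff P_C)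

lemma A_bound:
  assumes "\<phi> \<in> C_compact" "\<And>V. \<bar>\<phi> V\<bar> \<le> c"
  shows "\<bar>A \<phi> V\<bar> \<le> 2 * lam * c"
proof -
  have "\<bar>P \<phi> V - \<phi> V\<bar> \<le> 2 * c"
    using P_bound[OF assms, of V] assms(2)[of V] by linarith
  from mult_left_mono[OF this, of lam] show ?thesis using lam_pos by (simp add: A_def abs_mult)
qed

lemma S_deriv:
  assumes "\<phi> \<in> C_compact"
  shows "((\<lambda>t. S t \<phi> V) has_real_derivative S t (A \<phi>) V) (at t within X)"
proof -
  let ?c = "\<lambda>k. (P ^^ k) \<phi> V / fact k"
  let ?F = "\<lambda>x. \<Sum>k. ?c k * x ^ k"
  \<comment> \<open>The coefficient of index k + 1 is multiplied by k + 1: the factorial drops by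
    one and the extra \<open>P\<close> lands on \<phi>. The derivative of the series is thus the
    same series for \<open>P \<phi>\<close>.\<close>
  have d: "diffs ?c k = (P ^^ k) (P \<phi>) V / fact k" for k
    by (simp add: diffs_def funpow_swap1 field_simps del: of_nat_Suc)
  have D: "(?F has_real_derivative (\<Sum>k. (P ^^ k) (P \<phi>) V / fact k * x ^ k)) (at x)" for x
    using termdiffs_strong_converges_everywhere[of ?c, OF summable_S[OF assms]] unfolding d .
  have "((\<lambda>t. S t \<phi> V) has_real_derivative
      (exp (- (lam * t)) * (- lam) * ?F (lam * t) +
       (\<Sum>k. (P ^^ k) (P \<phi>) V / fact k * (lam * t) ^ k) * lam * exp (- (lam * t)))) (at t)"
    unfolding S_def
    by (rule derivative_eq_intros DERIV_chain2[OF D] refl | simp)+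
  also have "(exp (- (lam * t)) * (- lam) * ?F (lam * t) +
       (\<Sum>k. (P ^^ k) (P \<phi>) V / fact k * (lam * t) ^ k) * lam * exp (- (lam * t)))
    = lam * S t (P \<phi>) V + (- lam) * S t \<phi> V"
    by (simp add: S_def algebra_simps)
  also have "\<dots> = S t (A \<phi>) V"
    using S_lin[OF P_C[OF assms] assms, of t lam "- lam"] by (simp add: A_def[abs_def] algebra_simps)
  finally show ?thesis by (rule has_field_derivative_at_within)
qed

text \<open>Linearity of \<open>P\<close> covers finite sums only. It is exchanged with the series
  by approximating \<open>S t \<phi>\<close> uniformly by partial sums and using that
  \<open>P\<close> is a contraction.\<close>

lemma P_S_commute:
  assumes "\<phi> \<in> C_compact" "0 \<le> t"
  shows "P (S t \<phi>) = S t (P \<phi>)"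
proof
  fix V
  let ?p = "\<lambda>n V. \<Sum>k<n. wt t k * (P ^^ k) \<phi> V"
  have pC: "?p n \<in> C_compact" for n by (auto intro!: C_compact_sum Pk_C assms)
  have Pp: "P (?p n) V = (\<Sum>k<n. wt t k * (P ^^ k) (P \<phi>) V)" for n V
  proof (induction n arbitrary: V)
    case 0
    show ?case using P_lin[of "\<lambda>_. 1" "\<lambda>_. 1" 0 0] by simp
  next
    case (Suc n)
    have "P (?p (Suc n)) = P (\<lambda>V. 1 * ?p n V + wt t n * (P ^^ n) \<phi> V)" by simp
    also have "\<dots> = (\<lambda>V. 1 * P (?p n) V + wt t n * P ((P ^^ n) \<phi>) V)"
      by (rule P_lin) (auto intro: pC Pk_C assms)
    finally show ?case using Suc by (simp add: funpow_swap1)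
  qed
  obtain c where c: "c \<ge> 0" "\<And>V. \<bar>\<phi> V\<bar> \<le> c" using C_compact_bounded[OF assms(1)] by blast
  have b: "\<bar>P (S t \<phi>) V - P (?p n) V\<bar> \<le> c * (1 - (\<Sum>k<n. wt t k))" for n
  proof -
    have "P (\<lambda>V. 1 * S t \<phi> V + (-1) * ?p n V) = (\<lambda>V. 1 * P (S t \<phi>) V + (-1) * P (?p n) V)"
      by (rule P_lin) (auto intro: pC S_C assms)
    moreover have "\<bar>P (\<lambda>V. 1 * S t \<phi> V + (-1) * ?p n V) V\<bar> \<le> c * (1 - (\<Sum>k<n. wt t k))"
      using S_partial[OF assms(1) c(2) assms(2), of _ n]
      by (intro P_bound C_compact_lin pC S_C assms) auto
    ultimately show ?thesis by simp
  qed
  have "(\<lambda>n. c * (1 - (\<Sum>k<n. wt t k))) \<longlonglongrightarrow> c * (1 - 1)"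
    using wt_sums[of t] unfolding sums_def by (intro tendsto_intros)
  then have "(\<lambda>n. c * (1 - (\<Sum>k<n. wt t k))) \<longlonglongrightarrow> 0" by simp
  then have "(\<lambda>n. P (S t \<phi>) V - P (?p n) V) \<longlonglongrightarrow> 0"
    by (rule Lim_null_comparison[OF always_eventually, rotated]) (use b in simp)
  moreover have "(\<lambda>n. P (?p n) V) \<longlonglongrightarrow> S t (P \<phi>) V"
    using S_sums[OF P_C[OF assms(1)], of t V] by (simp add: sums_def Pp)
  ultimately have "(\<lambda>n. P (S t \<phi>) V) \<longlonglongrightarrow> 0 + S t (P \<phi>) V"
    using tendsto_add[of "\<lambda>n. P (S t \<phi>) V - P (?p n) V" 0 sequentially "\<lambda>n. P (?p n) V"] by simp
  then show "P (S t \<phi>) V = S t (P \<phi>) V" by (simp add: LIMSEQ_const_iff)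
qed

lemma A_S_commute:
  assumes "\<phi> \<in> C_compact" "0 \<le> t"
  shows "A (S t \<phi>) = S t (A \<phi>)"
  using S_lin[OF P_C[OF assms(1)] assms(1), of t lam "- lam"] P_S_commute[OF assms]
  by (simp add: A_def[abs_def] algebra_simps fun_eq_iff)

lemma S_lipschitz:
  assumes "\<phi> \<in> C_compact" "\<And>V. \<bar>A \<phi> V\<bar> \<le> d" "0 \<le> s" "0 \<le> t"
  shows "\<bar>S t \<phi> V - S s \<phi> V\<bar> \<le> d * \<bar>t - s\<bar>"
proof -
  have "norm (S t \<phi> V - S s \<phi> V) \<le> d * norm (t - s)"
  proof (rule field_differentiable_bound[where S = "{0..}" and f' = "\<lambda>t. S t (A \<phi>) V"])
    show "norm (S z (A \<phi>) V) \<le> d" if "z \<in> {0..}" for z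
      using S_bound[OF A_C[OF assms(1)] assms(2)] that by simp
  qed (use assms in \<open>auto intro!: S_deriv\<close>)
  then show ?thesis by simp
qed

text \<open>The remainder is governed by \<open>A (A \<phi>)\<close>, which is bounded by
  \<open>(2 * lam)\<^sup>2 * c\<close>. Uniformity in \<open>V\<close> matters: the difference
  quotient will be inserted into a functional that controls only sup norms.\<close>

lemma S_taylor:
  assumes "\<phi> \<in> C_compact" "\<And>V. \<bar>\<phi> V\<bar> \<le> c" "0 \<le> s" "0 \<le> t"
  shows "\<bar>S t \<phi> V - S s \<phi> V - (t - s) * S s (A \<phi>) V\<bar> \<le> 4 * lam\<^sup>2 * c * (t - s)\<^sup>2"
proof -
  let ?g = "\<lambda>r. S r \<phi> V - r * S s (A \<phi>) V"
  let ?I = "closed_segment s t"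
  have I: "z \<ge> 0" if "z \<in> ?I" for z using that assms(3,4) by (auto simp: closed_segment_eq_real_ivl split: if_splits)
  have b: "norm (S z (A \<phi>) V - S s (A \<phi>) V) \<le> (2 * lam * (2 * lam * c)) * \<bar>t - s\<bar>" if "z \<in> ?I" for z
  proof -
    have "\<bar>S z (A \<phi>) V - S s (A \<phi>) V\<bar> \<le> (2 * lam * (2 * lam * c)) * \<bar>z - s\<bar>"
      using I[OF that] assms by (intro S_lipschitz A_C A_bound) auto
    also have "\<dots> \<le> (2 * lam * (2 * lam * c)) * \<bar>t - s\<bar>"
      using that lam_pos bounded_by_nonneg[OF assms(2)]
      by (intro mult_left_mono) (auto simp: closed_segment_eq_real_ivl split: if_splits)
    finally show ?thesis by simp
  qed
  have "norm (?g t - ?g s) \<le> (2 * lam * (2 * lam * c)) * \<bar>t - s\<bar> * norm (t - s)"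
  proof (rule field_differentiable_bound[where S = ?I and f' = "\<lambda>r. S r (A \<phi>) V - S s (A \<phi>) V"])
    show "(?g has_real_derivative S z (A \<phi>) V - S s (A \<phi>) V) (at z within ?I)" for z
      by (auto intro!: derivative_eq_intros S_deriv assms)
  qed (use b in auto)
  also have "(2 * lam * (2 * lam * c)) * \<bar>t - s\<bar> * norm (t - s) = 4 * lam\<^sup>2 * c * (\<bar>t - s\<bar> * \<bar>t - s\<bar>)"
    by (simp add: power2_eq_square)
  also have "\<bar>t - s\<bar> * \<bar>t - s\<bar> = (t - s)\<^sup>2"
    by (simp add: power2_eq_square)
  also have "?g t - ?g s = S t \<phi> V - S s \<phi> V - (t - s) * S s (A \<phi>) V"
    by (simp add: algebra_simps)
  finally show ?thesis by simp
qed

end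

text \<open>A common interface for integrals against the measures of a weak solution and for limits
  of \<open>l0 (S n t \<phi>)\<close> that are not yet known to be measures. \<open>m\<close> is a
  bound for the total mass.\<close>

definition bounded_functional :: "real \<Rightarrow> ((ennreal \<Rightarrow> real) \<Rightarrow> real) \<Rightarrow> bool" where
  "bounded_functional m l \<longleftrightarrow>
     (\<forall>\<phi>\<in>C_compact. \<forall>\<psi>\<in>C_compact. \<forall>a b. l (\<lambda>V. a * \<phi> V + b * \<psi> V) = a * l \<phi> + b * l \<psi>) \<and>
     (\<forall>\<phi>\<in>C_compact. \<forall>c. (\<forall>V. \<bar>\<phi> V\<bar> \<le> c) \<longrightarrow> \<bar>l \<phi>\<bar> \<le> m * c)"

lemma bounded_functionalD:
  assumes "bounded_functional m l"
  shows "\<phi> \<in> C_compact \<Longrightarrow> \<psi> \<in> C_compact \<Longrightarrow> l (\<lambda>V. a * \<phi> V + b * \<psi> V) = a * l \<phi> + b * l \<psi>"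
    and "\<phi> \<in> C_compact \<Longrightarrow> (\<And>V. \<bar>\<phi> V\<bar> \<le> c) \<Longrightarrow> \<bar>l \<phi>\<bar> \<le> m * c"
proof -
  note 1 = conjunct1[OF assms[unfolded bounded_functional_def]]
  note 2 = conjunct2[OF assms[unfolded bounded_functional_def]]
  show "\<phi> \<in> C_compact \<Longrightarrow> \<psi> \<in> C_compact \<Longrightarrow> l (\<lambda>V. a * \<phi> V + b * \<psi> V) = a * l \<phi> + b * l \<psi>"
    by (rule 1[rule_format])
  show "\<phi> \<in> C_compact \<Longrightarrow> (\<And>V. \<bar>\<phi> V\<bar> \<le> c) \<Longrightarrow> \<bar>l \<phi>\<bar> \<le> m * c"
    by (rule 2[rule_format])
qed

lemma bounded_functional_nonneg:
  assumes "bounded_functional m l"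
  shows "0 \<le> m"
  using bounded_functionalD(2)[OF assms, of "\<lambda>_. 1" 1] by simp

lemma bounded_functional_diff:
  assumes "bounded_functional m l" "\<phi> \<in> C_compact" "\<psi> \<in> C_compact"
  shows "l (\<lambda>V. \<phi> V - \<psi> V) = l \<phi> - l \<psi>"
  using bounded_functionalD(1)[OF assms, of 1 "-1"] by simp

lemma bounded_functional_cmult:
  assumes "bounded_functional m l" "\<phi> \<in> C_compact"
  shows "l (\<lambda>V. a * \<phi> V) = a * l \<phi>"
  using bounded_functionalD(1)[OF assms assms(2), of a 0] by simp

lemma bounded_functional_dist:
  assumes "bounded_functional m l" "\<phi> \<in> C_compact" "\<psi> \<in> C_compact" "\<And>V. \<bar>\<phi> V - \<psi> V\<bar> \<le> c"
  shows "\<bar>l \<phi> - l \<psi>\<bar> \<le> m * c"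
  using bounded_functionalD(2)[OF assms(1) C_compact_diff[OF assms(2,3)] assms(4)]
    bounded_functional_diff[OF assms(1-3)] by simp

text \<open>
  The two error quotients are controlled separately: the first uniformly in \<open>V\<close>, the second by the
  weak continuity of the functionals.
\<close>

lemma functional_product_rule:
  assumes l: "\<And>t. t \<in> X \<Longrightarrow> bounded_functional m (l t)" and s: "s \<in> X"
    and u: "\<And>t. t \<in> X \<Longrightarrow> u t \<in> C_compact" and w: "w \<in> C_compact"
    and lim: "\<And>e. e > 0 \<Longrightarrow> \<forall>\<^sub>F t in at s within X. \<forall>V. \<bar>(u t V - u s V) / (t - s) - w V\<bar> \<le> e"
    and cont: "((\<lambda>t. l t w) \<longlongrightarrow> l s w) (at s within X)"
    and deriv: "((\<lambda>t. l t (u s)) has_real_derivative d) (at s within X)"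
  shows "((\<lambda>t. l t (u t)) has_real_derivative (d + l s w)) (at s within X)"
proof -
  have m: "0 \<le> m" using bounded_functional_nonneg[OF l[OF s]] .
  have 1: "((\<lambda>t. l t (\<lambda>V. (u t V - u s V) / (t - s) - w V)) \<longlongrightarrow> 0) (at s within X)"
  proof (rule tendstoI)
    fix e :: real assume "e > 0"
    then have "e / (m + 1) > 0" using m by simp
    from lim[OF this] have "\<forall>\<^sub>F t in at s within X. t \<in> X \<and> (\<forall>V. \<bar>(u t V - u s V) / (t - s) - w V\<bar> \<le> e / (m + 1))"
      by (intro eventually_conj) (auto simp: eventually_at_filter)
    then show "\<forall>\<^sub>F t in at s within X. dist (l t (\<lambda>V. (u t V - u s V) / (t - s) - w V)) 0 < e"
    proof eventually_elim
      case (elim t)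
      have "(\<lambda>V. (1 / (t - s)) * (u t V - u s V)) \<in> C_compact"
        using elim s by (intro C_compact_cmult C_compact_diff u) auto
      then have "(\<lambda>V. (u t V - u s V) / (t - s) - w V) \<in> C_compact"
        by (intro C_compact_diff w) simp
      then have "\<bar>l t (\<lambda>V. (u t V - u s V) / (t - s) - w V)\<bar> \<le> m * (e / (m + 1))"
        using bounded_functionalD(2)[OF l[of t]] elim by blast
      also have "\<dots> < e" using m \<open>e > 0\<close> by (simp add: field_simps)
      finally show ?case by simp
    qed
  qed
  have 2: "((\<lambda>t. (l t (u s) - l s (u s)) / (t - s)) \<longlongrightarrow> d) (at s within X)"
    using deriv by (simp add: has_field_derivative_iff)
  have "((\<lambda>t. l t (\<lambda>V. (u t V - u s V) / (t - s) - w V) + l t w + (l t (u s) - l s (u s)) / (t - s))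
      \<longlongrightarrow> 0 + l s w + d) (at s within X)"
    by (intro tendsto_add 1 2 cont)
  moreover have "\<forall>\<^sub>F t in at s within X.
      l t (\<lambda>V. (u t V - u s V) / (t - s) - w V) + l t w + (l t (u s) - l s (u s)) / (t - s)
      = (l t (u t) - l s (u s)) / (t - s)"
    unfolding eventually_at_filter
  proof (intro always_eventually allI impI)
    fix t assume t: "t \<noteq> s" "t \<in> X"
    note lt = l[OF t(2)]
    have dC: "(\<lambda>V. u t V - u s V) \<in> C_compact" using s t by (intro C_compact_diff u)
    have qC: "(\<lambda>V. (1 / (t - s)) * (u t V - u s V)) \<in> C_compact"
      by (intro C_compact_cmult dC)
    have "l t (\<lambda>V. (1 / (t - s)) * (u t V - u s V) - w V) = l t (\<lambda>V. (1 / (t - s)) * (u t V - u s V)) - l t w"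
      by (intro bounded_functional_diff[OF lt] qC w)
    also have "l t (\<lambda>V. (1 / (t - s)) * (u t V - u s V)) = (1 / (t - s)) * l t (\<lambda>V. u t V - u s V)"
      by (intro bounded_functional_cmult[OF lt] dC)
    also have "l t (\<lambda>V. u t V - u s V) = l t (u t) - l t (u s)"
      using s t by (intro bounded_functional_diff[OF lt] u)
    finally show "l t (\<lambda>V. (u t V - u s V) / (t - s) - w V) + l t w + (l t (u s) - l s (u s)) / (t - s)
      = (l t (u t) - l s (u s)) / (t - s)"
      by (simp add: diff_divide_distrib)
  qed
  ultimately have "((\<lambda>t. (l t (u t) - l s (u s)) / (t - s)) \<longlongrightarrow> 0 + l s w + d) (at s within X)"
    by (rule Lim_transform_eventually)
  then show ?thesis by (simp add: has_field_derivative_iff add.commute)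
qed

context markov_step begin

text \<open>The interpolation s \<mapsto> \<open>l s (S (T - s) \<phi>)\<close> joins
  \<open>l 0 (S T \<phi>)\<close> to \<open>l T \<phi>\<close>. Its derivative is \<open>l s\<close>
  applied to (B - A) of \<open>S (T - s) \<phi>\<close>, hence at most \<open>m * d\<close>. The
  invariance \<open>SD\<close> enters because the evolution equation for \<open>l\<close> is
  available on \<open>D\<close>.\<close>

lemma duhamel:
  assumes T: "0 \<le> T"
    and l: "\<And>t. t \<in> {0..T} \<Longrightarrow> bounded_functional m (l t)"
    and cont: "\<And>\<psi>. \<psi> \<in> C_compact \<Longrightarrow> continuous_on {0..T} (\<lambda>t. l t \<psi>)"
    and deriv: "\<And>\<psi> t. \<psi> \<in> D \<Longrightarrow> t \<in> {0..T} \<Longrightarrow>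
       ((\<lambda>t. l t \<psi>) has_real_derivative l t (B \<psi>)) (at t within {0..T})"
    and B: "\<And>\<psi>. \<psi> \<in> D \<Longrightarrow> B \<psi> \<in> C_compact"
    and BA: "\<And>\<psi> V. \<psi> \<in> D \<Longrightarrow> \<bar>B \<psi> V - A \<psi> V\<bar> \<le> d"
    and \<phi>: "\<phi> \<in> C_compact" and SD: "\<And>t. t \<in> {0..T} \<Longrightarrow> S t \<phi> \<in> D"
  shows "\<bar>l T \<phi> - l 0 (S T \<phi>)\<bar> \<le> m * d * T"
proof -
  let ?u = "\<lambda>s. S (T - s) \<phi>"
  let ?w = "\<lambda>s V. - A (?u s) V"
  obtain c where c: "c \<ge> 0" "\<And>V. \<bar>\<phi> V\<bar> \<le> c" using C_compact_bounded[OF \<phi>] by blast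
  have uC: "?u s \<in> C_compact" if "s \<in> {0..T}" for s using that by (intro S_C \<phi>) auto
  have wC: "?w s \<in> C_compact" if "s \<in> {0..T}" for s
    using C_compact_cmult[OF A_C[OF uC[OF that]], of "-1"] by simp
  have D: "((\<lambda>s. l s (?u s)) has_real_derivative (l s (B (?u s)) + l s (?w s))) (at s within {0..T})"
    if s: "s \<in> {0..T}" for s
  proof (rule functional_product_rule[where m = m and l = l and u = ?u and w = "?w s"])
    fix e :: real assume e: "e > 0"
    \<comment> \<open>The added 1 keeps \<open>K\<close> positive when \<open>c\<close> is 0, so
      that e / K is a legitimate radius.\<close>
    define K where "K = 4 * lam\<^sup>2 * c + 1"
    have K: "K > 0" using c(1) unfolding K_def by (intro add_nonneg_pos) auto
    have "\<forall>\<^sub>F t in at s within {0..T}. dist t s < e / K \<and> t \<in> {0..T} \<and> t \<noteq> s"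
    proof -
      have "\<forall>\<^sub>F t in at s within {0..T}. dist t s < e / K"
        using e K by (intro tendstoD[OF tendsto_ident_at]) simp
      moreover have "\<forall>\<^sub>F t in at s within {0..T}. t \<in> {0..T} \<and> t \<noteq> s"
        by (auto simp: eventually_at_filter)
      ultimately show ?thesis by (rule eventually_conj)
    qed
    then show "\<forall>\<^sub>F t in at s within {0..T}. \<forall>V. \<bar>(?u t V - ?u s V) / (t - s) - ?w s V\<bar> \<le> e"
    proof eventually_elim
      case (elim t)
      show ?case
      proof
        fix V
        have "\<bar>S (T - t) \<phi> V - S (T - s) \<phi> V - ((T - t) - (T - s)) * S (T - s) (A \<phi>) V\<bar>
            \<le> 4 * lam\<^sup>2 * c * ((T - t) - (T - s))\<^sup>2"
          using elim s by (intro S_taylor \<phi> c) auto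
        also have "((T - t) - (T - s))\<^sup>2 = \<bar>t - s\<bar> * \<bar>t - s\<bar>"
          by (simp add: power2_eq_square algebra_simps)
        also have "4 * lam\<^sup>2 * c * (\<bar>t - s\<bar> * \<bar>t - s\<bar>) \<le> K * (\<bar>t - s\<bar> * \<bar>t - s\<bar>)"
          by (intro mult_right_mono) (auto simp: K_def)
        also have "\<dots> = K * \<bar>t - s\<bar> * \<bar>t - s\<bar>" by simp
        also have "\<dots> \<le> e * \<bar>t - s\<bar>"
          using elim K by (intro mult_right_mono) (auto simp: dist_real_def field_simps)
        also have "S (T - s) (A \<phi>) V = A (?u s) V"
          using s by (subst A_S_commute[OF \<phi>]) auto
        finally have *: "\<bar>?u t V - ?u s V - (t - s) * ?w s V\<bar> \<le> e * \<bar>t - s\<bar>"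
          by (simp add: algebra_simps)
        have "(?u t V - ?u s V) / (t - s) - ?w s V = (?u t V - ?u s V - (t - s) * ?w s V) / (t - s)"
        proof -
          have "t - s \<noteq> 0" using elim by simp
          then show ?thesis by (simp add: field_simps del: right_minus_eq)
        qed
        then show "\<bar>(?u t V - ?u s V) / (t - s) - ?w s V\<bar> \<le> e"
          using * elim by (simp add: abs_divide divide_le_eq)
      qed
    qed
  next
    show "((\<lambda>t. l t (?w s)) \<longlongrightarrow> l s (?w s)) (at s within {0..T})"
      using cont[OF wC[OF s]] s by (simp add: continuous_on_def)
    show "((\<lambda>t. l t (?u s)) has_real_derivative l s (B (?u s))) (at s within {0..T})"
      using s by (intro deriv SD) auto
  qed (use s in \<open>auto intro: l uC wC\<close>)
  have b: "norm (l s (B (?u s)) + l s (?w s)) \<le> m * d" if s: "s \<in> {0..T}" for s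
  proof -
    have Du: "?u s \<in> D" using s by (intro SD) auto
    have "l s (?w s) = - l s (A (?u s))"
      using bounded_functional_cmult[OF l[OF s] A_C[OF uC[OF s]], of "-1"] by simp
    moreover have "\<bar>l s (B (?u s)) - l s (A (?u s))\<bar> \<le> m * d"
      by (intro bounded_functional_dist[OF l[OF s]] B A_C uC s Du BA)
    ultimately show ?thesis by simp
  qed
  have "norm (l T (?u T) - l 0 (?u 0)) \<le> m * d * norm (T - 0)"
    by (rule field_differentiable_bound[OF _ D b]) (use T in auto)
  then show ?thesis using T by (simp add: S_0)
qed

end


section \<open>Convergence of the approximating semigroups and uniqueness, at the level of
  functionals\<close>

lemma has_real_derivative_quadratic:
  fixes f :: "real \<Rightarrow> real"
  assumes "\<And>t. t \<in> X \<Longrightarrow> \<bar>f t - f s - (t - s) * d\<bar> \<le> K * (t - s)\<^sup>2"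
  shows "(f has_real_derivative d) (at s within X)"
  unfolding has_field_derivative_iff
proof (rule Lim_transform2)
  show "((\<lambda>t. d) \<longlongrightarrow> d) (at s within X)" by simp
  show "((\<lambda>t. d - (f t - f s) / (t - s)) \<longlongrightarrow> 0) (at s within X)"
  proof (rule Lim_null_comparison)
    show "\<forall>\<^sub>F t in at s within X. norm (d - (f t - f s) / (t - s)) \<le> K * \<bar>t - s\<bar>"
      unfolding eventually_at_filter
    proof (intro always_eventually allI impI)
      fix t assume t: "t \<noteq> s" "t \<in> X"
      have "d - (f t - f s) / (t - s) = - ((f t - f s - (t - s) * d) / (t - s))"
        using t(1) by (simp add: diff_divide_distrib)
      then have "norm (d - (f t - f s) / (t - s)) = \<bar>f t - f s - (t - s) * d\<bar> / \<bar>t - s\<bar>"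
        by (simp only: abs_minus_cancel real_norm_def abs_divide)
      also have "\<dots> \<le> K * (t - s)\<^sup>2 / \<bar>t - s\<bar>"
        using assms[OF t(2)] by (intro divide_right_mono) auto
      also have "K * (t - s)\<^sup>2 / \<bar>t - s\<bar> = K * \<bar>t - s\<bar>"
        using t(1) by (auto simp: power2_eq_square abs_if field_simps)
      finally show "norm (d - (f t - f s) / (t - s)) \<le> K * \<bar>t - s\<bar>" .
    qed
    have "((\<lambda>t. K * \<bar>t - s\<bar>) \<longlongrightarrow> K * \<bar>s - s\<bar>) (at s within X)"
      by (intro tendsto_intros)
    then show "((\<lambda>t. K * \<bar>t - s\<bar>) \<longlongrightarrow> 0) (at s within X)" by simp
  qed
qed

text \<open>A quantitative Trotter-Kato setting. In the applications the index i records a point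
  beyond which functions are constant and a sup or modulus constant, so \<open>D i\<close> is a
  bounded class and not a linear space. Invariance under \<open>S n\<close> with the same i keeps
  the generator error below \<open>del i n\<close> along the whole trajectory.\<close>

locale generator_approximation =
  fixes P :: "nat \<Rightarrow> (ennreal \<Rightarrow> real) \<Rightarrow> ennreal \<Rightarrow> real" and lam :: "nat \<Rightarrow> real"
    and L :: "(ennreal \<Rightarrow> real) \<Rightarrow> ennreal \<Rightarrow> real"
    and D :: "'i \<Rightarrow> (ennreal \<Rightarrow> real) set" and n0 :: "'i \<Rightarrow> nat" and del :: "'i \<Rightarrow> nat \<Rightarrow> real"
  assumes step: "markov_step (P n) (lam n)"
    and D_C: "\<phi> \<in> D i \<Longrightarrow> \<phi> \<in> C_compact"
    and D_S: "\<phi> \<in> D i \<Longrightarrow> n0 i \<le> n \<Longrightarrow> 0 \<le> t \<Longrightarrow> markov_step.S (P n) (lam n) t \<phi> \<in> D i"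
    and L_C: "\<phi> \<in> D i \<Longrightarrow> L \<phi> \<in> C_compact"
    and L_A: "\<phi> \<in> D i \<Longrightarrow> n0 i \<le> n \<Longrightarrow> \<bar>L \<phi> V - markov_step.A (P n) (lam n) \<phi> V\<bar> \<le> del i n"
    and del: "del i \<longlonglongrightarrow> 0"
    and dense: "\<phi> \<in> C_compact \<Longrightarrow> 0 < e \<Longrightarrow> \<exists>i. \<exists>\<psi>\<in>D i. \<forall>V. \<bar>\<phi> V - \<psi> V\<bar> \<le> e"
begin

sublocale Q: markov_step "P n" "lam n" for n by (rule step)

abbreviation "S \<equiv> \<lambda>n. markov_step.S (P n) (lam n)"
abbreviation "A \<equiv> \<lambda>n. markov_step.A (P n) (lam n)"

end

locale generator_approximation_functional = generator_approximation P lam L D n0 del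
  for P lam L and D :: "'i \<Rightarrow> (ennreal \<Rightarrow> real) set" and n0 del +
  fixes m :: real and l0 :: "(ennreal \<Rightarrow> real) \<Rightarrow> real"
  assumes l0: "bounded_functional m l0"
    and l0_pos: "\<phi> \<in> C_compact \<Longrightarrow> (\<And>V. 0 \<le> \<phi> V) \<Longrightarrow> 0 \<le> l0 \<phi>"
begin

lemma m_nonneg: "0 \<le> m" by (rule bounded_functional_nonneg[OF l0])

lemma l0_S_bounded:
  assumes "0 \<le> t"
  shows "bounded_functional m (\<lambda>\<phi>. l0 (S n t \<phi>))"
  unfolding bounded_functional_def
proof (intro conjI ballI allI impI)
  fix \<phi> \<psi> a b assume C: "\<phi> \<in> C_compact" "\<psi> \<in> C_compact"
  then have "l0 (\<lambda>V. a * S n t \<phi> V + b * S n t \<psi> V) = a * l0 (S n t \<phi>) + b * l0 (S n t \<psi>)"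
    using assms by (intro bounded_functionalD(1)[OF l0] Q.S_C)
  then show "l0 (S n t (\<lambda>V. a * \<phi> V + b * \<psi> V)) = a * l0 (S n t \<phi>) + b * l0 (S n t \<psi>)"
    by (simp only: Q.S_lin[OF C])
next
  fix \<phi> c assume "\<phi> \<in> C_compact" "\<forall>V. \<bar>\<phi> V\<bar> \<le> c"
  then show "\<bar>l0 (S n t \<phi>)\<bar> \<le> m * c"
    using assms by (intro bounded_functionalD(2)[OF l0] Q.S_C Q.S_bound) auto
qed

lemma l0_S_deriv:
  assumes \<phi>: "\<phi> \<in> C_compact" and s: "0 \<le> s"
  shows "((\<lambda>t. l0 (S n t \<phi>)) has_real_derivative l0 (S n s (A n \<phi>))) (at s within {0..T})"
proof -
  obtain c where c: "\<And>V. \<bar>\<phi> V\<bar> \<le> c" using C_compact_bounded[OF \<phi>] by blast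
  show ?thesis
  proof (rule has_real_derivative_quadratic)
    fix t assume "t \<in> {0..T}"
    then have t: "0 \<le> t" by simp
    let ?A = "S n s (A n \<phi>)"
    have C: "S n t \<phi> \<in> C_compact" "S n s \<phi> \<in> C_compact" "?A \<in> C_compact"
      using s t \<phi> by (auto intro!: Q.S_C Q.A_C)
    have "\<bar>l0 (\<lambda>V. S n t \<phi> V - S n s \<phi> V - (t - s) * ?A V)\<bar> \<le> m * (4 * (lam n)\<^sup>2 * c * (t - s)\<^sup>2)"
      by (intro bounded_functionalD(2)[OF l0] C_compact_diff C_compact_cmult C Q.S_taylor \<phi> c s t)
    also have "l0 (\<lambda>V. S n t \<phi> V - S n s \<phi> V - (t - s) * ?A V)
      = l0 (\<lambda>V. S n t \<phi> V - S n s \<phi> V) - l0 (\<lambda>V. (t - s) * ?A V)"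
      by (intro bounded_functional_diff[OF l0] C_compact_diff C_compact_cmult C)
    also have "l0 (\<lambda>V. S n t \<phi> V - S n s \<phi> V) = l0 (S n t \<phi>) - l0 (S n s \<phi>)"
      by (intro bounded_functional_diff[OF l0] C)
    also have "l0 (\<lambda>V. (t - s) * ?A V) = (t - s) * l0 ?A"
      by (intro bounded_functional_cmult[OF l0] C)
    finally show "\<bar>l0 (S n t \<phi>) - l0 (S n s \<phi>) - (t - s) * l0 ?A\<bar> \<le> (m * (4 * (lam n)\<^sup>2 * c)) * (t - s)\<^sup>2"
      by (simp only: mult.assoc)
  qed
qed

lemma l0_S_continuous:
  assumes "\<phi> \<in> C_compact"
  shows "continuous_on {0..T} (\<lambda>t. l0 (S n t \<phi>))"
  using l0_S_deriv[OF assms] by (intro DERIV_continuous_on) auto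
 
text \<open>Duhamel's formula for the evolution t \<mapsto> \<open>l0 (S n t \<phi>)\<close>, with
  generator \<open>A n\<close>, against the semigroup \<open>S k\<close>. On \<open>D i\<close> both
  generators are close to \<open>L\<close>, so they differ by at most the sum of the two
  errors.\<close>

lemma l0_S_cauchy:
  assumes \<phi>: "\<phi> \<in> D i" and n: "n0 i \<le> n" "n0 i \<le> k" and t: "0 \<le> t"
  shows "\<bar>l0 (S n t \<phi>) - l0 (S k t \<phi>)\<bar> \<le> m * (del i n + del i k) * t"
proof -
  have "\<bar>l0 (S n t \<phi>) - l0 (S n 0 (S k t \<phi>))\<bar> \<le> m * (del i n + del i k) * t"
  proof (rule Q.duhamel[where l = "\<lambda>t \<phi>. l0 (S n t \<phi>)" and D = "D i" and B = "A n"])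
    show "((\<lambda>t. l0 (S n t \<psi>)) has_real_derivative l0 (S n s (A n \<psi>))) (at s within {0..t})"
      if "\<psi> \<in> D i" "s \<in> {0..t}" for \<psi> s
      using that by (intro l0_S_deriv D_C) auto
    show "\<bar>A n \<psi> V - A k \<psi> V\<bar> \<le> del i n + del i k" if "\<psi> \<in> D i" for \<psi> V
      using L_A[OF that n(1), of V] L_A[OF that n(2), of V] by linarith
    show "S k s \<phi> \<in> D i" if "s \<in> {0..t}" for s using that by (intro D_S \<phi> n) auto
    show "bounded_functional m (\<lambda>\<phi>. l0 (S n s \<phi>))" if "s \<in> {0..t}" for s
      using that by (intro l0_S_bounded) auto
  qed (use t in \<open>auto intro: l0_S_continuous D_C \<phi> Q.A_C\<close>)
  then show ?thesis by (simp add: Q.S_0)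
qed

definition L_sol :: "real \<Rightarrow> (ennreal \<Rightarrow> real) \<Rightarrow> real" where
  "L_sol t \<phi> = lim (\<lambda>n. l0 (S n t \<phi>))"

lemma l0_S_uniformly_Cauchy:
  assumes \<phi>: "\<phi> \<in> C_compact"
  shows "uniformly_Cauchy_on {0..T} (\<lambda>n t. l0 (S n t \<phi>))"
proof (rule uniformly_Cauchy_onI)
  fix e :: real assume e: "e > 0"
  \<comment> \<open>\<open>e'\<close> pays for two density errors \<open>m * e'\<close> and for the
    Duhamel error \<open>m * (2 * e') * \<bar>T\<bar>\<close>; the 1s added to \<open>m\<close> and
    to \<open>\<bar>T\<bar>\<close> keep the denominator positive.\<close>
  define e' where "e' = e / (4 * (m + 1) * (\<bar>T\<bar> + 1))"
  have e': "e' > 0" unfolding e'_def using e m_nonneg by (auto intro!: divide_pos_pos mult_pos_pos)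
  have me: "m * (2 * e' + 2 * e' * \<bar>T\<bar>) < e"
  proof -
    have "m * (2 * e' + 2 * e' * \<bar>T\<bar>) = 2 * m * e' * (\<bar>T\<bar> + 1)" by (simp add: algebra_simps)
    also have "\<dots> < 4 * (m + 1) * e' * (\<bar>T\<bar> + 1)"
      using e' m_nonneg by (intro mult_strict_right_mono) auto
    also have "\<dots> = e' * (4 * (m + 1) * (\<bar>T\<bar> + 1))" by simp
    also have "\<dots> = e" using m_nonneg by (simp add: e'_def)
    finally show ?thesis .
  qed
  obtain i \<psi> where \<psi>: "\<psi> \<in> D i" and d: "\<And>V. \<bar>\<phi> V - \<psi> V\<bar> \<le> e'"
    using dense[OF \<phi> e'] by blast
  have "\<forall>\<^sub>F n in sequentially. dist (del i n) 0 < e' \<and> n0 i \<le> n"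
    by (intro eventually_conj tendstoD[OF del] e' eventually_ge_at_top)
  then obtain N where N: "\<And>n. n \<ge> N \<Longrightarrow> \<bar>del i n\<bar> < e' \<and> n0 i \<le> n"
    by (auto simp: eventually_sequentially)
  have "dist (l0 (S n t \<phi>)) (l0 (S k t \<phi>)) < e" if t: "t \<in> {0..T}" and nk: "N \<le> n" "N \<le> k" for t n k
  proof -
    have t0: "0 \<le> t" "t \<le> \<bar>T\<bar>" using t by auto
    have a: "\<bar>l0 (S j t \<phi>) - l0 (S j t \<psi>)\<bar> \<le> m * e'" for j
      by (intro bounded_functional_dist[OF l0_S_bounded[OF t0(1)]] \<phi> D_C[OF \<psi>] d)
    have "\<bar>l0 (S n t \<psi>) - l0 (S k t \<psi>)\<bar> \<le> m * (del i n + del i k) * t"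
      using N[OF nk(1)] N[OF nk(2)] by (intro l0_S_cauchy \<psi> t0) auto
    also have "m * (del i n + del i k) * t \<le> m * (2 * e') * t"
      using N[OF nk(1)] N[OF nk(2)] m_nonneg t0 by (intro mult_right_mono mult_left_mono) auto
    also have "\<dots> \<le> m * (2 * e') * \<bar>T\<bar>"
      using m_nonneg t0 e' by (intro mult_left_mono) auto
    finally have "\<bar>l0 (S n t \<psi>) - l0 (S k t \<psi>)\<bar> \<le> m * (2 * e') * \<bar>T\<bar>" .
    then have "\<bar>l0 (S n t \<phi>) - l0 (S k t \<phi>)\<bar> \<le> m * (2 * e' + 2 * e' * \<bar>T\<bar>)"
      using a[of n] a[of k] by (simp add: algebra_simps)
    then show ?thesis using me by (simp add: dist_real_def)
  qed
  then show "\<exists>N. \<forall>t\<in>{0..T}. \<forall>n\<ge>N. \<forall>k\<ge>N. dist (l0 (S n t \<phi>)) (l0 (S k t \<phi>)) < e" by blast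
qed

lemma L_sol_uniform:
  assumes "\<phi> \<in> C_compact"
  shows "uniform_limit {0..T} (\<lambda>n t. l0 (S n t \<phi>)) (\<lambda>t. L_sol t \<phi>) sequentially"
proof -
  obtain g where g: "uniform_limit {0..T} (\<lambda>n t. l0 (S n t \<phi>)) g sequentially"
    using Cauchy_uniformly_convergent[OF l0_S_uniformly_Cauchy[OF assms]]
    unfolding uniformly_convergent_on_def by blast
  have "g t = L_sol t \<phi>" if "t \<in> {0..T}" for t
    using tendsto_uniform_limitI[OF g that] unfolding L_sol_def by (simp add: limI)
  note eq = this
  show ?thesis
  proof (rule uniform_limitI)
    fix e :: real assume "e > 0"
    from uniform_limitD[OF g this]
    show "\<forall>\<^sub>F n in sequentially. \<forall>t\<in>{0..T}. dist (l0 (S n t \<phi>)) (L_sol t \<phi>) < e"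
      by eventually_elim (auto simp: eq)
  qed
qed

lemma L_sol_tendsto:
  assumes "\<phi> \<in> C_compact" "0 \<le> t"
  shows "(\<lambda>n. l0 (S n t \<phi>)) \<longlonglongrightarrow> L_sol t \<phi>"
  using tendsto_uniform_limitI[OF L_sol_uniform[OF assms(1), of t], of t] assms(2) by simp

lemma L_sol_bounded:
  assumes t: "0 \<le> t"
  shows "bounded_functional m (L_sol t)"
  unfolding bounded_functional_def
proof (intro conjI ballI allI impI)
  fix \<phi> \<psi> a b assume C: "\<phi> \<in> C_compact" "\<psi> \<in> C_compact"
  have "(\<lambda>n. a * l0 (S n t \<phi>) + b * l0 (S n t \<psi>)) \<longlonglongrightarrow> a * L_sol t \<phi> + b * L_sol t \<psi>"
    by (intro tendsto_intros L_sol_tendsto C t)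
  moreover have "(\<lambda>n. l0 (S n t (\<lambda>V. a * \<phi> V + b * \<psi> V))) \<longlonglongrightarrow> L_sol t (\<lambda>V. a * \<phi> V + b * \<psi> V)"
    by (intro L_sol_tendsto C_compact_lin C t)
  moreover have "l0 (S n t (\<lambda>V. a * \<phi> V + b * \<psi> V)) = a * l0 (S n t \<phi>) + b * l0 (S n t \<psi>)" for n
    by (rule bounded_functionalD(1)[OF l0_S_bounded[OF t] C])
  ultimately show "L_sol t (\<lambda>V. a * \<phi> V + b * \<psi> V) = a * L_sol t \<phi> + b * L_sol t \<psi>"
    by (simp only:) (rule LIMSEQ_unique)
next
  fix \<phi> c assume C: "\<phi> \<in> C_compact" "\<forall>V. \<bar>\<phi> V\<bar> \<le> c"
  have "\<bar>l0 (S n t \<phi>)\<bar> \<le> m * c" for n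
    by (rule bounded_functionalD(2)[OF l0_S_bounded[OF t] C(1)]) (use C in auto)
  moreover have "(\<lambda>n. \<bar>l0 (S n t \<phi>)\<bar>) \<longlonglongrightarrow> \<bar>L_sol t \<phi>\<bar>"
    by (intro tendsto_rabs L_sol_tendsto C t)
  ultimately show "\<bar>L_sol t \<phi>\<bar> \<le> m * c" by (intro LIMSEQ_le_const2) auto
qed

lemma L_sol_pos:
  assumes "\<phi> \<in> C_compact" "\<And>V. 0 \<le> \<phi> V" "0 \<le> t"
  shows "0 \<le> L_sol t \<phi>"
proof (rule LIMSEQ_le_const[OF L_sol_tendsto[OF assms(1,3)]])
  have "0 \<le> l0 (S n t \<phi>)" for n by (intro l0_pos Q.S_C Q.S_pos assms)
  then show "\<exists>N. \<forall>n\<ge>N. 0 \<le> l0 (S n t \<phi>)" by blast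
qed

lemma L_sol_0: "\<phi> \<in> C_compact \<Longrightarrow> L_sol 0 \<phi> = l0 \<phi>"
  unfolding L_sol_def by (simp add: Q.S_0)

lemma L_sol_continuous: "\<phi> \<in> C_compact \<Longrightarrow> continuous_on {0..T} (\<lambda>t. L_sol t \<phi>)"
  by (rule uniform_limit_theorem[OF always_eventually L_sol_uniform]) (auto intro: l0_S_continuous)

text \<open>Differentiation of a limit. The derivatives \<open>l0 (S n x (A n \<phi>))\<close>
  converge uniformly in x: replacing \<open>A n \<phi>\<close> by the fixed function
  \<open>L \<phi>\<close> costs \<open>m * del i n\<close>, and on a fixed continuous function the
  approximations converge uniformly on compact time intervals.\<close>

lemma L_sol_deriv:
  assumes \<phi>: "\<phi> \<in> D i" and t: "t \<in> {0..T}"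
  shows "((\<lambda>t. L_sol t \<phi>) has_real_derivative L_sol t (L \<phi>)) (at t within {0..T})"
proof -
  have "\<exists>g. \<forall>x\<in>{0..T}. (\<lambda>n. l0 (S n x \<phi>)) \<longlonglongrightarrow> g x \<and> (g has_derivative (\<lambda>h. L_sol x (L \<phi>) * h)) (at x within {0..T})"
  proof (rule has_derivative_sequence)
    show "((\<lambda>t. l0 (S n t \<phi>)) has_derivative (\<lambda>h. l0 (S n x (A n \<phi>)) * h)) (at x within {0..T})"
      if "x \<in> {0..T}" for n x
      using l0_S_deriv[OF D_C[OF \<phi>], of x n T] that by (simp add: has_field_derivative_def)
    show "\<forall>\<^sub>F n in sequentially. \<forall>x\<in>{0..T}. \<forall>h. norm (l0 (S n x (A n \<phi>)) * h - L_sol x (L \<phi>) * h) \<le> e * norm h"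
      if e: "e > 0" for e
    proof -
      have e': "e / (2 * (m + 1)) > 0" "e / 2 > 0" using e m_nonneg by auto
      have "\<forall>\<^sub>F n in sequentially. dist (del i n) 0 < e / (2 * (m + 1)) \<and> n0 i \<le> n \<and>
        (\<forall>x\<in>{0..T}. dist (l0 (S n x (L \<phi>))) (L_sol x (L \<phi>)) < e / 2)"
        by (intro eventually_conj tendstoD[OF del] e' eventually_ge_at_top
            uniform_limitD[OF L_sol_uniform[OF L_C[OF \<phi>]]])
      then show ?thesis
      proof eventually_elim
        case (elim n)
        show ?case
        proof (intro ballI allI)
          fix x h assume x: "x \<in> {0..T}"
          then have x0: "0 \<le> x" by simp
          have "\<bar>l0 (S n x (A n \<phi>)) - l0 (S n x (L \<phi>))\<bar> \<le> m * del i n"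
          proof (rule bounded_functional_dist[OF l0_S_bounded[OF x0]])
            show "\<bar>A n \<phi> V - L \<phi> V\<bar> \<le> del i n" for V
              using L_A[OF \<phi>, of n V] elim by (simp add: abs_minus_commute)
          qed (auto intro: Q.A_C D_C[OF \<phi>] L_C[OF \<phi>])
          also have "\<dots> \<le> m * (e / (2 * (m + 1)))"
            using elim m_nonneg by (intro mult_left_mono) auto
          also have "\<dots> \<le> e / 2" using e m_nonneg by (simp add: field_simps)
          finally have "\<bar>l0 (S n x (A n \<phi>)) - l0 (S n x (L \<phi>))\<bar> \<le> e / 2" .
          moreover have "\<bar>l0 (S n x (L \<phi>)) - L_sol x (L \<phi>)\<bar> < e / 2"
            using elim x by (simp add: dist_real_def)
          ultimately have "\<bar>l0 (S n x (A n \<phi>)) - L_sol x (L \<phi>)\<bar> \<le> e" by linarith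
          then have "\<bar>l0 (S n x (A n \<phi>)) - L_sol x (L \<phi>)\<bar> * \<bar>h\<bar> \<le> e * \<bar>h\<bar>"
            by (intro mult_right_mono) auto
          then show "norm (l0 (S n x (A n \<phi>)) * h - L_sol x (L \<phi>) * h) \<le> e * norm h"
            by (simp add: abs_mult flip: left_diff_distrib)
        qed
      qed
    qed
    show "(\<lambda>n. l0 (S n t \<phi>)) \<longlonglongrightarrow> L_sol t \<phi>" using t by (intro L_sol_tendsto D_C[OF \<phi>]) auto
  qed (use t in auto)
  then obtain g where g: "\<And>x. x \<in> {0..T} \<Longrightarrow> (\<lambda>n. l0 (S n x \<phi>)) \<longlonglongrightarrow> g x"
    "\<And>x. x \<in> {0..T} \<Longrightarrow> (g has_derivative (\<lambda>h. L_sol x (L \<phi>) * h)) (at x within {0..T})" by blast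
  have "g x = L_sol x \<phi>" if "x \<in> {0..T}" for x
    using LIMSEQ_unique[OF g(1)[OF that] L_sol_tendsto[OF D_C[OF \<phi>]]] that by simp
  then have "((\<lambda>t. L_sol t \<phi>) has_derivative (\<lambda>h. L_sol t (L \<phi>) * h)) (at t within {0..T})"
    using has_derivative_transform[OF t, of "\<lambda>t. L_sol t \<phi>" g] g(2)[OF t] by simp
  then show ?thesis by (simp add: has_field_derivative_def)
qed

text \<open>On a class \<open>D i\<close>, Duhamel's formula with \<open>B = L\<close> compares the
  given family with \<open>S n\<close>, and the error \<open>m' * del i n * T\<close> vanishes;
  density extends the equality to all continuous functions. \<open>m'\<close> is separate from
  \<open>m\<close> because an arbitrary solution comes only with some bound on its mass.\<close>

lemma L_sol_unique:
  assumes T: "0 \<le> T"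
    and l: "\<And>t. t \<in> {0..T} \<Longrightarrow> bounded_functional m' (l t)"
    and cont: "\<And>\<psi>. \<psi> \<in> C_compact \<Longrightarrow> continuous_on {0..T} (\<lambda>t. l t \<psi>)"
    and deriv: "\<And>i \<psi> t. \<psi> \<in> D i \<Longrightarrow> t \<in> {0..T} \<Longrightarrow>
       ((\<lambda>t. l t \<psi>) has_real_derivative l t (L \<psi>)) (at t within {0..T})"
    and l_0: "\<And>\<psi>. \<psi> \<in> C_compact \<Longrightarrow> l 0 \<psi> = l0 \<psi>"
    and \<phi>: "\<phi> \<in> C_compact"
  shows "l T \<phi> = L_sol T \<phi>"
proof -
  have lT: "bounded_functional m' (l T)" using l T by auto
  have m': "0 \<le> m'" by (rule bounded_functional_nonneg[OF lT])
  have DD: "l T \<psi> = L_sol T \<psi>" if \<psi>: "\<psi> \<in> D i" for \<psi> i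
  proof -
    have "\<bar>l T \<psi> - l0 (S n T \<psi>)\<bar> \<le> m' * del i n * T" if n: "n0 i \<le> n" for n
    proof -
      have "\<bar>l T \<psi> - l 0 (S n T \<psi>)\<bar> \<le> m' * del i n * T"
      proof (rule Q.duhamel[where l = l and D = "D i" and B = L])
        show "S n s \<psi> \<in> D i" if "s \<in> {0..T}" for s using that by (intro D_S \<psi> n) auto
        show "\<psi> \<in> C_compact" by (rule D_C[OF \<psi>])
      qed (fact T l cont deriv L_C L_A[OF _ n])+
      then show ?thesis using T by (subst (asm) l_0) (auto intro: Q.S_C D_C[OF \<psi>])
    qed
    then have "\<forall>\<^sub>F n in sequentially. norm (l0 (S n T \<psi>) - l T \<psi>) \<le> m' * del i n * T"
      by (intro eventually_mono[OF eventually_ge_at_top[of "n0 i"]]) (simp add: abs_minus_commute)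
    moreover have "(\<lambda>n. m' * del i n * T) \<longlonglongrightarrow> 0"
      using tendsto_mult[OF tendsto_mult[OF tendsto_const[of m'] del] tendsto_const[of T]] by simp
    ultimately have "(\<lambda>n. l0 (S n T \<psi>) - l T \<psi>) \<longlonglongrightarrow> 0"
      by (rule Lim_null_comparison)
    then have "(\<lambda>n. l0 (S n T \<psi>)) \<longlonglongrightarrow> l T \<psi>" by (simp add: LIM_zero_iff)
    then show ?thesis using LIMSEQ_unique L_sol_tendsto[OF D_C[OF \<psi>] T] by blast
  qed
  have "\<bar>l T \<phi> - L_sol T \<phi>\<bar> \<le> 0 + e" if e: "e > 0" for e
  proof -
    have e': "e / (m + m' + 1) > 0" using e m' m_nonneg by simp
    obtain i \<psi> where \<psi>: "\<psi> \<in> D i" and d: "\<And>V. \<bar>\<phi> V - \<psi> V\<bar> \<le> e / (m + m' + 1)"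
      using dense[OF \<phi> e'] by blast
    have "\<bar>l T \<phi> - l T \<psi>\<bar> \<le> m' * (e / (m + m' + 1))"
      by (intro bounded_functional_dist[OF lT] \<phi> D_C[OF \<psi>] d)
    moreover have "\<bar>L_sol T \<phi> - L_sol T \<psi>\<bar> \<le> m * (e / (m + m' + 1))"
      by (intro bounded_functional_dist[OF L_sol_bounded[OF T]] \<phi> D_C[OF \<psi>] d)
    moreover have "m' * (e / (m + m' + 1)) + m * (e / (m + m' + 1)) \<le> e"
    proof -
      have "m' * (e / (m + m' + 1)) + m * (e / (m + m' + 1)) = (m + m') * (e / (m + m' + 1))"
        by (simp only: distrib_right add.commute)
      also have "\<dots> \<le> (m + m' + 1) * (e / (m + m' + 1))"
        using e' by (intro mult_right_mono) auto
      also have "\<dots> = e" using m' m_nonneg by simp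
      finally show ?thesis .
    qed
    ultimately show ?thesis using DD[OF \<psi>] by linarith
  qed
  then have "\<bar>l T \<phi> - L_sol T \<phi>\<bar> \<le> 0" by (rule field_le_epsilon)
  then show ?thesis by simp
qed

end

section \<open>Radon measures on the compactified half-line\<close>

lemma radon_measuresD:
  assumes "\<mu> \<in> radon_measures"
  shows "sets \<mu> = sets borel" "space \<mu> = UNIV" "finite_measure \<mu>"
  using assms sets_eq_imp_space_eq[of \<mu> borel] by (auto simp: radon_measures_def)

lemma radon_integrable:
  assumes \<mu>: "\<mu> \<in> radon_measures" and \<psi>: "\<psi> \<in> C_compact"
  shows "integrable \<mu> \<psi>"
proof -
  interpret finite_measure \<mu> by (rule radon_measuresD[OF \<mu>])
  obtain c where c: "\<And>V. \<bar>\<psi> V\<bar> \<le> c" using C_compact_bounded[OF \<psi>] by blast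
  have "\<psi> \<in> borel_measurable \<mu>"
    using \<psi> borel_measurable_continuous_onI[of \<psi>] radon_measuresD(1)[OF \<mu>]
    by (simp add: C_compact_def cong: measurable_cong_sets)
  then show ?thesis using c by (intro integrable_const_bound[where B = c]) auto
qed

lemma radon_bounded_functional:
  assumes \<mu>: "\<mu> \<in> radon_measures"
  shows "bounded_functional (measure \<mu> UNIV) (\<lambda>\<psi>. \<integral>V. \<psi> V \<partial>\<mu>)"
proof -
  interpret finite_measure \<mu> by (rule radon_measuresD[OF \<mu>])
  note i = radon_integrable[OF \<mu>]
  show ?thesis unfolding bounded_functional_def
  proof (intro conjI ballI allI impI)
    fix \<phi> c assume \<phi>: "\<phi> \<in> C_compact" "\<forall>V. \<bar>\<phi> V\<bar> \<le> c"
    have "\<bar>\<integral>V. \<phi> V \<partial>\<mu>\<bar> \<le> (\<integral>V. \<bar>\<phi> V\<bar> \<partial>\<mu>)" by (rule integral_abs_bound)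
    also have "\<dots> \<le> (\<integral>V. c \<partial>\<mu>)"
      using \<phi> i by (intro integral_mono integrable_abs) auto
    finally show "\<bar>\<integral>V. \<phi> V \<partial>\<mu>\<bar> \<le> measure \<mu> UNIV * c"
      by (simp add: radon_measuresD(2)[OF \<mu>])
  qed (use i in simp)
qed

text \<open>The order-reversing homeomorphism V \<mapsto> 1 / (1 + V) of [0, \<infinity>] onto
  [0, 1], with inverse \<open>of_unit_coord\<close>. It brings Bernstein polynomials and weak
  convergence on the real line to the compactified half-line.\<close>

definition unit_coord :: "ennreal \<Rightarrow> real" where
  "unit_coord V = enn2real (inverse (1 + V))"

definition of_unit_coord :: "real \<Rightarrow> ennreal" where
  "of_unit_coord x = inverse (ennreal x) - 1"

lemma unit_coord_ennreal: "0 \<le> r \<Longrightarrow> unit_coord (ennreal r) = 1 / (1 + r)"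
proof -
  assume r: "0 \<le> r"
  then have "1 + ennreal r = ennreal (1 + r)" by simp
  then show ?thesis using r
    by (simp only: unit_coord_def) (simp add: inverse_ennreal divide_inverse del: ennreal_plus)
qed

lemma unit_coord_top: "unit_coord top = 0"
  by (simp add: unit_coord_def)

lemma of_unit_coord_unit_coord: "of_unit_coord (unit_coord V) = V"
proof (cases V)
  case (real r)
  have "inverse (ennreal (1 / (1 + r))) = ennreal (1 + r)"
    using real(1) by (simp add: inverse_ennreal del: ennreal_plus)
  moreover have "ennreal (1 + r) - ennreal 1 = ennreal r"
    using real(1) by (subst ennreal_minus) auto
  ultimately show ?thesis using real by (simp only: unit_coord_ennreal of_unit_coord_def) simp
next
  case top
  then show ?thesis by (simp add: unit_coord_top of_unit_coord_def)
qed

lemma unit_coord_range: "unit_coord V \<in> {0..1}"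
  by (cases V) (auto simp: unit_coord_ennreal unit_coord_top field_simps)

lemma range_unit_coord: "range unit_coord = {0..1}"
proof
  show "{0..1} \<subseteq> range unit_coord"
  proof
    fix x :: real assume x: "x \<in> {0..1}"
    show "x \<in> range unit_coord"
    proof (cases "x = 0")
      case False
      then have "unit_coord (ennreal (1 / x - 1)) = x"
        using x by (subst unit_coord_ennreal) (auto simp: field_simps)
      then show ?thesis by (metis rangeI)
    qed (metis rangeI unit_coord_top)
  qed
qed (use unit_coord_range in auto)

lemma continuous_unit_coord: "continuous_on UNIV unit_coord"
  unfolding continuous_on_def
proof
  fix V :: ennreal
  have "((\<lambda>V. inverse (1 + V)) \<longlongrightarrow> inverse (1 + V)) (at V)"
    using continuous_on_inverse_ennreal[OF continuous_on_add_ennreal[OF continuous_on_const continuous_on_id], of UNIV 1]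
    by (auto simp: continuous_on_def)
  moreover have "inverse (1 + V) = ennreal (enn2real (inverse (1 + V)))"
  proof (cases V)
    case (real r)
    then have "1 + V = ennreal (1 + r)" by simp
    then show ?thesis using real(1) by (simp add: inverse_ennreal del: ennreal_plus)
  qed simp
  ultimately show "(unit_coord \<longlongrightarrow> unit_coord V) (at V)"
    unfolding unit_coord_def[abs_def] by (intro tendsto_enn2real) auto
qed

lemma continuous_of_unit_coord: "continuous_on {0..1} of_unit_coord"
  using continuous_on_inv[OF continuous_unit_coord compact_UNIV, of of_unit_coord]
  by (simp add: of_unit_coord_unit_coord range_unit_coord)

lemma unit_coord_less_iff: "unit_coord V < unit_coord W \<longleftrightarrow> W < V"
proof (cases V; cases W)
  fix r s assume rs: "0 \<le> r" "V = ennreal r" "0 \<le> s" "W = ennreal s"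
  then show ?thesis by (simp add: unit_coord_ennreal ennreal_less_iff field_simps)
qed (auto simp: unit_coord_ennreal unit_coord_top)

text \<open>Open upper rays together with the whole space form an intersection-stable generator of
  the Borel sets, and the indicator of a ray is a bounded pointwise limit of continuous ramps that
  steepen in the unit coordinate. The order reversal of that coordinate explains the sign inside
  \<open>?f\<close>.\<close>

lemma radon_measure_eqI:
  assumes \<mu>: "\<mu> \<in> radon_measures" and \<nu>: "\<nu> \<in> radon_measures"
    and eq: "\<And>\<psi>. \<psi> \<in> C_compact \<Longrightarrow> (\<integral>V. \<psi> V \<partial>\<mu>) = (\<integral>V. \<psi> V \<partial>\<nu>)"
  shows "\<mu> = \<nu>"
proof -
  let ?f = "\<lambda>a (k::nat) V. min 1 (max 0 (real k * (unit_coord a - unit_coord V)))"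
  have fC: "?f a k \<in> C_compact" for a k
    using continuous_unit_coord by (auto simp: C_compact_def intro!: continuous_intros)
  have lim: "(\<lambda>k. ?f a k V) \<longlonglongrightarrow> indicator {a<..} V" for a V
  proof (cases "a < V")
    case True
    then have d: "unit_coord a - unit_coord V > 0" by (simp add: unit_coord_less_iff)
    obtain n where n: "1 / (unit_coord a - unit_coord V) < real n" using reals_Archimedean2 by blast
    have "\<forall>\<^sub>F k in sequentially. ?f a k V = 1"
      using eventually_ge_at_top[of n]
    proof eventually_elim
      case (elim k)
      have "1 < real n * (unit_coord a - unit_coord V)" using n d by (simp add: field_simps)
      also have "\<dots> \<le> real k * (unit_coord a - unit_coord V)"
        using elim d by (intro mult_right_mono) auto
      finally show ?case by simp
    qed
    then show ?thesis using True by (auto intro: tendsto_eventually)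
  next
    case False
    then have "unit_coord a - unit_coord V \<le> 0" using unit_coord_less_iff[of V a] by linarith
    then have "?f a k V = 0" for k
      using mult_nonneg_nonpos[of "real k" "unit_coord a - unit_coord V"] by simp
    then show ?thesis using False by simp
  qed
  have meas: "(\<lambda>k. \<integral>V. ?f a k V \<partial>\<rho>) \<longlonglongrightarrow> measure \<rho> {a<..}" if \<rho>: "\<rho> \<in> radon_measures" for \<rho> a
  proof -
    note s = radon_measuresD[OF \<rho>]
    interpret finite_measure \<rho> by (rule s)
    have "(\<lambda>k. \<integral>V. ?f a k V \<partial>\<rho>) \<longlonglongrightarrow> (\<integral>V. indicator {a<..} V \<partial>\<rho>)"
    proof (rule integral_dominated_convergence[where w = "\<lambda>_. 1"])
      show "(\<lambda>V. indicator {a<..} V :: real) \<in> borel_measurable \<rho>" using s by (intro borel_measurable_indicator) simp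
      show "?f a k \<in> borel_measurable \<rho>" for k using radon_integrable[OF \<rho> fC] by blast
    qed (use lim in auto)
    then show ?thesis using s by simp
  qed
  interpret \<mu>: finite_measure \<mu> by (rule radon_measuresD[OF \<mu>])
  interpret \<nu>: finite_measure \<nu> by (rule radon_measuresD[OF \<nu>])
  have 1: "emeasure \<mu> {a<..} = emeasure \<nu> {a<..}" for a
    using LIMSEQ_unique[OF meas[OF \<mu>, of a]] meas[OF \<nu>, of a]
    by (simp add: eq[OF fC] \<mu>.emeasure_eq_measure \<nu>.emeasure_eq_measure)
  have 2: "emeasure \<mu> UNIV = emeasure \<nu> UNIV"
    using eq[of "\<lambda>_. 1"] radon_measuresD[OF \<mu>] radon_measuresD[OF \<nu>]
    by (simp add: \<mu>.emeasure_eq_measure \<nu>.emeasure_eq_measure)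
  \<comment> \<open>\<open>UNIV\<close> is added to supply an exhausting sequence of sets of finite
    measure; no ray of this form contains 0.\<close>
  let ?E = "insert UNIV (range greaterThan) :: ennreal set set"
  have gen: "sets (borel :: ennreal measure) = sigma_sets UNIV ?E"
  proof -
    have "sets (borel :: ennreal measure) = sigma_sets UNIV (range greaterThan)"
      by (subst borel_Ioi) simp
    also have "\<dots> = sigma_sets UNIV ?E"
      by (intro sigma_sets_eqI) (auto intro: sigma_sets_top)
    finally show ?thesis .
  qed
  show ?thesis
  proof (rule measure_eqI_generator_eq[where E = ?E and \<Omega> = UNIV and A = "\<lambda>_. UNIV"])
    have "{a<..} \<inter> {b<..} = {max a b<..}" for a b :: ennreal by auto
    then show "Int_stable ?E" unfolding Int_stable_def by auto
  qed (use 1 2 gen radon_measuresD[OF \<mu>] radon_measuresD[OF \<nu>] in auto)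
qed

text \<open>
  The Bernstein operators turn \<open>\<Lambda>\<close> into point measures on the unit interval, a tight sequence; any
  weak limit represents \<open>\<Lambda>\<close>.
\<close>

theorem radon_representation:
  assumes bf: "bounded_functional m \<Lambda>"
    and pos: "\<And>\<phi>. \<phi> \<in> C_compact \<Longrightarrow> (\<And>V. 0 \<le> \<phi> V) \<Longrightarrow> 0 \<le> \<Lambda> \<phi>"
  shows "\<exists>\<mu>\<in>radon_measures. \<forall>\<phi>\<in>C_compact. (\<integral>V. \<phi> V \<partial>\<mu>) = \<Lambda> \<phi>"
\<comment> \<open>The degenerate case is split off because the point weights below are normalized by
  \<Lambda> 1. By positivity, \<Lambda> 1 = 0 forces \<Lambda> to vanish.\<close>
proof (cases "\<Lambda> (\<lambda>_. 1) = 0")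
  case True
  have "\<Lambda> \<phi> = 0" if \<phi>: "\<phi> \<in> C_compact" for \<phi>
  proof -
    obtain c where c: "\<And>V. \<bar>\<phi> V\<bar> \<le> c" using C_compact_bounded[OF \<phi>] by blast
    have "0 \<le> \<Lambda> (\<lambda>V. c * 1 + a * \<phi> V)" if "\<bar>a\<bar> = 1" for a
    proof (intro pos C_compact_lin \<phi> C_compact_const)
      show "0 \<le> c * 1 + a * \<phi> V" for V using c[of V] that by (auto simp: abs_if split: if_splits)
    qed
    from this[of 1] this[of "-1"] show ?thesis
      using bounded_functionalD(1)[OF bf C_compact_const \<phi>, of c 1 1] bounded_functionalD(1)[OF bf C_compact_const \<phi>, of c 1 "-1"]
      by (simp add: True)
  qed
  moreover have "null_measure borel \<in> radon_measures"
    by (auto simp: radon_measures_def intro!: finite_measureI)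
  ultimately show ?thesis by (intro bexI[of _ "null_measure borel"]) auto
next
  case False
  define m0 where "m0 = \<Lambda> (\<lambda>_. 1)"
  have m0: "m0 > 0" using False pos[of "\<lambda>_. 1"] unfolding m0_def by simp
  define B where "B n k V = Bernstein n k (unit_coord V)" for n k V
  have BC: "B n k \<in> C_compact" for n k
    unfolding B_def Bernstein_def C_compact_def using continuous_unit_coord by (auto intro!: continuous_intros)
  have B0: "0 \<le> B n k V" for n k V
    using unit_coord_range[of V] by (auto simp: B_def intro: Bernstein_nonneg)
  have Lsum: "\<Lambda> (\<lambda>V. \<Sum>k\<in>K. a k * B n k V) = (\<Sum>k\<in>K. a k * \<Lambda> (B n k))" if "finite K" for K a n
    using that
  proof induction
    case empty
    then show ?case using bounded_functional_cmult[OF bf C_compact_const, of 0 1] by simp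
  next
    case (insert k K)
    then show ?case
      using bounded_functionalD(1)[OF bf BC C_compact_sum[of K "B n" a], of "a k" n k 1] BC by simp
  qed
  \<comment> \<open>Since the Bernstein basis is a partition of unity, these weights are
    probabilities. Placed at the nodes k / n they make integration against \<open>M n\<close> the
    same as applying \<Lambda> to a Bernstein polynomial, up to the factor
    \<open>m0\<close>.\<close>
  define w where "w n k = \<Lambda> (B n k) / m0" for n k
  have w0: "0 \<le> w n k" for n k unfolding w_def using m0 by (auto intro!: divide_nonneg_pos pos BC B0)
  have w1: "(\<Sum>k\<le>n. w n k) = 1" for n
    using Lsum[of "{..n}" "\<lambda>_. 1" n] m0
    by (simp add: w_def B_def m0_def flip: sum_divide_distrib)
  define N where "N n = density (count_space {..n}) (\<lambda>k. ennreal (w n k))" for n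
  define M where "M n = distr (N n) borel (\<lambda>k. real k / real n)" for n
  have Nem: "emeasure (N n) {..n} = 1" for n
    unfolding N_def using w0 w1[of n]
    by (subst emeasure_density) (auto simp: nn_integral_count_space_finite sum_ennreal)
  interpret N: prob_space "N n" for n
    by (rule prob_spaceI) (use Nem in \<open>simp add: N_def\<close>)
  have Mreal: "real_distribution (M n)" for n
  proof -
    have "prob_space (M n)" unfolding M_def by (rule N.prob_space_distr) (simp add: N_def)
    then show ?thesis unfolding real_distribution_def real_distribution_axioms_def by (simp add: M_def)
  qed
  have Mint: "(\<integral>x. \<psi> x \<partial>M n) = (\<Sum>k\<le>n. w n k * \<psi> (real k / real n))"
    if "\<psi> \<in> borel_measurable borel" for \<psi> :: "real \<Rightarrow> real" and n
    unfolding M_def N_def using that w0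
    by (subst integral_distr; simp?; subst integral_density) (auto simp: lebesgue_integral_count_space_finite)
  have "tight M"
    unfolding tight_def
  proof (intro conjI allI impI)
    fix e :: real assume e: "e > 0"
    \<comment> \<open>Tightness is stated with half-open intervals; the left end -1 keeps a possible
      atom at 0 inside.\<close>
    have "measure (M n) {-1<..1} = 1" for n
    proof -
      have "(\<lambda>k. real k / real n) -` {-1<..1} \<inter> space (N n) = {..n}"
      proof -
        have "-1 < real k / real n" for k by (rule less_le_trans[of _ 0]) auto
        then show ?thesis by (auto simp: N_def divide_le_eq)
      qed
      moreover have "emeasure (M n) {-1<..1} = emeasure (N n) ((\<lambda>k. real k / real n) -` {-1<..1} \<inter> space (N n))"
        unfolding M_def by (rule emeasure_distr) (auto simp: N_def)
      ultimately have "emeasure (M n) {-1<..1} = 1" by (simp add: Nem)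
      then show ?thesis by (simp add: measure_def)
    qed
    then show "\<exists>a b. a < b \<and> (\<forall>n. 1 - e < measure (M n) {a<..b})"
      using e by (intro exI[of _ "-1"] exI[of _ 1]) auto
  qed (rule Mreal)
  from tight_imp_convergent_subsubsequence[OF this strict_mono_id]
  obtain r R where r: "strict_mono (r :: nat \<Rightarrow> nat)" and R: "real_distribution R"
    and conv: "weak_conv_m (M \<circ> id \<circ> r) R" by blast
  interpret R: real_distribution R by (rule R)
  \<comment> \<open>Clamping to [0, 1] extends the inverse coordinate continuously to the whole
    line, on which the limit distribution \<open>R\<close> is defined.\<close>
  define q where "q x = of_unit_coord (max 0 (min 1 x))" for x
  have qC: "continuous_on UNIV q"
    unfolding q_def by (rule continuous_on_compose2[OF continuous_of_unit_coord]) (auto intro!: continuous_intros)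
  have qu: "q (unit_coord V) = V" for V
    using unit_coord_range[of V] by (simp add: q_def of_unit_coord_unit_coord)
  have main: "m0 * (\<integral>x. \<phi> (q x) \<partial>R) = \<Lambda> \<phi>" if \<phi>: "\<phi> \<in> C_compact" for \<phi>
  proof -
    obtain c where c: "\<And>V. \<bar>\<phi> V\<bar> \<le> c" using C_compact_bounded[OF \<phi>] by blast
    let ?g = "\<lambda>x. \<phi> (q x)"
    have gc: "continuous_on UNIV ?g"
      using \<phi> by (intro continuous_on_compose2[OF _ qC]) (auto simp: C_compact_def)
    then have gm: "?g \<in> borel_measurable borel" by (rule borel_measurable_continuous_onI)
    have lim1: "(\<lambda>n. \<integral>x. ?g x \<partial>M (r n)) \<longlonglongrightarrow> (\<integral>x. ?g x \<partial>R)"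
    proof -
      have "(\<lambda>n. \<integral>x. ?g x \<partial>((M \<circ> id \<circ> r) n)) \<longlonglongrightarrow> (\<integral>x. ?g x \<partial>R)"
      proof (rule weak_conv_imp_integral_bdd_continuous_conv[OF _ R conv])
        show "isCont ?g x" for x using gc by (simp add: continuous_on_eq_continuous_at)
        show "norm (?g x) \<le> c" for x using c by simp
      qed (simp add: Mreal)
      then show ?thesis by simp
    qed
    have lim2: "(\<lambda>n. \<integral>x. ?g x \<partial>M n) \<longlonglongrightarrow> \<Lambda> \<phi> / m0"
    proof (rule LIMSEQ_I)
      fix e :: real assume e: "e > 0"
      have mn: "0 \<le> m" by (rule bounded_functional_nonneg[OF bf])
      define e' where "e' = e * m0 / (m + 1)"
      have e': "e' > 0" using e m0 mn by (simp add: e'_def)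
      obtain n0 where n0: "\<And>n x. n0 \<le> n \<Longrightarrow> x \<in> {0..1} \<Longrightarrow> \<bar>?g x - (\<Sum>k\<le>n. ?g (k / n) * Bernstein n k x)\<bar> < e'"
        using Bernstein_Weierstrass[OF continuous_on_subset[OF gc] e'] by blast
      have "norm ((\<integral>x. ?g x \<partial>M n) - \<Lambda> \<phi> / m0) < e" if n: "n0 \<le> n" for n
      proof -
        have "\<bar>(\<Sum>k\<le>n. ?g (k / n) * B n k V) - \<phi> V\<bar> \<le> e'" for V
          using n0[OF n unit_coord_range, of V] by (simp add: qu B_def abs_minus_commute)
        then have "\<bar>\<Lambda> (\<lambda>V. \<Sum>k\<le>n. ?g (k / n) * B n k V) - \<Lambda> \<phi>\<bar> \<le> m * e'"
          by (intro bounded_functional_dist[OF bf] C_compact_sum BC \<phi>)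
        also have "\<Lambda> (\<lambda>V. \<Sum>k\<le>n. ?g (k / n) * B n k V) = m0 * (\<integral>x. ?g x \<partial>M n)"
          using m0 by (simp only: Lsum[OF finite_atMost]) (simp add: Mint[OF gm] w_def sum_distrib_left mult.commute)
        finally have "\<bar>m0 * ((\<integral>x. ?g x \<partial>M n) - \<Lambda> \<phi> / m0)\<bar> \<le> m * e'"
          using m0 by (simp add: right_diff_distrib)
        also have "m * e' < m0 * e"
        proof -
          have "m * e' = m0 * e * (m / (m + 1))" by (simp add: e'_def)
          also have "\<dots> < m0 * e * 1" using m0 e mn by (intro mult_strict_left_mono) auto
          finally show ?thesis by simp
        qed
        finally show ?thesis using m0 by (simp add: abs_mult)
      qed
      then show "\<exists>n0. \<forall>n\<ge>n0. norm ((\<integral>x. ?g x \<partial>M n) - \<Lambda> \<phi> / m0) < e" by blast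
    qed
    have "(\<integral>x. ?g x \<partial>R) = \<Lambda> \<phi> / m0"
      using LIMSEQ_unique[OF lim1] LIMSEQ_subseq_LIMSEQ[OF lim2 r] by (simp add: o_def)
    then show ?thesis using m0 by simp
  qed
  have qm: "q \<in> measurable R borel"
    using borel_measurable_continuous_onI[OF qC] by (simp cong: measurable_cong_sets)
  \<comment> \<open>The density \<open>m0\<close> undoes the normalization of the weights;
    \<open>q\<close> carries the limit back to [0, \<infinity>].\<close>
  define \<mu> where "\<mu> = distr (density R (\<lambda>_. ennreal m0)) borel q"
  have "emeasure \<mu> (space \<mu>) = ennreal m0"
    using qm m0 unfolding \<mu>_def
    by (subst emeasure_distr) (auto simp: emeasure_density R.emeasure_space_1[simplified])
  then have "\<mu> \<in> radon_measures"
    by (auto simp: radon_measures_def \<mu>_def intro!: finite_measureI)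
  moreover have "(\<integral>V. \<phi> V \<partial>\<mu>) = \<Lambda> \<phi>" if \<phi>: "\<phi> \<in> C_compact" for \<phi>
  proof -
    have \<phi>m: "\<phi> \<in> borel_measurable borel"
      using \<phi> by (auto simp: C_compact_def intro: borel_measurable_continuous_onI)
    have "(\<integral>V. \<phi> V \<partial>\<mu>) = (\<integral>x. m0 *\<^sub>R \<phi> (q x) \<partial>R)"
      unfolding \<mu>_def using qm m0 \<phi>m
      by (subst integral_distr; simp?; subst integral_density) (auto intro: measurable_compose)
    then show ?thesis using main[OF \<phi>] by simp
  qed
  ultimately show ?thesis by blast
qed

section \<open>Smooth test functions on the compactified half-line\<close>

text \<open>Truncation with real values. An element of \<open>X_space M\<close> depends on
  \<open>V\<close> only through \<open>clip M V\<close> (\<open>X_space_clip\<close>), which reduces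
  questions on [0, \<infinity>] to real functions on [0, M].\<close>

definition clip :: "real \<Rightarrow> ennreal \<Rightarrow> real" where
  "clip M V = enn2real (min V (ennreal M))"

lemma clip_ennreal [simp]: "0 \<le> v \<Longrightarrow> 0 \<le> M \<Longrightarrow> clip M (ennreal v) = min v M"
  by (simp add: clip_def min_def)

lemma clip_nonneg [simp]: "0 \<le> clip M V"
  by (simp add: clip_def)

lemma clip_le: "0 \<le> M \<Longrightarrow> clip M V \<le> M"
  by (cases V) (auto simp: clip_def min_def)

lemma clip_ge: "0 \<le> M \<Longrightarrow> ennreal M \<le> V \<Longrightarrow> clip M V = M"
  by (simp add: clip_def min_def antisym_conv)

lemma clip_mono: "0 \<le> M \<Longrightarrow> V \<le> W \<Longrightarrow> clip M V \<le> clip M W"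
  unfolding clip_def by (intro enn2real_mono min.mono) (auto simp: min_less_iff_disj)

lemma continuous_clip: "continuous_on UNIV (clip M)"
  unfolding continuous_on_def
proof
  fix V :: ennreal
  have "((\<lambda>V. min V (ennreal M)) \<longlongrightarrow> min V (ennreal M)) (at V)"
    by (intro tendsto_min tendsto_ident_at tendsto_const)
  moreover have "min V (ennreal M) = ennreal (enn2real (min V (ennreal M)))"
    by (simp add: min_less_iff_disj)
  ultimately show "(clip M \<longlongrightarrow> clip M V) (at V)"
    unfolding clip_def[abs_def] by (intro tendsto_enn2real) auto
qed

lemma X_space_C: "\<phi> \<in> X_space M \<Longrightarrow> \<phi> \<in> C_compact"
  by (simp add: X_space_def)

lemma X_space_const:
  "\<phi> \<in> X_space M \<Longrightarrow> ennreal M \<le> V \<Longrightarrow> ennreal M \<le> W \<Longrightarrow> \<phi> V = \<phi> W"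
  by (auto simp: X_space_def constant_on_def)

lemma X_space_clip: "\<phi> \<in> X_space M \<Longrightarrow> 0 \<le> M \<Longrightarrow> \<phi> V = \<phi> (ennreal (clip M V))"
proof (cases "V \<le> ennreal M")
  case True
  then have "V < top" by (rule le_less_trans) simp
  then show ?thesis using True by (simp add: clip_def min_absorb1)
next
  case False
  assume "\<phi> \<in> X_space M" "0 \<le> M"
  then show ?thesis using False X_space_const[of \<phi> M V "ennreal M"] by (simp add: clip_ge)
qed

lemma clip_in_X_space:
  assumes "continuous_on {0..M} f" "0 \<le> M"
  shows "(\<lambda>V. f (clip M V)) \<in> X_space M"
proof -
  have "continuous_on UNIV (\<lambda>V. f (clip M V))"
    by (rule continuous_on_compose2[OF assms(1) continuous_clip]) (use assms in \<open>auto intro: clip_le\<close>)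
  then show ?thesis
    using assms(2) by (auto simp: X_space_def C_compact_def constant_on_def clip_ge)
qed

text \<open>The iterated one-sided derivative is identified from any chain \<open>F\<close> of
  two-sided derivatives; the vector derivative on the half-line is unique because none of its
  points, 0 included, is isolated.\<close>

lemma halfline_deriv_eq:
  assumes F: "\<And>k v. 0 \<le> v \<Longrightarrow> (F k has_real_derivative F (Suc k) v) (at v)"
    and \<psi>: "\<And>v. 0 \<le> v \<Longrightarrow> \<psi> (ennreal v) = F 0 v"
  shows "0 \<le> v \<Longrightarrow> halfline_deriv k \<psi> v = F k v"
proof (induction k arbitrary: v)
  case 0
  then show ?case by (simp add: halfline_deriv_def \<psi>)
next
  case (Suc k)
  have "(F k has_vector_derivative F (Suc k) v) (at v within {0..})"
    using has_field_derivative_at_within[OF F[OF Suc.prems]]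
    by (simp add: has_real_derivative_iff_has_vector_derivative)
  then have "(halfline_deriv k \<psi> has_vector_derivative F (Suc k) v) (at v within {0..})"
    by (rule has_vector_derivative_transform[rotated 2]) (use Suc in auto)
  moreover have "at v within {0..} \<noteq> bot"
  proof -
    have "at v within {v..v+1} \<noteq> bot" by (simp add: at_within_Icc_at_right trivial_limit_at_right_real)
    then show ?thesis using at_le[of "{v..v+1}" "{0..}" v] Suc.prems by (auto simp: le_bot)
  qed
  ultimately have "vector_derivative (halfline_deriv k \<psi>) (at v within {0..}) = F (Suc k) v"
    by (intro vector_derivative_within)
  then show ?case by (simp add: halfline_deriv_def)
qed

lemma C_infty_compactI:
  assumes F: "\<And>k v. 0 \<le> v \<Longrightarrow> (F k has_real_derivative F (Suc k) v) (at v)"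
    and \<psi>: "\<And>v. 0 \<le> v \<Longrightarrow> \<psi> (ennreal v) = F 0 v"
    and lim: "\<And>k. \<exists>l. (F k \<longlongrightarrow> l) at_top" and C: "\<psi> \<in> C_compact"
  shows "\<psi> \<in> C_infty_compact"
proof -
  note eq = halfline_deriv_eq[of F \<psi>, OF F \<psi>]
  have "halfline_deriv k \<psi> differentiable (at v within {0..})" if v: "0 \<le> v" for k v
  proof -
    have "(F k has_real_derivative F (Suc k) v) (at v within {0..})"
      using F[OF v] by (rule has_field_derivative_at_within)
    then have "F k differentiable (at v within {0..})"
      by (auto simp: real_differentiable_def)
    then show ?thesis
      by (rule differentiable_transform_within[where d = 1]) (use v eq in auto)
  qed
  moreover have "\<exists>l. (halfline_deriv k \<psi> \<longlongrightarrow> l) at_top" for k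
  proof -
    obtain l where "(F k \<longlongrightarrow> l) at_top" using lim by blast
    then have "(halfline_deriv k \<psi> \<longlongrightarrow> l) at_top"
      by (rule Lim_transform_eventually)
        (use eventually_ge_at_top[of 0] in \<open>eventually_elim, simp add: eq\<close>)
    then show ?thesis ..
  qed
  ultimately show ?thesis using C by (simp add: C_infty_compact_def)
qed

section \<open>Flat functions: smooth on the line and zero beyond M\<close>

definition bump :: "real \<Rightarrow> nat \<Rightarrow> nat \<Rightarrow> real \<Rightarrow> real" where
  "bump M i j v = (if v < M then inverse (M - v) ^ i * exp (- real j * inverse (M - v)) else 0)"

text \<open>The linear span of the \<open>bump\<close> functions with j > 0. Differentiation raises
  the power i and multiplication adds both indices, so the span is an algebra closed under
  derivatives; smoothness of all orders thus comes down to one derivative computation. The condition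
  j > 0 lets the exponential beat every power at \<open>M\<close>.\<close>

inductive_set flat :: "real \<Rightarrow> (real \<Rightarrow> real) set" for M where
  bump: "0 < j \<Longrightarrow> bump M i j \<in> flat M"
| add: "f \<in> flat M \<Longrightarrow> g \<in> flat M \<Longrightarrow> (\<lambda>v. f v + g v) \<in> flat M"
| scale: "f \<in> flat M \<Longrightarrow> (\<lambda>v. a * f v) \<in> flat M"

text \<open>From t \<le> exp t with t = x / (i + 2) and x = 1 / (M - v), raised to the power i + 2.
  Two powers of x are gained, that is a factor (v - M)^2, and a quadratic bound gives derivative 0
  at the gluing point \<open>M\<close>.\<close>

lemma bump_le_square:
  assumes "0 < j"
  shows "\<bar>bump M i j v\<bar> \<le> real (i + 2) ^ (i + 2) * (v - M)\<^sup>2"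
proof (cases "v < M")
  case True
  define x where "x = inverse (M - v)"
  have x: "x > 0" using True by (simp add: x_def)
  have "x / real (i + 2) \<le> exp (x / real (i + 2))"
    using exp_ge_add_one_self[of "x / real (i + 2)"] by linarith
  then have "(x / real (i + 2)) ^ (i + 2) \<le> exp (x / real (i + 2)) ^ (i + 2)"
    using x by (intro power_mono) auto
  also have "\<dots> = exp (real (i + 2) * (x / real (i + 2)))" by (rule exp_of_nat_mult[symmetric])
  also have "\<dots> = exp x" by (simp del: of_nat_add)
  finally have "x ^ (i + 2) \<le> real (i + 2) ^ (i + 2) * exp x"
    by (simp add: power_divide divide_le_eq mult.commute del: power_Suc)
  then have "x ^ i * exp (- x) \<le> real (i + 2) ^ (i + 2) * inverse (x\<^sup>2)"
    using x by (simp add: exp_minus field_simps power_add power2_eq_square)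
  moreover have "1 * x \<le> real j * x" using assms x by (intro mult_right_mono) auto
  then have "x ^ i * exp (- real j * x) \<le> x ^ i * exp (- x)"
    using x by (intro mult_left_mono) auto
  moreover have "inverse (x\<^sup>2) = (v - M)\<^sup>2"
    by (simp add: x_def power_inverse power2_commute)
  moreover have "\<bar>bump M i j v\<bar> = x ^ i * exp (- real j * x)"
    using True x by (simp add: bump_def abs_mult x_def)
  ultimately show ?thesis by (simp only:)
qed (simp add: bump_def)

lemma bump_deriv:
  assumes j: "0 < j"
  shows "(bump M i j has_real_derivative real i * bump M (i + 1) j v + (- real j) * bump M (i + 2) j v) (at v)"
proof (cases v M rule: linorder_cases)
  case less
  let ?f = "\<lambda>v. inverse (M - v) ^ i * exp (- real j * inverse (M - v))"
  have "(?f has_real_derivative real i * bump M (i + 1) j v + (- real j) * bump M (i + 2) j v) (at v)"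
  proof -
    have dy: "((\<lambda>v. inverse (M - v)) has_real_derivative (inverse (M - v))\<^sup>2) (at v)"
      using less by (auto intro!: derivative_eq_intros simp: power2_eq_square)
    have de: "((\<lambda>v. exp (- real j * inverse (M - v))) has_real_derivative
        exp (- real j * inverse (M - v)) * (- real j * (inverse (M - v))\<^sup>2)) (at v)"
      by (intro DERIV_fun_exp DERIV_cmult dy)
    show ?thesis
    proof (cases i)
      case 0
      then show ?thesis using less de by (simp add: bump_def power2_eq_square mult_ac)
    next
      case (Suc k)
      show ?thesis unfolding Suc
        by (rule DERIV_cong[OF DERIV_mult[OF DERIV_power_Suc[OF dy] de]])
          (use less in \<open>simp add: bump_def power2_eq_square algebra_simps\<close>)
    qed
  qed
  then show ?thesis
    by (rule has_field_derivative_transform_within_open[where S = "{..<M}"]) (use less in \<open>auto simp: bump_def\<close>)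
next
  case equal
  have "(bump M i j has_real_derivative 0) (at M within UNIV)"
  proof (rule has_real_derivative_quadratic)
    show "\<bar>bump M i j t - bump M i j M - (t - M) * 0\<bar> \<le> real (i + 2) ^ (i + 2) * (t - M)\<^sup>2" for t
      using bump_le_square[OF j, of M i t] by (simp add: bump_def)
  qed
  then show ?thesis using equal by (simp add: bump_def)
next
  case greater
  have "((\<lambda>v. 0) has_real_derivative 0) (at v)" by simp
  then have "(bump M i j has_real_derivative 0) (at v)"
    by (rule has_field_derivative_transform_within_open[where S = "{M<..}"]) (use greater in \<open>auto simp: bump_def\<close>)
  then show ?thesis using greater by (simp add: bump_def)
qed

lemma flat_deriv:
  assumes "f \<in> flat M"
  shows "\<exists>f'\<in>flat M. \<forall>v. (f has_real_derivative f' v) (at v)"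
  using assms
proof induction
  case (bump j i)
  have "(\<lambda>v. real i * bump M (i + 1) j v + (- real j) * bump M (i + 2) j v) \<in> flat M"
    by (intro flat.intros bump)
  then show ?case by (rule bexI[rotated]) (intro allI bump_deriv bump)
next
  case (add f g)
  then obtain f' g' where "f' \<in> flat M" "\<forall>v. (f has_real_derivative f' v) (at v)"
    "g' \<in> flat M" "\<forall>v. (g has_real_derivative g' v) (at v)" by blast
  then show ?case by (intro bexI[of _ "\<lambda>v. f' v + g' v"]) (auto intro: flat.intros DERIV_add)
next
  case (scale f a)
  then obtain f' where "f' \<in> flat M" "\<forall>v. (f has_real_derivative f' v) (at v)" by blast
  then show ?case by (intro bexI[of _ "\<lambda>v. a * f' v"]) (auto intro: flat.intros DERIV_cmult)
qed

lemma flat_zero: "f \<in> flat M \<Longrightarrow> M \<le> v \<Longrightarrow> f v = 0"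
  by (induction rule: flat.induct) (auto simp: bump_def)

lemma flat_mult_bump:
  assumes "f \<in> flat M" "0 < j"
  shows "(\<lambda>v. bump M i j v * f v) \<in> flat M"
  using assms(1)
proof induction
  case (bump j' i')
  have "(\<lambda>v. bump M i j v * bump M i' j' v) = bump M (i + i') (j + j')"
    by (auto simp: bump_def power_add algebra_simps exp_add[symmetric] fun_eq_iff)
  then show ?case using assms(2) by (simp add: flat.bump)
next
  case (add f g)
  then show ?case using flat.add[OF add.IH] by (simp add: distrib_left)
next
  case (scale f a)
  then show ?case using flat.scale[OF scale.IH, of a] by (simp add: mult.left_commute)
qed

lemma flat_mult:
  assumes "f \<in> flat M" "g \<in> flat M"
  shows "(\<lambda>v. f v * g v) \<in> flat M"
  using assms(1)
proof induction
  case (bump j i)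
  then show ?case using flat_mult_bump[OF assms(2)] by blast
next
  case (add f h)
  then show ?case using flat.add[OF add.IH] by (simp add: distrib_right)
next
  case (scale f a)
  then show ?case using flat.scale[OF scale.IH, of a] by (simp add: mult.assoc)
qed

lemma flat_continuous: "f \<in> flat M \<Longrightarrow> continuous_on X f"
  using flat_deriv by (meson DERIV_continuous_on has_field_derivative_at_within)

lemma flat_dense:
  assumes M: "0 < M" and g: "continuous_on {0..M} g" "g M = 0" and e: "0 < e"
  shows "\<exists>f\<in>flat M. \<forall>v\<in>{0..M}. \<bar>g v - f v\<bar> \<le> e"
proof -
  define R where "R = {\<lambda>v. c + f v | c f. f \<in> flat M}"
  have RI: "(\<lambda>v. c + f v) \<in> R" if "f \<in> flat M" for c f using that unfolding R_def by blast
  have z: "(\<lambda>v. 0) \<in> flat M" using flat.scale[OF flat.bump[of 1 M 0], of 0] by simp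
  interpret function_ring_on R "{0..M}"
  proof
    show "f \<in> R \<Longrightarrow> continuous_on {0..M} f" for f
      unfolding R_def by (auto intro!: continuous_on_add continuous_on_const intro: flat_continuous)
    show "(\<lambda>_. c) \<in> R" for c using RI[OF z, of c] by simp
  next
    fix f g assume "f \<in> R" "g \<in> R"
    then obtain a b f' g' where fg: "f = (\<lambda>v. a + f' v)" "g = (\<lambda>v. b + g' v)" "f' \<in> flat M" "g' \<in> flat M"
      unfolding R_def by blast
    have "(\<lambda>v. (a + b) + (f' v + g' v)) \<in> R" by (intro RI flat.intros fg)
    then show "(\<lambda>x. f x + g x) \<in> R" using fg by (simp add: algebra_simps)
    have "(\<lambda>v. (a * b) + ((a * g' v + b * f' v) + f' v * g' v)) \<in> R"
      by (intro RI flat.intros flat_mult fg)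
    then show "(\<lambda>x. f x * g x) \<in> R" using fg by (simp add: algebra_simps)
  next
    fix x y :: real assume xy: "x \<in> {0..M}" "y \<in> {0..M}" "x \<noteq> y"
    have "(\<lambda>v. 0 + bump M 0 1 v) \<in> R" by (intro RI flat.intros) simp
    moreover have "bump M 0 1 x \<noteq> bump M 0 1 y"
      using xy by (auto simp: bump_def)
    ultimately show "\<exists>f\<in>R. f x \<noteq> f y"
      by (intro bexI[of _ "\<lambda>v. 0 + bump M 0 1 v"]) auto
  qed simp
  obtain F where F: "F \<in> R" "\<And>v. v \<in> {0..M} \<Longrightarrow> \<bar>g v - F v\<bar> < e / 2"
  proof -
    obtain F where F: "F \<in> (UNIV :: nat set) \<rightarrow> R" "LIM n sequentially. F n :> uniformly_on {0..M} g"
      using Stone_Weierstrass[OF g(1)] by blast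
    have "\<forall>\<^sub>F n in sequentially. \<forall>v\<in>{0..M}. dist (F n v) (g v) < e / 2"
      using e by (intro uniform_limitD[OF F(2)]) simp
    then obtain n where "\<forall>v\<in>{0..M}. dist (F n v) (g v) < e / 2"
      by (auto simp: eventually_sequentially)
    then show ?thesis using that[of "F n"] F(1)
      by (auto simp: dist_real_def abs_minus_commute)
  qed
  obtain c f where cf: "F = (\<lambda>v. c + f v)" "f \<in> flat M" using F(1) unfolding R_def by blast
  have c: "\<bar>c\<bar> < e / 2" using F(2)[of M] M g(2) flat_zero[OF cf(2), of M] cf(1) by simp
  have "\<bar>g v - f v\<bar> \<le> e" if "v \<in> {0..M}" for v
  proof -
    have "\<bar>g v - (c + f v)\<bar> < e / 2" using F(2)[OF that] cf(1) by simp
    then show ?thesis using c by linarith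
  qed
  then show ?thesis using cf(2) by blast
qed

text \<open>The derivative \<open>g\<close> is approximated by a flat function, which is then
  integrated. The error is therefore small in the Lipschitz seminorm, the quantity that controls the
  jump operator when the kernel is singular at 0.\<close>

lemma smooth_approximation:
  assumes M: "0 < M" and \<phi>: "\<phi> \<in> X_space M"
    and g: "continuous_on {0..M} g" "\<And>v. M \<le> v \<Longrightarrow> g v = 0"
    and deriv: "\<And>v. 0 \<le> v \<Longrightarrow> ((\<lambda>v. \<phi> (ennreal v)) has_real_derivative g v) (at v within {0..})"
    and e: "0 < e"
  obtains \<psi> where "\<psi> \<in> C_infty_compact" "\<psi> \<in> X_space M" "\<psi> (ennreal M) = \<phi> (ennreal M)"
    "\<And>v w. 0 \<le> v \<Longrightarrow> 0 \<le> w \<Longrightarrow>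
      \<bar>(\<phi> (ennreal w) - \<psi> (ennreal w)) - (\<phi> (ennreal v) - \<psi> (ennreal v))\<bar> \<le> e * \<bar>w - v\<bar>"
proof -
  obtain a where a: "a \<in> flat M" and ga: "\<And>v. v \<in> {0..M} \<Longrightarrow> \<bar>g v - a v\<bar> \<le> e"
    using flat_dense[OF M g(1) g(2) e] by blast
  obtain d where d: "\<And>f. f \<in> flat M \<Longrightarrow> d f \<in> flat M" "\<And>f v. f \<in> flat M \<Longrightarrow> (f has_real_derivative d f v) (at v)"
    using flat_deriv[of _ M] by metis
  \<comment> \<open>Starting the integral at -1 makes \<open>U\<close> differentiable from both
    sides at 0.\<close>
  define U where "U v = integral {-1..v} a" for v
  define F0 where "F0 v = \<phi> (ennreal M) + (U v - U M)" for v
  have U: "(U has_real_derivative a v) (at v)" if "0 \<le> v" for v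
  proof -
    have "(U has_real_derivative a v) (at v within {-1..v+1})"
      unfolding U_def using that by (intro integral_has_real_derivative flat_continuous[OF a]) auto
    moreover have "at v within {-1..v+1} = at v"
      using that by (intro at_within_interior) auto
    ultimately show ?thesis by simp
  qed
  have F0: "(F0 has_real_derivative a v) (at v)" if "0 \<le> v" for v
    unfolding F0_def using U[OF that] by (auto intro!: derivative_eq_intros)
  define F where "F k = (case k of 0 \<Rightarrow> F0 | Suc k \<Rightarrow> (d ^^ k) a)" for k
  have dk: "(d ^^ k) a \<in> flat M" for k by (induction k) (simp_all add: a d(1))
  have DF: "(F k has_real_derivative F (Suc k) v) (at v)" if "0 \<le> v" for k v
  proof (cases k)
    case 0
    then show ?thesis using F0[OF that] by (simp add: F_def)
  next
    case (Suc j)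
    show ?thesis unfolding Suc F_def nat.case funpow.simps(2) o_apply by (rule d(2)[OF dk])
  qed
  have const: "F0 v = F0 M" if "M \<le> v" for v
  proof -
    have "norm (F0 v - F0 M) \<le> 0 * norm (v - M)"
    proof (rule field_differentiable_bound[where S = "{M..}" and f' = a])
      show "(F0 has_real_derivative a z) (at z within {M..})" if "z \<in> {M..}" for z
        using that M by (intro has_field_derivative_at_within[OF F0]) auto
      show "norm (a z) \<le> 0" if "z \<in> {M..}" for z using that flat_zero[OF a, of z] by simp
    qed (use that in auto)
    then show ?thesis by simp
  qed
  define \<psi> where "\<psi> V = F0 (clip M V)" for V
  have \<psi>v: "\<psi> (ennreal v) = F0 v" if "0 \<le> v" for v
    using that M const[of v] by (simp add: \<psi>_def min_def)
  have F0c: "continuous_on {0..M} F0"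
    by (rule DERIV_continuous_on[where D = a], rule has_field_derivative_at_within[OF F0]) auto
  have X: "\<psi> \<in> X_space M" unfolding \<psi>_def using F0c M by (intro clip_in_X_space) auto
  have lim: "\<exists>l. (F k \<longlongrightarrow> l) at_top" for k
  proof -
    have "\<forall>\<^sub>F v in at_top. F k v = F k M"
      using eventually_ge_at_top[of M] 
    proof eventually_elim
      case (elim v)
      then show ?case using const[of v] flat_zero[OF dk] by (cases k) (auto simp: F_def)
    qed
    then show ?thesis using tendsto_eventually by blast
  qed
  have "\<psi> \<in> C_infty_compact"
    by (rule C_infty_compactI[of F, OF DF _ lim X_space_C[OF X]]) (auto simp: F_def \<psi>v)
  moreover have "\<bar>(\<phi> (ennreal w) - \<psi> (ennreal w)) - (\<phi> (ennreal v) - \<psi> (ennreal v))\<bar> \<le> e * \<bar>w - v\<bar>"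
    if vw: "0 \<le> v" "0 \<le> w" for v w
  proof -
    have "norm ((\<phi> (ennreal w) - F0 w) - (\<phi> (ennreal v) - F0 v)) \<le> e * norm (w - v)"
    proof (rule field_differentiable_bound[where S = "{0..}" and f' = "\<lambda>v. g v - a v"])
      show "((\<lambda>v. \<phi> (ennreal v) - F0 v) has_real_derivative g z - a z) (at z within {0..})" if "z \<in> {0..}" for z
        using that by (intro DERIV_diff deriv has_field_derivative_at_within[OF F0]) auto
      show "norm (g z - a z) \<le> e" if "z \<in> {0..}" for z
        using that ga[of z] g(2)[of z] flat_zero[OF a, of z] e by (cases "z \<le> M") auto
    qed (use vw in auto)
    then show ?thesis using vw by (simp add: \<psi>v)
  qed
  moreover have "\<psi> (ennreal M) = \<phi> (ennreal M)" using M by (simp add: \<psi>v F0_def)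
  ultimately show ?thesis using X that by blast
qed

section \<open>Bounded jump generators\<close>

lemma set_borel_measurable_mult:
  fixes G g :: "'a \<Rightarrow> real"
  assumes "set_borel_measurable M S G" "g \<in> borel_measurable M"
  shows "set_borel_measurable M S (\<lambda>v. G v * g v)"
proof -
  have "(\<lambda>x. indicator S x *\<^sub>R G x * g x) \<in> borel_measurable M"
    using assms unfolding set_borel_measurable_def by (rule borel_measurable_times)
  then show ?thesis unfolding set_borel_measurable_def by (simp add: mult.assoc)
qed

lemma continuous_borel_lebesgue:
  fixes g :: "real \<Rightarrow> real"
  assumes "continuous_on UNIV g"
  shows "g \<in> borel_measurable lebesgue"
  using borel_measurable_continuous_onI[OF assms] by (simp add: measurable_completion)

lemma continuous_shift:
  assumes "\<phi> \<in> C_compact"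
  shows "continuous_on UNIV (\<lambda>v. \<phi> (V + ennreal v))"
proof -
  have "continuous_on UNIV (\<lambda>v. V + ennreal v)"
    by (intro continuous_on_add_ennreal continuous_on_const continuous_on_ennreal continuous_on_id)
  then show ?thesis
    by (rule continuous_on_compose2[of UNIV \<phi>, rotated]) (use assms in \<open>auto simp: C_compact_def\<close>)
qed

text \<open>The volume in the rate is replaced by a function \<open>c\<close>. With
  \<open>c = clip M\<close> this is the jump operator on \<open>X_space M\<close>, since increments
  vanish beyond \<open>M\<close>; other choices bound the rate or freeze it near 0.\<close>

definition jump_gen :: "(real \<Rightarrow> real) \<Rightarrow> (ennreal \<Rightarrow> real) \<Rightarrow> (ennreal \<Rightarrow> real) \<Rightarrow> ennreal \<Rightarrow> real" where
  "jump_gen G c \<phi> V =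
     (LINT v:{0<..}|lebesgue. G v * (root 3 (c V) + root 3 v)\<^sup>2 * (\<phi> (V + ennreal v) - \<phi> V))"

lemma jump_operator_eq_jump_gen:
  assumes \<phi>: "\<phi> \<in> X_space M" and M: "0 \<le> M"
  shows "jump_operator G \<phi> V = jump_gen G (clip M) \<phi> V"
proof (cases "V < ennreal M")
  case True
  then have "clip M V = enn2real V" by (simp add: clip_def min_absorb1)
  then show ?thesis by (simp add: jump_operator_def jump_gen_def)
next
  case False
  then have "\<phi> (V + ennreal v) - \<phi> V = 0" for v
    using X_space_const[OF \<phi>, of "V + ennreal v" V] by (simp add: add_increasing2)
  then show ?thesis by (simp add: jump_operator_def jump_gen_def)
qed

lemma set_borel_measurable_jump:
  assumes "set_borel_measurable lebesgue {0<..} G" "\<phi> \<in> C_compact"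
  shows "set_borel_measurable lebesgue {0<..} (\<lambda>v. G v * (root 3 a + root 3 v)\<^sup>2 * (\<phi> (V + ennreal v) - \<phi> V))"
proof -
  have "set_borel_measurable lebesgue {0<..} (\<lambda>v. G v * ((root 3 a + root 3 v)\<^sup>2 * (\<phi> (V + ennreal v) - \<phi> V)))"
    by (intro set_borel_measurable_mult assms(1) continuous_borel_lebesgue continuous_intros continuous_shift assms(2))
      auto
  then show ?thesis by (simp only: mult.assoc)
qed

lemma set_integrable_jump_bound:
  assumes "set_borel_measurable lebesgue {0<..} G" "\<phi> \<in> C_compact" "set_integrable lebesgue {0<..} w"
    and "\<And>v. 0 < v \<Longrightarrow> \<bar>G v * (root 3 a + root 3 v)\<^sup>2 * (\<phi> (V + ennreal v) - \<phi> V)\<bar> \<le> w v"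
  shows "set_integrable lebesgue {0<..} (\<lambda>v. G v * (root 3 a + root 3 v)\<^sup>2 * (\<phi> (V + ennreal v) - \<phi> V))"
  by (rule set_integrable_bound[OF assms(3) set_borel_measurable_jump[OF assms(1,2)]])
    (use assms(4) in \<open>auto intro: order_trans[OF _ abs_ge_self]\<close>)

lemma set_lebesgue_integral_abs_bound:
  fixes f w :: "real \<Rightarrow> real"
  assumes "set_integrable lebesgue S f" "set_integrable lebesgue S w" "\<And>v. v \<in> S \<Longrightarrow> \<bar>f v\<bar> \<le> w v"
  shows "\<bar>LINT v:S|lebesgue. f v\<bar> \<le> (LINT v:S|lebesgue. w v)"
proof -
  have "(LINT v:S|lebesgue. f v) \<le> (LINT v:S|lebesgue. w v)"
    using assms by (intro set_integral_mono) (auto simp: abs_le_iff)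
  moreover have "(LINT v:S|lebesgue. (-1) * w v) \<le> (LINT v:S|lebesgue. f v)"
  proof (rule set_integral_mono)
    show "set_integrable lebesgue S (\<lambda>v. (-1) * w v)" using assms(2) by (intro set_integrable_mult_right)
    show "(-1) * w v \<le> f v" if "v \<in> S" for v using assms(3)[OF that] by (simp add: abs_le_iff)
  qed (rule assms)
  then have "- (LINT v:S|lebesgue. w v) \<le> (LINT v:S|lebesgue. f v)"
    unfolding set_integral_mult_right by simp
  ultimately show ?thesis by linarith
qed

lemma jump_gen_bound:
  assumes "set_borel_measurable lebesgue {0<..} G" "\<phi> \<in> C_compact" "set_integrable lebesgue {0<..} w"
    and "\<And>v. 0 < v \<Longrightarrow> \<bar>G v * (root 3 (c V) + root 3 v)\<^sup>2 * (\<phi> (V + ennreal v) - \<phi> V)\<bar> \<le> w v"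
  shows "\<bar>jump_gen G c \<phi> V\<bar> \<le> (LINT v:{0<..}|lebesgue. w v)"
  unfolding jump_gen_def using assms
  by (intro set_lebesgue_integral_abs_bound set_integrable_jump_bound[of G \<phi> w]) auto

text \<open>Dominated convergence with function and base point moving at once. A constant sequence
  of functions gives continuity of the generator in \<open>V\<close>; a constant base point gives
  the passage to the limit along approximating functions.\<close>

lemma jump_gen_tendsto:
  assumes G: "set_borel_measurable lebesgue {0<..} G" and \<phi>: "\<And>n. \<phi> n \<in> C_compact" "\<psi> \<in> C_compact"
    and w: "set_integrable lebesgue {0<..} w"
    and b: "\<And>n v. 0 < v \<Longrightarrow> \<bar>G v * (root 3 (c (V n)) + root 3 v)\<^sup>2 * (\<phi> n (V n + ennreal v) - \<phi> n (V n))\<bar> \<le> w v"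
    and lim: "\<And>v. 0 \<le> v \<Longrightarrow> (\<lambda>n. \<phi> n (V n + ennreal v)) \<longlonglongrightarrow> \<psi> (W + ennreal v)"
      "(\<lambda>n. c (V n)) \<longlonglongrightarrow> c W"
  shows "(\<lambda>n. jump_gen G c (\<phi> n) (V n)) \<longlonglongrightarrow> jump_gen G c \<psi> W"
  unfolding jump_gen_def set_lebesgue_integral_def
proof (rule integral_dominated_convergence[where w = "\<lambda>v. indicator {0<..} v *\<^sub>R w v"])
  show "integrable lebesgue (\<lambda>v. indicator {0<..} v *\<^sub>R w v)" using w by (simp add: set_integrable_def)
  show "(\<lambda>v. indicator {0<..} v *\<^sub>R (G v * (root 3 (c W) + root 3 v)\<^sup>2 * (\<psi> (W + ennreal v) - \<psi> W))) \<in> borel_measurable lebesgue"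
    using set_borel_measurable_jump[OF G \<phi>(2)] by (simp add: set_borel_measurable_def)
  show "(\<lambda>v. indicator {0<..} v *\<^sub>R (G v * (root 3 (c (V n)) + root 3 v)\<^sup>2 * (\<phi> n (V n + ennreal v) - \<phi> n (V n)))) \<in> borel_measurable lebesgue" for n
    using set_borel_measurable_jump[OF G \<phi>(1)] by (simp add: set_borel_measurable_def)
  show "AE v in lebesgue. norm (indicator {0<..} v *\<^sub>R (G v * (root 3 (c (V n)) + root 3 v)\<^sup>2 * (\<phi> n (V n + ennreal v) - \<phi> n (V n)))) \<le> indicator {0<..} v *\<^sub>R w v" for n
    using b by (intro AE_I2) (auto simp: indicator_def)
  have "(\<lambda>n. \<phi> n (V n)) \<longlonglongrightarrow> \<psi> W" using lim(1)[of 0] by simp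
  then show "AE v in lebesgue. (\<lambda>n. indicator {0<..} v *\<^sub>R (G v * (root 3 (c (V n)) + root 3 v)\<^sup>2 * (\<phi> n (V n + ennreal v) - \<phi> n (V n))))
      \<longlonglongrightarrow> indicator {0<..} v *\<^sub>R (G v * (root 3 (c W) + root 3 v)\<^sup>2 * (\<psi> (W + ennreal v) - \<psi> W))"
    by (intro AE_I2) (auto intro!: tendsto_intros lim simp: indicator_def)
qed

lemma jump_gen_C:
  assumes G: "set_borel_measurable lebesgue {0<..} G" and \<phi>: "\<phi> \<in> C_compact" and c: "continuous_on UNIV c"
    and w: "set_integrable lebesgue {0<..} w"
    and b: "\<And>V v. 0 < v \<Longrightarrow> \<bar>G v * (root 3 (c V) + root 3 v)\<^sup>2 * (\<phi> (V + ennreal v) - \<phi> V)\<bar> \<le> w v"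
  shows "jump_gen G c \<phi> \<in> C_compact"
  unfolding C_compact_def
proof (intro CollectI continuous_on_sequentiallyI)
  fix U :: "nat \<Rightarrow> ennreal" and W assume U: "U \<longlonglongrightarrow> W"
  have c': "isCont c W" and \<phi>': "\<And>W. isCont \<phi> W"
    using c \<phi> by (auto simp: C_compact_def continuous_on_eq_continuous_at)
  show "(\<lambda>n. jump_gen G c \<phi> (U n)) \<longlonglongrightarrow> jump_gen G c \<phi> W"
  proof (rule jump_gen_tendsto[OF G \<phi> \<phi> w b])
    show "(\<lambda>n. c (U n)) \<longlonglongrightarrow> c W" by (rule isCont_tendsto_compose[OF c' U])
    show "(\<lambda>n. \<phi> (U n + ennreal v)) \<longlonglongrightarrow> \<phi> (W + ennreal v)" for v
      by (rule isCont_tendsto_compose[OF \<phi>']) (intro tendsto_add U tendsto_const)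
  qed
qed

text \<open>The jump rate increases with \<open>c V\<close>, so its value at \<open>cmax\<close>,
  and hence \<open>lam\<close>, dominates the rate from every \<open>V\<close>. A step of
  \<open>P\<close> leaves the volume unchanged with the remaining probability.\<close>

locale bounded_jumps =
  fixes G :: "real \<Rightarrow> real" and c :: "ennreal \<Rightarrow> real" and cmax lam :: real
  assumes G: "set_borel_measurable lebesgue {0<..} G" "\<And>v. 0 < v \<Longrightarrow> 0 \<le> G v"
    and c: "continuous_on UNIV c" "\<And>V. 0 \<le> c V" "\<And>V. c V \<le> cmax"
    and rate: "set_integrable lebesgue {0<..} (\<lambda>v. G v * (root 3 cmax + root 3 v)\<^sup>2)"
    and lam: "0 < lam" "(LINT v:{0<..}|lebesgue. G v * (root 3 cmax + root 3 v)\<^sup>2) \<le> lam"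
begin

definition P :: "(ennreal \<Rightarrow> real) \<Rightarrow> ennreal \<Rightarrow> real" where
  "P \<phi> V = \<phi> V + jump_gen G c \<phi> V / lam"

lemma factor_le: "0 < v \<Longrightarrow> (root 3 (c V) + root 3 v)\<^sup>2 \<le> (root 3 cmax + root 3 v)\<^sup>2"
  using c by (intro power_mono add_mono) (auto intro: add_nonneg_nonneg)

lemma jump_le:
  assumes "\<And>V. \<bar>\<phi> V\<bar> \<le> K" "0 < v"
  shows "\<bar>G v * (root 3 (c V) + root 3 v)\<^sup>2 * (\<phi> (V + ennreal v) - \<phi> V)\<bar> \<le> (2 * K) * (G v * (root 3 cmax + root 3 v)\<^sup>2)"
proof -
  have "\<bar>\<phi> (V + ennreal v) - \<phi> V\<bar> \<le> 2 * K"
    using assms(1)[of V] assms(1)[of "V + ennreal v"] by linarith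
  then have "(G v * (root 3 (c V) + root 3 v)\<^sup>2) * \<bar>\<phi> (V + ennreal v) - \<phi> V\<bar> \<le> (G v * (root 3 cmax + root 3 v)\<^sup>2) * (2 * K)"
    using G(2)[OF assms(2)] factor_le[OF assms(2), of V] bounded_by_nonneg[OF assms(1)]
    by (intro mult_mono mult_left_mono) auto
  then show ?thesis using G(2)[OF assms(2)] by (simp add: abs_mult mult_ac)
qed

lemma dominating: "set_integrable lebesgue {0<..} (\<lambda>v. (2 * K) * (G v * (root 3 cmax + root 3 v)\<^sup>2))"
  using rate by simp

lemma jump_integrable:
  assumes "\<phi> \<in> C_compact"
  shows "set_integrable lebesgue {0<..} (\<lambda>v. G v * (root 3 (c V) + root 3 v)\<^sup>2 * (\<phi> (V + ennreal v) - \<phi> V))"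
proof -
  obtain K where K: "\<And>V. \<bar>\<phi> V\<bar> \<le> K" using C_compact_bounded[OF assms] by blast
  show ?thesis by (rule set_integrable_jump_bound[OF G(1) assms dominating jump_le[OF K]])
qed

lemma rate_integrable: "set_integrable lebesgue {0<..} (\<lambda>v. G v * (root 3 (c V) + root 3 v)\<^sup>2)"
proof (rule set_integrable_bound[OF rate])
  show "set_borel_measurable lebesgue {0<..} (\<lambda>v. G v * (root 3 (c V) + root 3 v)\<^sup>2)"
    by (intro set_borel_measurable_mult G continuous_borel_lebesgue continuous_intros)
  show "AE v in lebesgue. v \<in> {0<..} \<longrightarrow> norm (G v * (root 3 (c V) + root 3 v)\<^sup>2) \<le> norm (G v * (root 3 cmax + root 3 v)\<^sup>2)"
    using G(2) factor_le by (intro AE_I2) (auto simp: abs_mult intro!: mult_left_mono)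
qed

lemma rate_le: "(LINT v:{0<..}|lebesgue. G v * (root 3 (c V) + root 3 v)\<^sup>2) \<le> lam"
proof -
  have "(LINT v:{0<..}|lebesgue. G v * (root 3 (c V) + root 3 v)\<^sup>2) \<le> (LINT v:{0<..}|lebesgue. G v * (root 3 cmax + root 3 v)\<^sup>2)"
    using G(2) factor_le by (intro set_integral_mono rate rate_integrable) (auto intro!: mult_left_mono)
  then show ?thesis using lam by linarith
qed

lemma jump_gen_lin:
  assumes "\<phi> \<in> C_compact" "\<psi> \<in> C_compact"
  shows "jump_gen G c (\<lambda>V. a * \<phi> V + b * \<psi> V) V = a * jump_gen G c \<phi> V + b * jump_gen G c \<psi> V"
proof -
  have "jump_gen G c (\<lambda>V. a * \<phi> V + b * \<psi> V) V = (LINT v:{0<..}|lebesgue.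
      a * (G v * (root 3 (c V) + root 3 v)\<^sup>2 * (\<phi> (V + ennreal v) - \<phi> V)) +
      b * (G v * (root 3 (c V) + root 3 v)\<^sup>2 * (\<psi> (V + ennreal v) - \<psi> V)))"
    unfolding jump_gen_def by (simp add: algebra_simps)
  also have "\<dots> = a * jump_gen G c \<phi> V + b * jump_gen G c \<psi> V"
    unfolding jump_gen_def using assms
    by (subst set_integral_add) (auto intro: jump_integrable)
  finally show ?thesis .
qed

text \<open>Jumps occur at total rate at most \<open>lam\<close> and each lowers \<phi> by at most
  d. With d = \<phi> V for nonnegative \<phi> this is the positivity of \<open>P\<close>.\<close>

lemma jump_gen_lower:
  assumes \<phi>: "\<phi> \<in> C_compact" and d: "\<And>v. 0 < v \<Longrightarrow> - d \<le> \<phi> (V + ennreal v) - \<phi> V" and "0 \<le> d"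
  shows "- (lam * d) \<le> jump_gen G c \<phi> V"
proof -
  have "- (lam * d) \<le> - ((LINT v:{0<..}|lebesgue. G v * (root 3 (c V) + root 3 v)\<^sup>2) * d)"
    using rate_le[of V] assms(3) by (simp add: mult_right_mono)
  also have "\<dots> = (LINT v:{0<..}|lebesgue. G v * (root 3 (c V) + root 3 v)\<^sup>2 * (- d))"
    unfolding set_integral_mult_left by simp
  also have "\<dots> \<le> jump_gen G c \<phi> V"
    unfolding jump_gen_def using d G(2)
    by (intro set_integral_mono jump_integrable \<phi> set_integrable_mult_left rate_integrable mult_left_mono) auto
  finally show ?thesis .
qed

sublocale markov_step P lam
proof
  show "0 < lam" by (rule lam)
  show "P \<phi> \<in> C_compact" if \<phi>: "\<phi> \<in> C_compact" for \<phi>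
  proof -
    obtain K where K: "\<And>V. \<bar>\<phi> V\<bar> \<le> K" using C_compact_bounded[OF \<phi>] by blast
    have "jump_gen G c \<phi> \<in> C_compact" by (rule jump_gen_C[OF G(1) \<phi> c(1) dominating jump_le[OF K]])
    then have "(\<lambda>V. 1 * \<phi> V + (1 / lam) * jump_gen G c \<phi> V) \<in> C_compact" by (intro C_compact_lin \<phi>)
    then show ?thesis by (simp add: P_def[abs_def])
  qed
  show "P (\<lambda>V. a * \<phi> V + b * \<psi> V) = (\<lambda>V. a * P \<phi> V + b * P \<psi> V)"
    if "\<phi> \<in> C_compact" "\<psi> \<in> C_compact" for \<phi> \<psi> a b
    by (simp add: P_def[abs_def] jump_gen_lin[OF that] add_divide_distrib algebra_simps)
  show "0 \<le> P \<phi> V" if \<phi>: "\<phi> \<in> C_compact" "\<And>V. 0 \<le> \<phi> V" for \<phi> V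
    using jump_gen_lower[OF \<phi>(1), of "\<phi> V" V] \<phi>(2) lam by (simp add: P_def field_simps)
  show "P (\<lambda>_. 1) V = 1" for V by (simp add: P_def jump_gen_def)
qed

lemma A_eq: "A \<phi> = jump_gen G c \<phi>"
  using lam by (simp add: A_def[abs_def] P_def)

text \<open>A coupling in operator form. Jumps from V are matched with jumps of the same size from
  W, which occur at least as often because \<open>c\<close> is monotone; surplus jumps from W only
  move further up. The initial gap \<open>d\<close> covers the comparison because the total rate
  from W does not exceed \<open>lam\<close>.\<close>

lemma P_mono:
  assumes \<phi>: "\<phi> \<in> C_compact" and mono: "mono \<phi>" "mono c"
  shows "mono (P \<phi>)"
proof
  fix V W :: ennreal assume VW: "V \<le> W"
  define d where "d = \<phi> W - \<phi> V"
  have d: "0 \<le> d" using monoD[OF mono(1) VW] by (simp add: d_def)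
  let ?r = "\<lambda>V v. G v * (root 3 (c V) + root 3 v)\<^sup>2"
  have "jump_gen G c \<phi> V + - (lam * d) \<le> jump_gen G c \<phi> V + (LINT v:{0<..}|lebesgue. ?r W v) * (- d)"
    using rate_le[of W] d by (simp add: mult_right_mono)
  also have "\<dots> = (LINT v:{0<..}|lebesgue. ?r V v * (\<phi> (V + ennreal v) - \<phi> V) + ?r W v * (- d))"
    unfolding jump_gen_def set_integral_mult_left[symmetric]
    by (intro set_integral_add(2)[symmetric] jump_integrable \<phi> set_integrable_mult_left rate_integrable)
  also have "\<dots> \<le> jump_gen G c \<phi> W"
    unfolding jump_gen_def
  proof (intro set_integral_mono set_integral_add jump_integrable \<phi> set_integrable_mult_left rate_integrable)
    fix v :: real assume "v \<in> {0<..}"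
    then have v: "0 < v" by simp
    have "?r V v \<le> ?r W v"
      using G(2)[OF v] c monoD[OF mono(2) VW] v
      by (intro mult_left_mono power_mono add_mono) (auto intro: add_nonneg_nonneg)
    moreover have "0 \<le> ?r V v" using G(2)[OF v] by simp
    moreover have "0 \<le> \<phi> (V + ennreal v) - \<phi> V" "\<phi> (V + ennreal v) - \<phi> V \<le> \<phi> (W + ennreal v) - \<phi> V"
      using monoD[OF mono(1), of V "V + ennreal v"] monoD[OF mono(1), of "V + ennreal v" "W + ennreal v"] VW
      by (auto simp: add_right_mono)
    ultimately have "?r V v * (\<phi> (V + ennreal v) - \<phi> V) \<le> ?r W v * (\<phi> (W + ennreal v) - \<phi> V)"
      by - (rule mult_mono; linarith)
    then show "?r V v * (\<phi> (V + ennreal v) - \<phi> V) + ?r W v * (- d) \<le> ?r W v * (\<phi> (W + ennreal v) - \<phi> W)"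
      by (simp add: d_def algebra_simps)
  qed
  finally have "lam * \<phi> V + jump_gen G c \<phi> V \<le> lam * \<phi> W + jump_gen G c \<phi> W"
    by (simp add: d_def right_diff_distrib)
  then have "(lam * \<phi> V + jump_gen G c \<phi> V) / lam \<le> (lam * \<phi> W + jump_gen G c \<phi> W) / lam"
    using lam by (intro divide_right_mono) auto
  then show "P \<phi> V \<le> P \<phi> W" using lam by (simp add: P_def add_divide_distrib)
qed

lemma P_const_beyond:
  assumes "\<phi> \<in> X_space M" "ennreal M \<le> V"
  shows "P \<phi> V = \<phi> V"
proof -
  have "\<phi> (V + ennreal v) - \<phi> V = 0" for v
    using X_space_const[OF assms(1), of "V + ennreal v" V] assms(2) by (simp add: add_increasing2)
  then show ?thesis by (simp add: P_def jump_gen_def)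
qed

lemma P_X_space:
  assumes "\<phi> \<in> X_space M"
  shows "P \<phi> \<in> X_space M"
proof -
  have "P \<phi> V = \<phi> (ennreal M)" if "ennreal M \<le> V" for V
    using P_const_beyond[OF assms that] X_space_const[OF assms that order_refl] by simp
  then show ?thesis
    using P_C[OF X_space_C[OF assms]] unfolding X_space_def constant_on_def by blast
qed

end

context markov_step begin

text \<open>A bound on an increment that holds for all iterates survives averaging with Poisson
  weights. This is how modulus classes pass from single steps to the semigroup.\<close>

lemma S_increment_bound:
  assumes "\<phi> \<in> C_compact" "0 \<le> t" "\<And>k. \<bar>(P ^^ k) \<phi> W - (P ^^ k) \<phi> V\<bar> \<le> r"
  shows "\<bar>S t \<phi> W - S t \<phi> V\<bar> \<le> r"
proof -
  have s: "(\<lambda>k. wt t k * (P ^^ k) \<phi> W - wt t k * (P ^^ k) \<phi> V) sums (S t \<phi> W - S t \<phi> V)"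
    by (intro sums_diff S_sums assms)
  have r: "(\<lambda>k. wt t k * r) sums r" using sums_mult2[OF wt_sums, of t r] by simp
  have b: "\<bar>wt t k * (P ^^ k) \<phi> W - wt t k * (P ^^ k) \<phi> V\<bar> \<le> wt t k * r" for k
    using mult_left_mono[OF assms(3) wt_nonneg[OF assms(2)], of k k] wt_nonneg[OF assms(2), of k]
    by (simp add: abs_mult flip: right_diff_distrib)
  have "S t \<phi> W - S t \<phi> V \<le> r"
    by (rule sums_le[OF _ s r]) (use b in \<open>auto simp: abs_le_iff\<close>)
  moreover have "- (S t \<phi> W - S t \<phi> V) \<le> r"
  proof (rule sums_le[OF _ sums_minus[OF s] r])
    show "- (wt t k * (P ^^ k) \<phi> W - wt t k * (P ^^ k) \<phi> V) \<le> wt t k * r" for k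
      using b[of k] by linarith
  qed
  ultimately show ?thesis by linarith
qed

lemma S_X_space:
  assumes \<phi>: "\<phi> \<in> X_space M" and "0 \<le> t" and P: "\<And>\<phi>. \<phi> \<in> X_space M \<Longrightarrow> P \<phi> \<in> X_space M"
  shows "S t \<phi> \<in> X_space M"
proof -
  have k: "(P ^^ k) \<phi> \<in> X_space M" for k by (induction k) (auto intro: \<phi> P)
  have "S t \<phi> V = S t \<phi> (ennreal M)" if "ennreal M \<le> V" for V
  proof -
    have "\<bar>S t \<phi> V - S t \<phi> (ennreal M)\<bar> \<le> 0"
      by (intro S_increment_bound X_space_C[OF \<phi>] assms(2)) (use X_space_const[OF k that] in simp)
    then show ?thesis by simp
  qed
  then show ?thesis using S_C[OF X_space_C[OF \<phi>] assms(2)]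
    unfolding X_space_def constant_on_def by blast
qed

end

text \<open>Powers have explicit gauge integrals on [0, M] and on [M, \<infinity>); nonnegativity
  turns the glued function into a Lebesgue integrable one with the same value.\<close>

lemma two_piece_integral:
  fixes f g :: "real \<Rightarrow> real"
  assumes M: "0 < M" and f: "(f has_integral I) {0..M}" and g: "(g has_integral J) {M..}"
    and nn: "\<And>v. 0 < v \<Longrightarrow> v \<le> M \<Longrightarrow> 0 \<le> f v" "\<And>v. M < v \<Longrightarrow> 0 \<le> g v"
  shows "set_integrable lebesgue {0<..} (\<lambda>v. if v \<le> M then f v else g v)"
    and "(LINT v:{0<..}|lebesgue. if v \<le> M then f v else g v) = I + J"
proof -
  let ?p = "\<lambda>v. if v \<le> M then f v else g v"
  have 1: "(?p has_integral I) {0..M}" by (rule has_integral_eq[OF _ f]) auto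
  have 2: "(?p has_integral J) {M..}" by (rule has_integral_spike_finite[OF _ _ g, of "{M}"]) auto
  have "(?p has_integral (I + J)) ({0..M} \<union> {M..})"
    by (rule has_integral_Un[OF 1 2]; rule negligible_subset[of "{M}"]; auto)
  also have "{0..M} \<union> {M..} = {0..}" using M by auto
  finally have "(?p has_integral (I + J)) {0..}" .
  moreover have "(?p has_integral (I + J)) {0..} \<longleftrightarrow> (?p has_integral (I + J)) {0<..}"
    by (rule has_integral_spike_set_eq; rule negligible_subset[of "{0}"]; auto)
  ultimately have p: "(?p has_integral (I + J)) {0<..}" by simp
  then have i: "?p absolutely_integrable_on {0<..}"
    using nn by (intro nonnegative_absolutely_integrable_1) (auto simp: integrable_on_def)
  then show "set_integrable lebesgue {0<..} ?p" .
  show "(LINT v:{0<..}|lebesgue. ?p v) = I + J"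
    using set_lebesgue_integral_eq_integral(2)[OF i] p by (simp add: integral_unique)
qed

section \<open>The scaled modulus for the power kernel\<close>

lemma powr_subadditive:
  fixes x y a :: real
  assumes "0 \<le> x" "0 \<le> y" "0 \<le> a" "a \<le> 1"
  shows "(x + y) powr a \<le> x powr a + y powr a"
proof (cases "x + y = 0")
  case False
  then have r: "x + y > 0" using assms by simp
  have le: "z \<le> z powr a" if "0 \<le> z" "z \<le> 1" for z :: real
    using that assms powr_mono'[of a 1 z] by (cases "z = 0") auto
  have "1 = x / (x + y) + y / (x + y)" using r by (simp flip: add_divide_distrib)
  also have "\<dots> \<le> (x / (x + y)) powr a + (y / (x + y)) powr a"
    using assms r by (intro add_mono le) (auto simp: divide_le_eq)
  also have "\<dots> = (x powr a + y powr a) / (x + y) powr a"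
    using assms r by (simp add: powr_divide add_divide_distrib)
  finally show ?thesis using r by (simp add: le_divide_eq)
qed (use assms in auto)

lemma powr_increment_antimono:
  fixes x y v a :: real
  assumes "0 \<le> x" "x \<le> y" "0 \<le> v" "0 \<le> a" "a \<le> 1"
  shows "(y + v) powr a - y powr a \<le> (x + v) powr a - x powr a"
proof (cases "x = 0")
  case True
  then show ?thesis using powr_subadditive[of y v a] assms by simp
next
  case False
  then have x: "0 < x" using assms by simp
  have "(\<lambda>z. z powr a - (z + v) powr a) x \<le> (\<lambda>z. z powr a - (z + v) powr a) y"
  proof (rule DERIV_nonneg_imp_nondecreasing[OF assms(2)])
    fix z assume z: "x \<le> z" "z \<le> y"
    have "((\<lambda>z. z powr a - (z + v) powr a) has_real_derivative
        (a * z powr (a - 1) - a * (z + v) powr (a - 1))) (at z)"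
      using x z assms by (auto intro!: derivative_eq_intros has_real_derivative_powr DERIV_fun_powr[THEN DERIV_cong])
    moreover have "(z + v) powr (a - 1) \<le> z powr (a - 1)"
      using x z assms by (intro powr_mono2') auto
    then have "a * (z + v) powr (a - 1) \<le> a * z powr (a - 1)"
      using assms by (intro mult_left_mono)
    ultimately show "\<exists>D. ((\<lambda>z. z powr a - (z + v) powr a) has_real_derivative D) (at z) \<and> 0 \<le> D"
      by (intro exI conjI) auto
  qed
  then show ?thesis by simp
qed

lemma powr_min_increment_antimono:
  fixes x y v a R :: real
  assumes "0 \<le> x" "x \<le> y" "0 \<le> v" "0 \<le> a" "a \<le> 1"
  shows "min (y + v) R powr a - min y R powr a \<le> min (x + v) R powr a - min x R powr a"
proof (cases "y \<ge> R")
  case True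
  have "min x R powr a \<le> min (x + v) R powr a" if "0 \<le> R"
    using assms that by (intro powr_mono2) auto
  moreover have "min x R = min (x + v) R" if "R < 0" using that assms by auto
  ultimately show ?thesis using True assms by (cases "0 \<le> R") auto
next
  case False
  \<comment> \<open>The jump is shortened so that the higher starting point lands at or below the
    cap. The lower one then does so too, and concavity of the power applies to the common length
    w.\<close>
  define w where "w = min v (R - y)"
  have w: "0 \<le> w" "w \<le> v" "y + w \<le> R" "min (y + v) R = y + w" using False assms by (auto simp: w_def)
  have "(y + w) powr a - y powr a \<le> (x + w) powr a - x powr a"
    using assms w by (intro powr_increment_antimono) auto
  also have "(x + w) powr a \<le> min (x + v) R powr a"
    using assms w by (intro powr_mono2) auto
  finally show ?thesis using False assms w by simp
qed

lemma powr_primitive: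
  fixes x a :: real
  assumes "0 < x" "a \<noteq> 0"
  shows "((\<lambda>x. x powr a / a) has_real_derivative x powr (a - 1)) (at x)"
  using DERIV_cdivide[OF has_real_derivative_powr[OF assms(1), of a], of a] assms(2) by simp

text \<open>For V \<le> v subadditivity bounds the increment by v powr a; for V > v the estimate (1
  + s) powr a \<le> 1 + s with s = v / V linearizes it. \<open>max V v\<close> merges the two
  regimes.\<close>

lemma powr_increment_le:
  fixes V v a :: real
  assumes "0 \<le> V" "0 < v" "0 \<le> a" "a \<le> 1"
  shows "(V + v) powr a - V powr a \<le> v * max V v powr (a - 1)"
proof (cases "V \<le> v")
  case True
  have "(V + v) powr a - V powr a \<le> v powr a"
    using powr_subadditive[of V v a] assms by simp
  also have "\<dots> = v * v powr (a - 1)" using assms by (simp add: powr_diff)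
  finally show ?thesis using True by (simp add: max_absorb2)
next
  case False
  then have V: "0 < V" using assms by simp
  have "(V + v) powr a = V powr a * (1 + v / V) powr a"
    using V assms by (subst powr_mult[symmetric]) (auto simp: distrib_left)
  also have "\<dots> \<le> V powr a * (1 + v / V) powr 1"
    using V assms by (intro mult_left_mono powr_mono) auto
  also have "V powr a * (1 + v / V) powr 1 = V powr a + v * V powr (a - 1)"
    using V assms by (simp add: powr_diff field_simps)
  finally have "(V + v) powr a \<le> V powr a + v * V powr (a - 1)" by simp
  then show ?thesis using False by (simp add: max_absorb1)
qed

text \<open>\<eta> is the excess of \<alpha> over the critical exponent \<sigma> - 5/3. The bound
  \<eta> \<le> 2 - \<sigma> amounts to \<alpha> \<le> 1/3, and \<eta> \<le> 1/6 keeps the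
  denominator 1/3 - \<eta> at least 1/6.\<close>

locale scaling_exponents =
  fixes \<sigma> \<eta> \<alpha> :: real
  assumes \<sigma>: "5 / 3 < \<sigma>" "\<sigma> < 2" and \<eta>: "0 < \<eta>" "\<eta> \<le> 1 / 6" "\<eta> \<le> 2 - \<sigma>"
    and \<alpha>_eq: "\<alpha> = \<sigma> - 5 / 3 + \<eta>"
begin

lemma \<alpha>: "0 < \<alpha>" "\<alpha> \<le> 1 / 3" using \<sigma> \<eta> by (auto simp: \<alpha>_eq)

text \<open>The power kernel with base volume scaled to 1, in the variable w = v / V.
  Correspondingly \<open>k\<close> is the integrand of the generator applied to the \<alpha>-th
  power, and \<open>Q z\<close> is the integral of \<open>\<omega>\<close> over (z, \<infinity>),
  obtained by expanding the square.\<close>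

definition \<omega> :: "real \<Rightarrow> real" where
  "\<omega> w = w powr (- \<sigma>) * (1 + w powr (1 / 3))\<^sup>2"

definition k :: "real \<Rightarrow> real" where
  "k w = \<omega> w * ((1 + w) powr \<alpha> - 1)"

definition Q :: "real \<Rightarrow> real" where
  "Q z = z powr (1 - \<sigma>) / (\<sigma> - 1) + 2 * (z powr (4 / 3 - \<sigma>) / (\<sigma> - 4 / 3)) + z powr (5 / 3 - \<sigma>) / (\<sigma> - 5 / 3)"

lemma \<omega>_expand: "0 < w \<Longrightarrow> \<omega> w = w powr (- \<sigma>) + 2 * w powr (1 / 3 - \<sigma>) + w powr (2 / 3 - \<sigma>)"
proof -
  assume w: "0 < w"
  have "w powr (- \<sigma>) * w powr (1 / 3) = w powr (1 / 3 - \<sigma>)"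
    by (simp flip: powr_add)
  moreover have "w powr (- \<sigma>) * (w powr (1 / 3) * w powr (1 / 3)) = w powr (2 / 3 - \<sigma>)"
    by (simp flip: powr_add)
  ultimately show ?thesis
    unfolding \<omega>_def by (simp add: power2_eq_square algebra_simps)
qed

lemma Q_deriv:
  assumes "0 < z"
  shows "(Q has_real_derivative - \<omega> z) (at z)"
proof -
  have d: "((\<lambda>z. - (z powr (a + 1) / (a + 1))) has_real_derivative - (z powr a)) (at z)" if "a + 1 \<noteq> 0" for a
    using DERIV_minus[OF powr_primitive[OF assms that]] by simp
  have "((\<lambda>z. - (z powr (- \<sigma> + 1) / (- \<sigma> + 1)) + 2 * - (z powr (1/3 - \<sigma> + 1) / (1/3 - \<sigma> + 1)) + - (z powr (2/3 - \<sigma> + 1) / (2/3 - \<sigma> + 1)))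
    has_real_derivative (- (z powr (- \<sigma>)) + 2 * - (z powr (1/3 - \<sigma>)) + - (z powr (2/3 - \<sigma>)))) (at z)"
    using \<sigma> by (intro DERIV_add DERIV_cmult d) auto
  moreover have "Q = (\<lambda>z. - (z powr (- \<sigma> + 1) / (- \<sigma> + 1)) + 2 * - (z powr (1/3 - \<sigma> + 1) / (1/3 - \<sigma> + 1)) + - (z powr (2/3 - \<sigma> + 1) / (2/3 - \<sigma> + 1)))"
    by (simp add: Q_def fun_eq_iff minus_divide_right algebra_simps)
  ultimately show ?thesis using assms by (simp add: \<omega>_expand)
qed

lemma Q_lower: "0 < z \<Longrightarrow> z powr (5 / 3 - \<sigma>) / (\<sigma> - 5 / 3) \<le> Q z"
  using \<sigma> by (simp add: Q_def)

lemma k_le_small: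
  assumes "0 < w" "w \<le> 1"
  shows "k w \<le> 4 * w powr (1 - \<sigma>)"
proof -
  have "w powr (1 / 3) \<le> 1" using assms by (simp add: powr_le1)
  then have "(1 + w powr (1 / 3))\<^sup>2 \<le> 2\<^sup>2" by (intro power_mono) auto
  moreover have "(1 + w) powr \<alpha> \<le> (1 + w) powr 1" using assms \<alpha> by (intro powr_mono) auto
  ultimately have "k w \<le> (w powr (- \<sigma>) * 4) * w"
    unfolding k_def \<omega>_def using assms \<alpha> by (intro mult_mono) (auto intro: ge_one_powr_ge_zero)
  also have "\<dots> = 4 * w powr (1 - \<sigma>)" using assms by (simp add: powr_diff powr_minus divide_inverse)
  finally show ?thesis .
qed

lemma k_le_large:
  assumes "1 \<le> w"
  shows "k w \<le> w powr (\<eta> - 1) + 3 * w powr (\<eta> - 4 / 3)"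
proof -
  have "w powr (- \<sigma>) \<le> w powr (1 / 3 - \<sigma>)" using assms by (intro powr_mono) auto
  then have 1: "\<omega> w \<le> w powr (2 / 3 - \<sigma>) + 3 * w powr (1 / 3 - \<sigma>)"
    using assms by (simp add: \<omega>_expand)
  have 2: "(1 + w) powr \<alpha> - 1 \<le> w powr \<alpha>"
    using powr_subadditive[of 1 w \<alpha>] assms \<alpha> by simp
  have "k w \<le> (w powr (2 / 3 - \<sigma>) + 3 * w powr (1 / 3 - \<sigma>)) * w powr \<alpha>"
    unfolding k_def using 1 2 assms \<alpha> by (intro mult_mono) (auto intro: ge_one_powr_ge_zero)
  also have "\<dots> = w powr (2 / 3 - \<sigma> + \<alpha>) + 3 * w powr (1 / 3 - \<sigma> + \<alpha>)"
    by (simp add: powr_add distrib_right)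
  also have "2 / 3 - \<sigma> + \<alpha> = \<eta> - 1" by (simp add: \<alpha>_eq)
  also have "1 / 3 - \<sigma> + \<alpha> = \<eta> - 4 / 3" by (simp add: \<alpha>_eq)
  finally show ?thesis .
qed

lemma continuous_k: "0 < c \<Longrightarrow> continuous_on {c..} k"
  unfolding k_def \<omega>_def by (intro continuous_intros) auto

text \<open>Later only differences of \<Psi> enter, so any primitive will do; starting at a positive
  c stays away from the singularity of \<open>k\<close> at 0.\<close>

lemma primitive_exists:
  assumes "0 < c"
  obtains \<Psi> where "\<And>x. c < x \<Longrightarrow> (\<Psi> has_real_derivative k x) (at x)"
proof
  fix x assume x: "c < x"
  have "((\<lambda>x. integral {c..x} k) has_real_derivative k x) (at x within {c..x+1})"
    using x assms by (intro integral_has_real_derivative continuous_on_subset[OF continuous_k[OF assms]]) auto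
  moreover have "at x within {c..x+1} = at x" using x by (intro at_within_interior) auto
  ultimately show "((\<lambda>x. integral {c..x} k) has_real_derivative k x) (at x)" by simp
qed

lemma derivative_compare:
  fixes f g :: "real \<Rightarrow> real"
  assumes "a \<le> b" "\<And>x. a \<le> x \<Longrightarrow> x \<le> b \<Longrightarrow> (f has_real_derivative f' x) (at x)"
    "\<And>x. a \<le> x \<Longrightarrow> x \<le> b \<Longrightarrow> (g has_real_derivative g' x) (at x)"
    "\<And>x. a \<le> x \<Longrightarrow> x \<le> b \<Longrightarrow> f' x \<le> g' x"
  shows "f b - f a \<le> g b - g a"
proof -
  have "(\<lambda>x. g x - f x) a \<le> (\<lambda>x. g x - f x) b"
  proof (rule DERIV_nonneg_imp_nondecreasing[OF assms(1)])
    fix x assume x: "a \<le> x" "x \<le> b"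
    show "\<exists>y. ((\<lambda>x. g x - f x) has_real_derivative y) (at x) \<and> 0 \<le> y"
      by (rule exI[of _ "g' x - f' x"]) (use assms(2-4)[OF x] in \<open>auto intro: DERIV_diff\<close>)
  qed
  then show ?thesis by simp
qed

text \<open>4 / (2 - \<sigma>) is the integral over (0, 1) of the majorant 4 * w powr (1 -
  \<sigma>); 18 = 3 * 6 bounds the integral of 3 * w powr (\<eta> - 4/3) over [1, \<infinity>),
  because 1 / (1/3 - \<eta>) \<le> 6.\<close>

definition K0 :: real where "K0 = 18 + 4 / (2 - \<sigma>)"

text \<open>\<open>k_le_small\<close> is integrated below 1 and \<open>k_le_large\<close> above 1.
  The term growing with z is the primitive of w powr (\<eta> - 1); its coefficient is exactly 1, and
  the cancellation in \<open>scaled_generator_nondecreasing\<close> relies on that.\<close>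

lemma primitive_bound:
  assumes \<Psi>: "\<And>x. c < x \<Longrightarrow> (\<Psi> has_real_derivative k x) (at x)"
    and c: "0 < c" "c < a" "a \<le> 1" "1 \<le> z"
  shows "\<Psi> z - \<Psi> a \<le> K0 + (z powr \<eta> - 1) / \<eta>"
proof -
  have "\<Psi> 1 - \<Psi> a \<le> 4 * (1 powr (2 - \<sigma>) / (2 - \<sigma>)) - 4 * (a powr (2 - \<sigma>) / (2 - \<sigma>))"
  proof (rule derivative_compare[OF c(3), where f' = k and g' = "\<lambda>x. 4 * x powr (1 - \<sigma>)" and g = "\<lambda>x. 4 * (x powr (2 - \<sigma>) / (2 - \<sigma>))"])
    fix x assume x: "a \<le> x" "x \<le> 1"
    show "(\<Psi> has_real_derivative k x) (at x)" using x c by (intro \<Psi>) auto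
    show "((\<lambda>x. 4 * (x powr (2 - \<sigma>) / (2 - \<sigma>))) has_real_derivative 4 * x powr (1 - \<sigma>)) (at x)"
      using DERIV_cmult[OF powr_primitive[of x "2 - \<sigma>"], of 4] x c \<sigma> by simp
    show "k x \<le> 4 * x powr (1 - \<sigma>)" using x c by (intro k_le_small) auto
  qed
  also have "\<dots> \<le> 4 / (2 - \<sigma>)" using \<sigma> by simp
  finally have 1: "\<Psi> 1 - \<Psi> a \<le> 4 / (2 - \<sigma>)" .
  let ?g = "\<lambda>x. x powr \<eta> / \<eta> + 3 * (x powr (\<eta> - 1 / 3) / (\<eta> - 1 / 3))"
  have "\<Psi> z - \<Psi> 1 \<le> ?g z - ?g 1"
  proof (rule derivative_compare[OF c(4), where f' = k and g' = "\<lambda>x. x powr (\<eta> - 1) + 3 * x powr (\<eta> - 4 / 3)"])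
    fix x assume x: "1 \<le> x" "x \<le> z"
    show "(\<Psi> has_real_derivative k x) (at x)" using x c by (intro \<Psi>) auto
    have d: "((\<lambda>x. x powr a / a) has_real_derivative x powr (a - 1)) (at x)" if "a \<noteq> 0" for a
      using x that by (intro powr_primitive) auto
    have "(?g has_real_derivative x powr (\<eta> - 1) + 3 * x powr (\<eta> - 1 / 3 - 1)) (at x)"
      using \<eta> by (intro DERIV_add DERIV_cmult d) auto
    then show "(?g has_real_derivative x powr (\<eta> - 1) + 3 * x powr (\<eta> - 4 / 3)) (at x)" by simp
    show "k x \<le> x powr (\<eta> - 1) + 3 * x powr (\<eta> - 4 / 3)" using x by (intro k_le_large)
  qed
  also have "\<dots> = (z powr \<eta> - 1) / \<eta> + 3 * ((1 - z powr (\<eta> - 1 / 3)) / (1 / 3 - \<eta>))"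
  proof -
    have "y / (\<eta> - 1 / 3) = - (y / (1 / 3 - \<eta>))" for y
      by (metis minus_diff_eq divide_minus_right)
    then show ?thesis by (simp only:) (simp add: diff_divide_distrib)
  qed
  finally have 2: "\<Psi> z - \<Psi> 1 \<le> (z powr \<eta> - 1) / \<eta> + 3 * ((1 - z powr (\<eta> - 1 / 3)) / (1 / 3 - \<eta>))" .
  have "1 - z powr (\<eta> - 1 / 3) \<le> 6 * (1 / 3 - \<eta>)"
  proof -
    have "1 - z powr (\<eta> - 1 / 3) \<le> 1" by simp
    also have "1 \<le> 6 * (1 / 3 - \<eta>)" using \<eta>(2) by (simp add: right_diff_distrib)
    finally show ?thesis .
  qed
  then have "(1 - z powr (\<eta> - 1 / 3)) / (1 / 3 - \<eta>) \<le> 6"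
    using \<eta> by (subst pos_divide_le_eq) auto
  then show ?thesis using 1 2 unfolding K0_def by linarith
qed

text \<open>
  The scale-invariant form of the statement that the generator applied to the truncated power
  \<open>min V (2 * M) powr \<alpha>\<close> decreases; here \<open>b = 2 * M / V\<close>. To leading order in \<open>b\<close> the two sides of
  the derivative inequality agree, and the smallness of \<open>\<eta>\<close> and \<open>\<nu>\<close> decides its sign.
\<close>

lemma scaled_generator_nondecreasing:
  assumes \<Psi>: "\<And>x. c < x \<Longrightarrow> (\<Psi> has_real_derivative k x) (at x)"
    and c: "0 < c" and \<eta>K: "\<eta> * K0 \<le> 1 / 2" and \<nu>: "\<nu> \<le> 1" "4 * \<nu> powr (2 - \<sigma>) \<le> 1 / 2"
    and b: "2 \<le> b1" "b1 \<le> b2" "c < \<kappa> * b1" "\<kappa> * b2 \<le> \<nu>"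
  defines "B \<equiv> \<lambda>b. b powr (- \<eta>) * (\<Psi> (b - 1) - \<Psi> (\<kappa> * b) + (b powr \<alpha> - 1) * Q (b - 1))"
  shows "B b1 \<le> B b2"
proof (rule DERIV_nonneg_imp_nondecreasing[OF b(2)])
  fix b assume bb: "b1 \<le> b" "b \<le> b2"
  have b2: "2 \<le> b" using b bb by simp
  have \<kappa>: "0 < \<kappa>" using b c by (smt (verit) zero_less_mult_iff)
  have kb: "c < \<kappa> * b" "\<kappa> * b \<le> \<nu>"
    using b(3) mult_left_mono[OF bb(1), of \<kappa>] b(4) mult_left_mono[OF bb(2), of \<kappa>] \<kappa> by linarith+
  have cle: "c < b - 1" using kb \<nu> b2 by linarith
  let ?I = "\<Psi> (b - 1) - \<Psi> (\<kappa> * b) + (b powr \<alpha> - 1) * Q (b - 1)"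
  define I' where "I' = k (b - 1) - \<kappa> * k (\<kappa> * b) + (\<alpha> * b powr (\<alpha> - 1) * Q (b - 1) + (b powr \<alpha> - 1) * - \<omega> (b - 1))"
  have dI: "((\<lambda>b. \<Psi> (b - 1) - \<Psi> (\<kappa> * b) + (b powr \<alpha> - 1) * Q (b - 1)) has_real_derivative I') (at b)"
  proof -
    have 1: "((\<lambda>b. \<Psi> (b - 1)) has_real_derivative k (b - 1) * 1) (at b)"
      by (rule DERIV_chain2[where f = \<Psi> and g = "\<lambda>b. b - 1", OF \<Psi>[OF cle]]) (auto intro!: derivative_eq_intros)
    have 2: "((\<lambda>b. \<Psi> (\<kappa> * b)) has_real_derivative k (\<kappa> * b) * \<kappa>) (at b)"
      by (rule DERIV_chain2[where f = \<Psi> and g = "\<lambda>b. \<kappa> * b", OF \<Psi>[OF kb(1)]]) (auto intro!: derivative_eq_intros)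
    have 3: "((\<lambda>b. Q (b - 1)) has_real_derivative - \<omega> (b - 1) * 1) (at b)"
      by (rule DERIV_chain2[where f = Q and g = "\<lambda>b. b - 1", OF Q_deriv]) (use b2 in \<open>auto intro!: derivative_eq_intros\<close>)
    have 4: "((\<lambda>b. b powr \<alpha> - 1) has_real_derivative \<alpha> * b powr (\<alpha> - 1)) (at b)"
      using b2 by (auto intro!: derivative_eq_intros has_real_derivative_powr)
    show ?thesis
      by (rule DERIV_cong[OF DERIV_add[OF DERIV_diff[OF 1 2] DERIV_mult[OF 4 3]]])
        (simp add: I'_def algebra_simps)
  qed
  have dB: "(B has_real_derivative b powr (- \<eta>) * I' + (- \<eta> * b powr (- \<eta> - 1)) * ?I) (at b)"
    unfolding B_def
    using DERIV_mult[OF has_real_derivative_powr[of b "- \<eta>"] dI] b2 by (simp add: algebra_simps)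
  \<comment> \<open>The contributions of the moving endpoint b - 1 cancel, because the capped
    integrand is continuous where the cap is reached. What is left comes from the tail increment and
    from the lower cutoff.\<close>
  have "k (b - 1) = (b powr \<alpha> - 1) * \<omega> (b - 1)" by (simp add: k_def)
  then have I'_eq: "I' = \<alpha> * b powr (\<alpha> - 1) * Q (b - 1) - \<kappa> * k (\<kappa> * b)"
    by (simp add: I'_def algebra_simps)
  have bI': "b * I' = \<alpha> * b powr \<alpha> * Q (b - 1) - (\<kappa> * b) * k (\<kappa> * b)"
    using b2 by (simp add: I'_eq powr_diff field_simps)
  have Q1: "b powr \<eta> \<le> (\<sigma> - 5 / 3) * b powr \<alpha> * Q (b - 1)"
  proof -
    have "b powr (5 / 3 - \<sigma>) \<le> (b - 1) powr (5 / 3 - \<sigma>)"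
      using b2 \<sigma> by (intro powr_mono2') auto
    also have "\<dots> \<le> (\<sigma> - 5 / 3) * Q (b - 1)"
      using Q_lower[of "b - 1"] b2 \<sigma> by (simp add: field_simps)
    finally have "b powr \<alpha> * b powr (5 / 3 - \<sigma>) \<le> b powr \<alpha> * ((\<sigma> - 5 / 3) * Q (b - 1))"
      by (intro mult_left_mono) auto
    then show ?thesis by (simp add: \<alpha>_eq mult_ac flip: powr_add)
  qed
  have Q0: "0 \<le> Q (b - 1)"
    using b2 \<sigma> by (auto simp: Q_def intro!: add_nonneg_nonneg)
  have kk: "(\<kappa> * b) * k (\<kappa> * b) \<le> 1 / 2"
  proof -
    have p: "0 < \<kappa> * b" "\<kappa> * b \<le> 1" using kb c \<nu> by linarith+
    have "(\<kappa> * b) * k (\<kappa> * b) \<le> (\<kappa> * b) * (4 * (\<kappa> * b) powr (1 - \<sigma>))"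
      using p by (intro mult_left_mono k_le_small) auto
    also have "\<dots> = 4 * (\<kappa> * b) powr (2 - \<sigma>)"
    proof -
      have "(\<kappa> * b) powr (2 - \<sigma>) = (\<kappa> * b) powr (1 + (1 - \<sigma>))" by simp
      also have "\<dots> = (\<kappa> * b) * (\<kappa> * b) powr (1 - \<sigma>)"
        unfolding powr_add using p by simp
      finally show ?thesis by simp
    qed
    also have "\<dots> \<le> 4 * \<nu> powr (2 - \<sigma>)"
      using p kb \<sigma> by (intro mult_left_mono powr_mono2) auto
    finally show ?thesis using \<nu> by linarith
  qed
  have PP: "\<eta> * (\<Psi> (b - 1) - \<Psi> (\<kappa> * b)) \<le> 1 / 2 + (b powr \<eta> - 1)"
  proof -
    have "\<Psi> (b - 1) - \<Psi> (\<kappa> * b) \<le> K0 + ((b - 1) powr \<eta> - 1) / \<eta>"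
      using kb \<nu> b2 c by (intro primitive_bound[OF \<Psi>]) auto
    also have "\<dots> \<le> K0 + (b powr \<eta> - 1) / \<eta>"
      using b2 \<eta> by (intro add_mono divide_right_mono diff_mono powr_mono2) auto
    finally have "\<eta> * (\<Psi> (b - 1) - \<Psi> (\<kappa> * b)) \<le> \<eta> * (K0 + (b powr \<eta> - 1) / \<eta>)"
      using \<eta> by (intro mult_left_mono) auto
    also have "\<dots> = \<eta> * K0 + (b powr \<eta> - 1)" using \<eta> by (simp add: distrib_left)
    finally show ?thesis using \<eta>K by linarith
  qed
  \<comment> \<open>The balance: the tail gives at least b powr \<eta>, small jumps cost at most
    1/2, the bulk costs at most b powr \<eta> - 1/2. The thresholds 1/2 on \<eta> * K0 and on 4 *
    \<nu> powr (2 - \<sigma>) together use up exactly the 1 in b powr \<eta> - 1.\<close>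
  have "0 \<le> b * I' - \<eta> * ?I"
  proof -
    have "\<eta> * Q (b - 1) \<ge> 0" using Q0 \<eta> by simp
    moreover have "b * I' - \<eta> * ?I = (\<sigma> - 5 / 3) * b powr \<alpha> * Q (b - 1) + \<eta> * Q (b - 1)
        - (\<kappa> * b) * k (\<kappa> * b) - \<eta> * (\<Psi> (b - 1) - \<Psi> (\<kappa> * b))"
      unfolding bI' by (simp add: \<alpha>_eq algebra_simps)
    ultimately show ?thesis using Q1 kk PP by linarith
  qed
  then have "0 \<le> b powr (- \<eta> - 1) * (b * I' - \<eta> * ?I)" by (intro mult_nonneg_nonneg) auto
  also have "\<dots> = b powr (- \<eta>) * I' + (- \<eta> * b powr (- \<eta> - 1)) * ?I"
    using b2 by (simp add: powr_diff field_simps)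
  finally show "\<exists>y. (B has_real_derivative y) (at b) \<and> 0 \<le> y" using dB by blast
qed

lemma scale_\<omega>:
  assumes "0 < V" "0 < v"
  shows "V powr (2 / 3 - \<sigma>) * \<omega> (v / V) = v powr (- \<sigma>) * (V powr (1 / 3) + v powr (1 / 3))\<^sup>2"
proof -
  have "1 + (v / V) powr (1 / 3) = (V powr (1 / 3) + v powr (1 / 3)) / V powr (1 / 3)"
    using assms by (simp add: powr_divide field_simps)
  moreover have "(V powr (1 / 3))\<^sup>2 = V powr (2 / 3)"
    using assms by (simp add: power2_eq_square flip: powr_add)
  moreover have "(v / V) powr (- \<sigma>) = v powr (- \<sigma>) * V powr \<sigma>"
    using assms by (simp add: powr_divide powr_minus field_simps)
  ultimately have "\<omega> (v / V) = v powr (- \<sigma>) * V powr \<sigma> * ((V powr (1 / 3) + v powr (1 / 3))\<^sup>2 / V powr (2 / 3))"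
    by (simp add: \<omega>_def power_divide)
  then show ?thesis using assms by (simp add: powr_diff)
qed

text \<open>Split at z = 2 * M - V, the jump that reaches the cap. Below z the substitution w = v /
  V gives differences of \<Psi>; above z the increment is the constant (2 * M) powr \<alpha> - V
  powr \<alpha>, which multiplies the tail \<open>Q\<close>. All powers of V collect to V powr
  \<eta>, as 5/3 - \<sigma> + \<alpha> = \<eta>.\<close>

lemma truncated_generator_has_integral:
  assumes \<Psi>: "\<And>x. c < x \<Longrightarrow> (\<Psi> has_real_derivative k x) (at x)"
    and c: "0 < c" "c < \<tau> / V" and V: "0 < V" "V \<le> M" "\<tau> \<le> V"
  shows "((\<lambda>v. v powr (- \<sigma>) * (V powr (1 / 3) + v powr (1 / 3))\<^sup>2 * (min (V + v) (2 * M) powr \<alpha> - V powr \<alpha>))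
    has_integral V powr \<eta> * (\<Psi> (2 * M / V - 1) - \<Psi> (\<tau> / V) + ((2 * M / V) powr \<alpha> - 1) * Q (2 * M / V - 1))) {\<tau>..}"
    (is "(?f has_integral _) _")
proof -
  define z where "z = 2 * M - V"
  have z: "0 < z" "\<tau> \<le> z" "2 * M / V - 1 = z / V" using V by (auto simp: z_def field_simps)
  have \<tau>: "0 < \<tau>" using less_trans[OF c] V by (simp add: zero_less_divide_iff)
  have 1: "(?f has_integral (V powr \<eta> * \<Psi> (z / V) - V powr \<eta> * \<Psi> (\<tau> / V))) {\<tau>..z}"
  proof (rule fundamental_theorem_of_calculus[OF z(2)])
    fix v assume v: "v \<in> {\<tau>..z}"
    then have v0: "0 < v" using \<tau> by simp
    have "c < v / V" using c v V by (smt (verit) divide_right_mono atLeastAtMost_iff)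
    then have "((\<lambda>v. V powr \<eta> * \<Psi> (v / V)) has_real_derivative V powr \<eta> * (k (v / V) * (1 / V))) (at v)"
      using V by (intro DERIV_cmult DERIV_chain2[where f = \<Psi> and g = "\<lambda>v. v / V", OF \<Psi>])
        (auto intro!: derivative_eq_intros)
    moreover have "V powr \<eta> * (k (v / V) * (1 / V)) = ?f v"
    proof -
      have "(1 + v / V) powr \<alpha> - 1 = ((V + v) powr \<alpha> - V powr \<alpha>) / V powr \<alpha>"
        using V v0 by (simp add: diff_divide_distrib add_divide_distrib flip: powr_divide)
      moreover have "V powr \<eta> / V = V powr (2 / 3 - \<sigma>) * V powr \<alpha>"
      proof -
        have "V powr (2 / 3 - \<sigma>) * V powr \<alpha> = V powr (\<eta> - 1)" by (simp add: \<alpha>_eq flip: powr_add)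
        then show ?thesis using V by (simp add: powr_diff)
      qed
      ultimately have "V powr \<eta> * (k (v / V) * (1 / V)) = (V powr (2 / 3 - \<sigma>) * \<omega> (v / V)) * ((V + v) powr \<alpha> - V powr \<alpha>)"
        using V by (simp add: k_def field_simps)
      also have "\<dots> = ?f v" using v V v0 by (simp add: scale_\<omega> z_def min_def)
      finally show ?thesis .
    qed
    ultimately show "((\<lambda>v. V powr \<eta> * \<Psi> (v / V)) has_vector_derivative ?f v) (at v within {\<tau>..z})"
      by (simp add: has_real_derivative_iff_has_vector_derivative has_vector_derivative_at_within)
  qed
  define d where "d = (2 * M) powr \<alpha> - V powr \<alpha>"
  have 2: "(?f has_integral d * (V powr (2 / 3) * (z powr (1 - \<sigma>) / (\<sigma> - 1)) +
      2 * V powr (1 / 3) * (z powr (4 / 3 - \<sigma>) / (\<sigma> - 4 / 3)) + z powr (5 / 3 - \<sigma>) / (\<sigma> - 5 / 3))) {z..}"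
  proof -
    have t: "((\<lambda>x. x powr e) has_integral (z powr (e + 1) / (- e - 1))) {z..}" if "e < -1" for e
    proof -
      have "- (z powr (e + 1)) / (e + 1) = z powr (e + 1) / (- e - 1)" using that by (simp add: divide_simps) (simp add: algebra_simps)
      then show ?thesis using has_integral_powr_to_inf[OF that z(1)] by simp
    qed
    have "((\<lambda>v. d * (V powr (2 / 3) * v powr (- \<sigma>) + 2 * V powr (1 / 3) * v powr (1 / 3 - \<sigma>) + v powr (2 / 3 - \<sigma>)))
      has_integral d * (V powr (2 / 3) * (z powr (- \<sigma> + 1) / (- (- \<sigma>) - 1)) +
      2 * V powr (1 / 3) * (z powr (1 / 3 - \<sigma> + 1) / (- (1 / 3 - \<sigma>) - 1)) + z powr (2 / 3 - \<sigma> + 1) / (- (2 / 3 - \<sigma>) - 1))) {z..}"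
      using \<sigma> by (intro has_integral_mult_right has_integral_add t) auto
    then have "((\<lambda>v. d * (V powr (2 / 3) * v powr (- \<sigma>) + 2 * V powr (1 / 3) * v powr (1 / 3 - \<sigma>) + v powr (2 / 3 - \<sigma>)))
      has_integral d * (V powr (2 / 3) * (z powr (1 - \<sigma>) / (\<sigma> - 1)) +
      2 * V powr (1 / 3) * (z powr (4 / 3 - \<sigma>) / (\<sigma> - 4 / 3)) + z powr (5 / 3 - \<sigma>) / (\<sigma> - 5 / 3))) {z..}"
      by (simp add: algebra_simps)
    then show ?thesis
    proof (rule has_integral_eq[rotated])
      fix v assume v: "v \<in> {z..}"
      then have v0: "0 < v" using z by simp
      have e: "v powr (1 / 3 - \<sigma>) = v powr (- \<sigma>) * v powr (1 / 3)"
        "v powr (2 / 3 - \<sigma>) = v powr (- \<sigma>) * (v powr (1 / 3) * v powr (1 / 3))"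
        "V powr (2 / 3) = V powr (1 / 3) * V powr (1 / 3)"
        by (simp_all flip: powr_add)
      have "min (V + v) (2 * M) = 2 * M" using v by (simp add: z_def)
      then show "d * (V powr (2 / 3) * v powr (- \<sigma>) + 2 * V powr (1 / 3) * v powr (1 / 3 - \<sigma>) + v powr (2 / 3 - \<sigma>)) = ?f v"
        by (simp only: e d_def power2_eq_square) (simp add: algebra_simps)
    qed
  qed
  have "negligible ({\<tau>..z} \<inter> {z..})"
    by (rule negligible_subset[of "{z}"]) auto
  note U = has_integral_Un[OF 1 2 this]
  have "{\<tau>..z} \<union> {z..} = {\<tau>..}" using z(2) by auto
  with U have "(?f has_integral (V powr \<eta> * \<Psi> (z / V) - V powr \<eta> * \<Psi> (\<tau> / V)) +
     d * (V powr (2 / 3) * (z powr (1 - \<sigma>) / (\<sigma> - 1)) +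
      2 * V powr (1 / 3) * (z powr (4 / 3 - \<sigma>) / (\<sigma> - 4 / 3)) + z powr (5 / 3 - \<sigma>) / (\<sigma> - 5 / 3))) {\<tau>..}"
    by (simp only:)
  moreover have "d * (V powr (2 / 3) * (z powr (1 - \<sigma>) / (\<sigma> - 1)) +
      2 * V powr (1 / 3) * (z powr (4 / 3 - \<sigma>) / (\<sigma> - 4 / 3)) + z powr (5 / 3 - \<sigma>) / (\<sigma> - 5 / 3))
     = V powr \<eta> * (((2 * M / V) powr \<alpha> - 1) * Q (z / V))"
  proof -
    have gen: "V powr (5 / 3 - \<sigma> - p) * z powr p = V powr (5 / 3 - \<sigma>) * (z / V) powr p" for p
      using V z(1) by (simp add: powr_divide powr_diff[of V "5 / 3 - \<sigma>" p])
    have a: "V powr (2 / 3) * z powr (1 - \<sigma>) = V powr (5 / 3 - \<sigma>) * (z / V) powr (1 - \<sigma>)"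
      "V powr (1 / 3) * z powr (4 / 3 - \<sigma>) = V powr (5 / 3 - \<sigma>) * (z / V) powr (4 / 3 - \<sigma>)"
      "z powr (5 / 3 - \<sigma>) = V powr (5 / 3 - \<sigma>) * (z / V) powr (5 / 3 - \<sigma>)"
      using gen[of "1 - \<sigma>"] gen[of "4 / 3 - \<sigma>"] gen[of "5 / 3 - \<sigma>"] V by simp_all
    have b: "d = V powr \<alpha> * ((2 * M / V) powr \<alpha> - 1)"
      using V by (simp add: d_def powr_divide field_simps)
    have "V powr \<alpha> * V powr (5 / 3 - \<sigma>) = V powr \<eta>"
      by (simp add: \<alpha>_eq flip: powr_add)
    moreover have "V powr (2 / 3) * (z powr (1 - \<sigma>) / (\<sigma> - 1)) +
      2 * V powr (1 / 3) * (z powr (4 / 3 - \<sigma>) / (\<sigma> - 4 / 3)) + z powr (5 / 3 - \<sigma>) / (\<sigma> - 5 / 3)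
      = V powr (5 / 3 - \<sigma>) * Q (z / V)"
    proof -
      have "V powr (2 / 3) * (z powr (1 - \<sigma>) / (\<sigma> - 1)) +
      2 * V powr (1 / 3) * (z powr (4 / 3 - \<sigma>) / (\<sigma> - 4 / 3)) + z powr (5 / 3 - \<sigma>) / (\<sigma> - 5 / 3)
      = (V powr (2 / 3) * z powr (1 - \<sigma>)) / (\<sigma> - 1) +
      2 * ((V powr (1 / 3) * z powr (4 / 3 - \<sigma>)) / (\<sigma> - 4 / 3)) + z powr (5 / 3 - \<sigma>) / (\<sigma> - 5 / 3)"
        by simp
      also have "\<dots> = V powr (5 / 3 - \<sigma>) * Q (z / V)"
        unfolding a Q_def by (simp add: distrib_left)
      finally show ?thesis .
    qed
    ultimately show ?thesis unfolding b by (metis mult.assoc mult.commute)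
  qed
  moreover have "V powr \<eta> * (x - y + w) = (V powr \<eta> * x - V powr \<eta> * y) + V powr \<eta> * w" for x y w
    by (simp add: algebra_simps)
  ultimately show ?thesis unfolding z(3) by (simp only:)
qed

end

section \<open>Smoothing test functions\<close>

lemma root3_sum_square_le:
  assumes "0 \<le> x" "0 \<le> v" "x \<le> m" "v \<le> m"
  shows "(root 3 x + root 3 v)\<^sup>2 \<le> 4 * m powr (2 / 3)"
proof -
  have m: "0 \<le> m" using assms by linarith
  have "root 3 x \<le> m powr (1 / 3)" "root 3 v \<le> m powr (1 / 3)"
    using assms m by (auto simp: root_powr_inverse intro!: powr_mono2)
  then have "root 3 x + root 3 v \<le> 2 * m powr (1 / 3)" by linarith
  then have "(root 3 x + root 3 v)\<^sup>2 \<le> (2 * m powr (1 / 3))\<^sup>2"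
    using assms by (intro power_mono) (auto intro: add_nonneg_nonneg)
  also have "\<dots> = 4 * (m powr (1 / 3) * m powr (1 / 3))" by (simp add: power2_eq_square)
  also have "m powr (1 / 3) * m powr (1 / 3) = m powr (2 / 3)" by (simp flip: powr_add)
  finally show ?thesis .
qed

lemma X_space_diff:
  assumes "u \<in> X_space M" "u' \<in> X_space M"
  shows "(\<lambda>V. u V - u' V) \<in> X_space M"
proof -
  have "u V - u' V = u (ennreal M) - u' (ennreal M)" if "ennreal M \<le> V" for V
    using X_space_const[OF assms(1) that order_refl] X_space_const[OF assms(2) that order_refl] by simp
  then show ?thesis
    using C_compact_diff[OF assms[THEN X_space_C]] unfolding X_space_def constant_on_def by blast
qed

text \<open>The integral starts at -1 so that the derivative at 0 is two-sided. As
  \<open>ennreal\<close> sends negative reals to 0, the integrand is continued there by the constant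
  \<open>u 0\<close>.\<close>

definition primitive :: "(ennreal \<Rightarrow> real) \<Rightarrow> real \<Rightarrow> real" where
  "primitive u x = integral {-1..x} (\<lambda>z. u (ennreal z))"

definition right_average :: "(ennreal \<Rightarrow> real) \<Rightarrow> real \<Rightarrow> real \<Rightarrow> ennreal \<Rightarrow> real" where
  "right_average u M \<epsilon> V = (primitive u (clip M V + \<epsilon>) - primitive u (clip M V)) / \<epsilon>"

lemma primitive_deriv:
  assumes "u \<in> C_compact" "0 \<le> x"
  shows "(primitive u has_real_derivative u (ennreal x)) (at x)"
proof -
  have uc: "continuous_on S (\<lambda>z. u (ennreal z))" for S
    using continuous_shift[OF assms(1), of 0] continuous_on_subset by fastforce
  have "(primitive u has_real_derivative u (ennreal x)) (at x within {-1..x+1})"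
    unfolding primitive_def using assms by (intro integral_has_real_derivative uc) auto
  moreover have "at x within {-1..x+1} = at x" using assms by (intro at_within_interior) auto
  ultimately show ?thesis by simp
qed

section \<open>Consequences of the upper power bound, common to both kernels\<close>

locale jump_kernel =
  fixes \<sigma> C :: real and G :: "real \<Rightarrow> real"
  assumes \<sigma>: "5 / 3 < \<sigma>" "\<sigma> < 2"
    and G_meas: "set_borel_measurable lebesgue {0<..} G"
    and G_nonneg: "\<And>v. 0 < v \<Longrightarrow> 0 \<le> G v"
    and G_le: "\<And>v. 0 < v \<Longrightarrow> G v \<le> C * v powr (- \<sigma>)"
begin

lemma C_nonneg: "0 \<le> C"
  using G_nonneg[of 1] G_le[of 1] by simp

text \<open>Majorant of the jump integrand for a function with Lipschitz constant 1 that is constant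
  beyond \<open>M\<close>: the increment is at most min v M and the squared factor at most 4 * (max
  v M) powr (2/3). Its integral scales like M powr (8/3 - \<sigma>), with constant
  \<open>C1\<close>.\<close>

definition lipw :: "real \<Rightarrow> real \<Rightarrow> real" where
  "lipw M v = (if v \<le> M then 4 * C * M powr (2 / 3) * v powr (1 - \<sigma>) else 4 * C * M * v powr (2 / 3 - \<sigma>))"

definition C1 :: real where "C1 = 4 * C * (1 / (2 - \<sigma>) + 1 / (\<sigma> - 5 / 3))"

lemma C1_nonneg: "0 \<le> C1"
  using C_nonneg \<sigma> by (auto simp: C1_def intro!: mult_nonneg_nonneg add_nonneg_nonneg)

lemma lipw:
  assumes M: "0 < M"
  shows "set_integrable lebesgue {0<..} (lipw M)"
    and "(LINT v:{0<..}|lebesgue. lipw M v) = C1 * M powr (8 / 3 - \<sigma>)"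
proof -
  let ?I = "4 * C * M powr (2 / 3) * (M powr (1 - \<sigma> + 1) / (1 - \<sigma> + 1))"
  let ?J = "4 * C * M * (- (M powr (2 / 3 - \<sigma> + 1)) / (2 / 3 - \<sigma> + 1))"
  have 1: "((\<lambda>v. 4 * C * M powr (2 / 3) * v powr (1 - \<sigma>)) has_integral ?I) {0..M}"
    using \<sigma> M by (intro has_integral_mult_right has_integral_powr_from_0) auto
  have 2: "((\<lambda>v. 4 * C * M * v powr (2 / 3 - \<sigma>)) has_integral ?J) {M..}"
    using \<sigma> M by (intro has_integral_mult_right has_integral_powr_to_inf) auto
  have nn: "0 \<le> 4 * C * M powr (2 / 3) * v powr (1 - \<sigma>)" "0 \<le> 4 * C * M * v powr (2 / 3 - \<sigma>)" for v
    using C_nonneg M by auto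
  show "set_integrable lebesgue {0<..} (lipw M)"
    using two_piece_integral(1)[OF M 1 2 nn] by (simp add: lipw_def[abs_def])
  have "(LINT v:{0<..}|lebesgue. lipw M v) = ?I + ?J"
    using two_piece_integral(2)[OF M 1 2 nn] by (simp add: lipw_def[abs_def])
  also have "?I = 4 * C * (1 / (2 - \<sigma>)) * M powr (8 / 3 - \<sigma>)"
  proof -
    have "M powr (2 / 3) * M powr (2 - \<sigma>) = M powr (8 / 3 - \<sigma>)" by (simp flip: powr_add)
    then show ?thesis by simp
  qed
  also have "?J = 4 * C * (1 / (\<sigma> - 5 / 3)) * M powr (8 / 3 - \<sigma>)"
  proof -
    have "M * M powr (5 / 3 - \<sigma>) = M powr (1 + (5 / 3 - \<sigma>))" unfolding powr_add using M by simp
    then have *: "M * M powr (5 / 3 - \<sigma>) = M powr (8 / 3 - \<sigma>)" by simp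
    have "- (M powr (2 / 3 - \<sigma> + 1)) / (2 / 3 - \<sigma> + 1) = M powr (5 / 3 - \<sigma>) / (\<sigma> - 5 / 3)"
      by (simp add: minus_divide_left[symmetric] minus_divide_right algebra_simps)
    then show ?thesis using * by simp
  qed
  finally show "(LINT v:{0<..}|lebesgue. lipw M v) = C1 * M powr (8 / 3 - \<sigma>)"
    by (simp add: C1_def algebra_simps)
qed

lemma lipschitz_jump_le:
  assumes \<psi>: "\<psi> \<in> X_space M" and M: "0 < M" and B: "0 \<le> B"
    and lip: "\<And>x y. 0 \<le> x \<Longrightarrow> x \<le> y \<Longrightarrow> \<bar>\<psi> (ennreal y) - \<psi> (ennreal x)\<bar> \<le> B * (y - x)"
    and v: "0 < v"
  shows "\<bar>G v * (root 3 (clip M V) + root 3 v)\<^sup>2 * (\<psi> (V + ennreal v) - \<psi> V)\<bar> \<le> B * lipw M v"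
proof (cases "V < ennreal M")
  case False
  then have "\<psi> (V + ennreal v) - \<psi> V = 0"
    using X_space_const[OF \<psi>, of "V + ennreal v" V] by (simp add: add_increasing2)
  then show ?thesis using B C_nonneg M by (simp add: lipw_def)
next
  case True
  then obtain x where x: "V = ennreal x" "0 \<le> x" "x < M"
    by (cases V) (auto simp: ennreal_less_iff)
  have "\<psi> (V + ennreal v) = \<psi> (ennreal (min (x + v) M))"
  proof (cases "x + v \<le> M")
    case True
    then show ?thesis using x v by (simp flip: ennreal_plus)
  next
    case False
    then show ?thesis using x v M X_space_const[OF \<psi>, of "ennreal (x + v)" "ennreal M"]
      by (simp flip: ennreal_plus)
  qed
  then have "\<bar>\<psi> (V + ennreal v) - \<psi> V\<bar> \<le> B * (min (x + v) M - x)"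
    using lip[of x "min (x + v) M"] x v by simp
  also have "\<dots> \<le> B * min v M" using x B by (intro mult_left_mono) auto
  finally have inc: "\<bar>\<psi> (V + ennreal v) - \<psi> V\<bar> \<le> B * min v M" .
  have clip: "clip M V = x" using x by simp
  have gen: ?thesis if le: "(root 3 x + root 3 v)\<^sup>2 \<le> q" "C * v powr (- \<sigma>) * q * min v M = lipw M v" for q
  proof -
    have "G v * (root 3 x + root 3 v)\<^sup>2 * \<bar>\<psi> (V + ennreal v) - \<psi> V\<bar> \<le> (C * v powr (- \<sigma>) * q) * (B * min v M)"
      using G_nonneg[OF v] G_le[OF v] le(1) inc v M B C_nonneg order_trans[OF zero_le_power2 le(1)]
      by (intro mult_mono mult_nonneg_nonneg) auto
    also have "\<dots> = B * lipw M v" using le(2) by (simp add: mult_ac)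
    finally show ?thesis using G_nonneg[OF v] by (simp add: clip abs_mult)
  qed
  show ?thesis
  proof (cases "v \<le> M")
    case True
    have "v powr (- \<sigma>) * v = v powr (1 - \<sigma>)"
      using v by (simp add: powr_diff powr_minus divide_inverse)
    then show ?thesis using True x v
      by (intro gen[of "4 * M powr (2 / 3)"] root3_sum_square_le) (auto simp: lipw_def min_def mult_ac)
  next
    case False
    have "v powr (- \<sigma>) * v powr (2 / 3) = v powr (2 / 3 - \<sigma>)" by (simp flip: powr_add)
    then show ?thesis using False x v
      by (intro gen[of "4 * v powr (2 / 3)"] root3_sum_square_le) (auto simp: lipw_def min_def mult_ac)
  qed
qed

lemma jump_operator_lipschitz_bound:
  assumes \<psi>: "\<psi> \<in> X_space M" and M: "0 < M" and B: "0 \<le> B"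
    and lip: "\<And>x y. 0 \<le> x \<Longrightarrow> x \<le> y \<Longrightarrow> \<bar>\<psi> (ennreal y) - \<psi> (ennreal x)\<bar> \<le> B * (y - x)"
  shows "\<bar>jump_operator G \<psi> V\<bar> \<le> B * (C1 * M powr (8 / 3 - \<sigma>))"
proof -
  have "\<bar>jump_gen G (clip M) \<psi> V\<bar> \<le> (LINT v:{0<..}|lebesgue. B * lipw M v)"
    by (rule jump_gen_bound[OF G_meas X_space_C[OF \<psi>] _ lipschitz_jump_le[OF assms]])
      (use lipw(1)[OF M] in auto)
  then show ?thesis
    using M by (simp add: jump_operator_eq_jump_gen[OF \<psi>] lipw(2)[OF M])
qed

lemma jump_operator_C:
  assumes u: "u \<in> X_space M" and M: "0 < M" and w: "set_integrable lebesgue {0<..} w"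
    and b: "\<And>V v. 0 < v \<Longrightarrow> \<bar>G v * (root 3 (clip M V) + root 3 v)\<^sup>2 * (u (V + ennreal v) - u V)\<bar> \<le> w v"
  shows "jump_operator G u \<in> C_compact"
proof -
  have "jump_gen G (clip M) u \<in> C_compact"
    by (rule jump_gen_C[OF G_meas X_space_C[OF u] continuous_clip w b])
  moreover have "jump_operator G u = jump_gen G (clip M) u"
    using jump_operator_eq_jump_gen[OF u] M by (simp add: fun_eq_iff)
  ultimately show ?thesis by simp
qed

lemma jump_operator_diff:
  assumes u: "u \<in> X_space M" "u' \<in> X_space M" and M: "0 < M"
    and w: "set_integrable lebesgue {0<..} w" "set_integrable lebesgue {0<..} w'"
    and b: "\<And>v. 0 < v \<Longrightarrow> \<bar>G v * (root 3 (clip M V) + root 3 v)\<^sup>2 * (u (V + ennreal v) - u V)\<bar> \<le> w v"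
      "\<And>v. 0 < v \<Longrightarrow> \<bar>G v * (root 3 (clip M V) + root 3 v)\<^sup>2 * (u' (V + ennreal v) - u' V)\<bar> \<le> w' v"
  shows "jump_operator G (\<lambda>V. u V - u' V) V = jump_operator G u V - jump_operator G u' V"
proof -
  have X: "(\<lambda>V. u V - u' V) \<in> X_space M"
    by (rule X_space_diff[OF u])
  have "jump_gen G (clip M) (\<lambda>V. u V - u' V) V = (LINT v:{0<..}|lebesgue.
      G v * (root 3 (clip M V) + root 3 v)\<^sup>2 * (u (V + ennreal v) - u V)
      - G v * (root 3 (clip M V) + root 3 v)\<^sup>2 * (u' (V + ennreal v) - u' V))"
    unfolding jump_gen_def by (simp add: algebra_simps)
  also have "\<dots> = jump_gen G (clip M) u V - jump_gen G (clip M) u' V"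
    unfolding jump_gen_def
    by (intro set_integral_diff(2) set_integrable_jump_bound[OF G_meas X_space_C[OF u(1)] w(1) b(1)]
        set_integrable_jump_bound[OF G_meas X_space_C[OF u(2)] w(2) b(2)])
  finally show ?thesis
    using M by (simp add: jump_operator_eq_jump_gen[OF u(1)] jump_operator_eq_jump_gen[OF u(2)]
        jump_operator_eq_jump_gen[OF X])
qed

text \<open>
  Averaging over \<open>[x, x + \<epsilon>]\<close>, to the right only, preserves every modulus of continuity \<open>m x v\<close> that is
  antitone in the base point \<open>x\<close>; it needs no extension of \<open>u\<close> to the left of \<open>0\<close>.
\<close>

lemma right_average:
  assumes u: "u \<in> X_space M" and M: "0 < M" and \<epsilon>: "0 < \<epsilon>"
    and mod: "\<And>x v. 0 \<le> x \<Longrightarrow> 0 \<le> v \<Longrightarrow> \<bar>u (ennreal (x + v)) - u (ennreal x)\<bar> \<le> m x v"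
    and anti: "\<And>x y v. 0 \<le> x \<Longrightarrow> x \<le> y \<Longrightarrow> 0 \<le> v \<Longrightarrow> m y v \<le> m x v"
  shows "right_average u M \<epsilon> \<in> X_space M"
    and "\<exists>g. continuous_on {0..M} g \<and> (\<forall>x\<ge>M. g x = 0) \<and>
       (\<forall>x\<ge>0. ((\<lambda>v. right_average u M \<epsilon> (ennreal v)) has_real_derivative g x) (at x within {0..}))"
    and "\<And>x v. 0 \<le> x \<Longrightarrow> 0 \<le> v \<Longrightarrow>
       \<bar>right_average u M \<epsilon> (ennreal (x + v)) - right_average u M \<epsilon> (ennreal x)\<bar> \<le> m x v"
proof -
  define U where "U = primitive u"
  define f where "f x = (U (x + \<epsilon>) - U x) / \<epsilon>" for x
  define g where "g x = (u (ennreal (x + \<epsilon>)) - u (ennreal x)) / \<epsilon>" for x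
  have uc: "continuous_on S (\<lambda>z. u (ennreal z))" for S
    using continuous_shift[OF X_space_C[OF u], of 0] continuous_on_subset by fastforce
  have dU: "(U has_real_derivative u (ennreal x)) (at x)" if "0 \<le> x" for x
    unfolding U_def by (rule primitive_deriv[OF X_space_C[OF u] that])
  have dUs: "((\<lambda>x. U (x + a)) has_real_derivative u (ennreal (x + a))) (at x)" if "0 \<le> x" "0 \<le> a" for x a
    using DERIV_shift[of U "u (ennreal (x + a))" x a] dU[of "x + a"] that by simp
  have df: "(f has_real_derivative g x) (at x)" if "0 \<le> x" for x
    unfolding f_def g_def using that \<epsilon> by (intro DERIV_cdivide DERIV_diff dU dUs) auto
  have g0: "g x = 0" if "M \<le> x" for x
  proof -
    have "u (ennreal (x + \<epsilon>)) = u (ennreal x)"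
      using that \<epsilon> by (intro X_space_const[OF u] ennreal_leI) auto
    then show ?thesis by (simp add: g_def)
  qed
  have gc: "continuous_on {0..M} g"
  proof -
    have "continuous_on UNIV (\<lambda>x. u (ennreal (x + \<epsilon>)))"
      by (rule continuous_on_compose2[OF uc[of UNIV]]) (auto intro!: continuous_intros)
    then show ?thesis unfolding g_def using uc \<epsilon>
      by (intro continuous_intros) (auto intro: continuous_on_subset)
  qed
  have fc: "continuous_on {0..M} f"
    by (rule DERIV_continuous_on[where D = g], rule has_field_derivative_at_within[OF df]) auto
  have fM: "f x = f M" if "M \<le> x" for x
  proof -
    have "norm (f x - f M) \<le> 0 * norm (x - M)"
    proof (rule field_differentiable_bound[where S = "{M..}" and f' = g])
      show "(f has_real_derivative g z) (at z within {M..})" if "z \<in> {M..}" for z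
        using that M by (intro has_field_derivative_at_within[OF df]) auto
      show "norm (g z) \<le> 0" if "z \<in> {M..}" for z using that g0 by simp
    qed (use that in auto)
    then show ?thesis by simp
  qed
  have md: "\<bar>f (x + v) - f x\<bar> \<le> m x v" if xv: "0 \<le> x" "0 \<le> v" for x v
  proof -
    let ?D = "\<lambda>z. U (z + v) - U z"
    have "norm (?D (x + \<epsilon>) - ?D x) \<le> m x v * norm ((x + \<epsilon>) - x)"
    proof (rule field_differentiable_bound[where S = "{x..}" and f' = "\<lambda>z. u (ennreal (z + v)) - u (ennreal z)"])
      show "(?D has_real_derivative u (ennreal (z + v)) - u (ennreal z)) (at z within {x..})" if "z \<in> {x..}" for z
        using that xv by (intro has_field_derivative_at_within[OF DERIV_diff[OF dUs dU]]) auto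
      show "norm (u (ennreal (z + v)) - u (ennreal z)) \<le> m x v" if "z \<in> {x..}" for z
        using mod[of z v] anti[of x z v] that xv by simp
    qed (use \<epsilon> in auto)
    then have "\<bar>?D (x + \<epsilon>) - ?D x\<bar> \<le> m x v * \<epsilon>" using \<epsilon> by simp
    moreover have "f (x + v) - f x = (?D (x + \<epsilon>) - ?D x) / \<epsilon>"
      unfolding f_def diff_divide_distrib[symmetric]
      by (rule arg_cong[where f = "\<lambda>z. z / \<epsilon>"]) (simp add: algebra_simps)
    ultimately show ?thesis using \<epsilon> by (simp add: abs_divide divide_le_eq)
  qed
  have av: "right_average u M \<epsilon> = (\<lambda>V. f (clip M V))"
    by (simp add: right_average_def f_def U_def fun_eq_iff)
  have avx: "right_average u M \<epsilon> (ennreal x) = f x" if "0 \<le> x" for x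
    using fM[of x] that M by (cases "x \<le> M") (auto simp: av)
  show "right_average u M \<epsilon> \<in> X_space M"
    unfolding av using clip_in_X_space[OF fc] M by simp
  have "((\<lambda>v. right_average u M \<epsilon> (ennreal v)) has_real_derivative g x) (at x within {0..})" if "0 \<le> x" for x
    by (rule has_field_derivative_transform_within[OF has_field_derivative_at_within[OF df[OF that]], of 1])
      (use that avx in auto)
  then show "\<exists>g. continuous_on {0..M} g \<and> (\<forall>x\<ge>M. g x = 0) \<and>
       (\<forall>x\<ge>0. ((\<lambda>v. right_average u M \<epsilon> (ennreal v)) has_real_derivative g x) (at x within {0..}))"
    using gc g0 by blast
  show "\<bar>right_average u M \<epsilon> (ennreal (x + v)) - right_average u M \<epsilon> (ennreal x)\<bar> \<le> m x v"
    if "0 \<le> x" "0 \<le> v" for x v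
    using md[OF that] that by (simp add: avx del: ennreal_plus)
qed

text \<open>Two stages. Averages to the right inherit the modulus \<open>m\<close>, hence the
  majorant \<open>w\<close>, and their jump integrals converge by dominated convergence; they are
  once differentiable. They are then replaced by smooth functions with an error of Lipschitz
  constant \<open>\<epsilon> n\<close>, whose image under the jump operator is again of order
  \<open>\<epsilon> n\<close>.\<close>

lemma smooth_sequence:
  assumes u: "u \<in> X_space M" and M: "0 < M"
    and mod: "\<And>x v. 0 \<le> x \<Longrightarrow> 0 \<le> v \<Longrightarrow> \<bar>u (ennreal (x + v)) - u (ennreal x)\<bar> \<le> m x v"
    and anti: "\<And>x y v. 0 \<le> x \<Longrightarrow> x \<le> y \<Longrightarrow> 0 \<le> v \<Longrightarrow> m y v \<le> m x v"
    and w: "set_integrable lebesgue {0<..} w" "\<And>v. 0 < v \<Longrightarrow> 0 \<le> w v"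
    and b: "\<And>x v. 0 \<le> x \<Longrightarrow> x \<le> M \<Longrightarrow> 0 < v \<Longrightarrow> G v * (root 3 x + root 3 v)\<^sup>2 * m x v \<le> w v"
  obtains \<psi> K where "\<And>n. \<psi> n \<in> C_infty_compact \<inter> X_space M"
    "\<And>n V. \<bar>\<psi> n V\<bar> \<le> K" "\<And>V. (\<lambda>n. \<psi> n V) \<longlonglongrightarrow> u V"
    "\<And>n V. \<bar>jump_operator G (\<psi> n) V\<bar> \<le> K" "\<And>V. (\<lambda>n. jump_operator G (\<psi> n) V) \<longlonglongrightarrow> jump_operator G u V"
    "jump_operator G u \<in> C_compact" "\<And>n. jump_operator G (\<psi> n) \<in> C_compact"
proof -
  have jump: "\<bar>G v * (root 3 (clip M V) + root 3 v)\<^sup>2 * (\<phi> (V + ennreal v) - \<phi> V)\<bar> \<le> w v"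
    if \<phi>: "\<phi> \<in> X_space M" and mod: "\<And>x v. 0 \<le> x \<Longrightarrow> 0 \<le> v \<Longrightarrow> \<bar>\<phi> (ennreal (x + v)) - \<phi> (ennreal x)\<bar> \<le> m x v"
      and v: "0 < v" for \<phi> V v
  proof (cases "V < ennreal M")
    case False
    then have "\<phi> (V + ennreal v) - \<phi> V = 0"
      using X_space_const[OF \<phi>, of "V + ennreal v" V] by (simp add: add_increasing2)
    then show ?thesis using w(2)[OF v] by simp
  next
    case True
    then obtain x where x: "V = ennreal x" "0 \<le> x" "x < M"
      by (cases V) (auto simp: ennreal_less_iff)
    have "V + ennreal v = ennreal (x + v)" using x v by simp
    then have "\<bar>\<phi> (V + ennreal v) - \<phi> V\<bar> \<le> m x v" using mod[of x v] x v by simp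
    then have "G v * (root 3 x + root 3 v)\<^sup>2 * \<bar>\<phi> (V + ennreal v) - \<phi> V\<bar> \<le> G v * (root 3 x + root 3 v)\<^sup>2 * m x v"
      using G_nonneg[OF v] by (intro mult_left_mono) auto
    also have "\<dots> \<le> w v" using b[of x v] x v by simp
    finally show ?thesis using x M G_nonneg[OF v] by (simp add: abs_mult)
  qed
  define \<epsilon> where "\<epsilon> n = 1 / real (Suc n)" for n
  have \<epsilon>: "0 < \<epsilon> n" "\<epsilon> n \<le> 1" for n by (auto simp: \<epsilon>_def)
  have \<epsilon>0: "\<epsilon> \<longlonglongrightarrow> 0" unfolding \<epsilon>_def using LIMSEQ_Suc[OF lim_1_over_n[where 'a=real]] by simp
  define f where "f n = right_average u M (\<epsilon> n)" for n
  note dU = primitive_deriv[OF X_space_C[OF u]]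
  have fX: "f n \<in> X_space M" for n unfolding f_def by (rule right_average(1)[OF u M \<epsilon>(1) mod anti])
  have fm: "\<bar>f n (ennreal (x + v)) - f n (ennreal x)\<bar> \<le> m x v" if "0 \<le> x" "0 \<le> v" for n x v
    unfolding f_def by (rule right_average(3)[OF u M \<epsilon>(1) mod anti]) (use that in auto)
  have ex: "\<exists>\<psi>. \<psi> \<in> C_infty_compact \<and> \<psi> \<in> X_space M \<and> \<psi> (ennreal M) = f n (ennreal M) \<and>
      (\<forall>v w. 0 \<le> v \<longrightarrow> 0 \<le> w \<longrightarrow>
      \<bar>(f n (ennreal w) - \<psi> (ennreal w)) - (f n (ennreal v) - \<psi> (ennreal v))\<bar> \<le> \<epsilon> n * \<bar>w - v\<bar>)" for n
  proof -
    have "\<exists>g. continuous_on {0..M} g \<and> (\<forall>x\<ge>M. g x = 0) \<and>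
       (\<forall>x\<ge>0. ((\<lambda>v. f n (ennreal v)) has_real_derivative g x) (at x within {0..}))"
      unfolding f_def by (rule right_average(2)[OF u M \<epsilon>(1) mod anti])
    then obtain g where g: "continuous_on {0..M} g" "\<And>x. M \<le> x \<Longrightarrow> g x = 0"
      "\<And>x. 0 \<le> x \<Longrightarrow> ((\<lambda>v. f n (ennreal v)) has_real_derivative g x) (at x within {0..})"
      by blast
    show ?thesis
    proof (rule smooth_approximation[OF M fX g \<epsilon>(1)])
      fix \<psi> assume "\<psi> \<in> C_infty_compact" "\<psi> \<in> X_space M" "\<psi> (ennreal M) = f n (ennreal M)"
        "\<And>v w. 0 \<le> v \<Longrightarrow> 0 \<le> w \<Longrightarrow>
         \<bar>(f n (ennreal w) - \<psi> (ennreal w)) - (f n (ennreal v) - \<psi> (ennreal v))\<bar> \<le> \<epsilon> n * \<bar>w - v\<bar>"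
      then show ?thesis by (intro exI[of _ \<psi>]) simp
    qed
  qed
  obtain \<psi> where \<psi>: "\<And>n. \<psi> n \<in> C_infty_compact" "\<And>n. \<psi> n \<in> X_space M"
    "\<And>n. \<psi> n (ennreal M) = f n (ennreal M)"
    "\<And>n v w. 0 \<le> v \<Longrightarrow> 0 \<le> w \<Longrightarrow>
      \<bar>(f n (ennreal w) - \<psi> n (ennreal w)) - (f n (ennreal v) - \<psi> n (ennreal v))\<bar> \<le> \<epsilon> n * \<bar>w - v\<bar>"
    using ex by metis
  let ?d = "\<lambda>n V. f n V - \<psi> n V"
  have dX: "?d n \<in> X_space M" for n
    by (rule X_space_diff[OF fX \<psi>(2)])
  have dlip: "\<bar>?d n (ennreal y) - ?d n (ennreal x)\<bar> \<le> \<epsilon> n * (y - x)" if "0 \<le> x" "x \<le> y" for n x y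
    using \<psi>(4)[of x y n] that by simp
  \<comment> \<open>The smooth function agrees with \<open>f n\<close> at \<open>M\<close>, so the
    Lipschitz bound on the error also bounds its sup norm.\<close>
  have dle: "\<bar>?d n V\<bar> \<le> \<epsilon> n * M" for n V
  proof -
    have "\<bar>?d n (ennreal M) - ?d n (ennreal (clip M V))\<bar> \<le> \<epsilon> n * (M - clip M V)"
      using M by (intro dlip) (auto intro: clip_le)
    also have "\<dots> \<le> \<epsilon> n * M" using \<epsilon>(1)[of n] by (intro mult_left_mono) auto
    finally show ?thesis using X_space_clip[OF dX[of n], of V] M \<psi>(3)[of n] by simp
  qed
  obtain c where c: "0 \<le> c" "\<And>V. \<bar>u V\<bar> \<le> c" using C_compact_bounded[OF X_space_C[OF u]] by blast
  have f_tendsto: "(\<lambda>n. f n V) \<longlonglongrightarrow> u V" for V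
  proof -
    define x where "x = clip M V"
    have x: "0 \<le> x" "u V = u (ennreal x)" using X_space_clip[OF u] M by (auto simp: x_def)
    have "((\<lambda>h. (primitive u (x + h) - primitive u x) / h) \<longlongrightarrow> u (ennreal x)) (at 0)"
      using dU[OF x(1)] by (simp add: DERIV_def)
    moreover have "filterlim \<epsilon> (at 0) sequentially"
      using \<epsilon>0 \<epsilon>(1) by (auto simp: filterlim_at intro!: always_eventually less_imp_neq[symmetric])
    ultimately have "(\<lambda>n. (primitive u (x + \<epsilon> n) - primitive u x) / \<epsilon> n) \<longlonglongrightarrow> u (ennreal x)"
      by (rule filterlim_compose)
    then show ?thesis by (simp add: f_def right_average_def x(2) flip: x_def)
  qed
  have f_bound: "\<bar>f n V\<bar> \<le> c" for n V
  proof -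
    define x where "x = clip M V"
    have x: "0 \<le> x" by (simp add: x_def)
    have "norm (primitive u (x + \<epsilon> n) - primitive u x) \<le> c * norm (x + \<epsilon> n - x)"
    proof (rule field_differentiable_bound[where S = "{0..}" and f' = "\<lambda>z. u (ennreal z)"])
      show "(primitive u has_real_derivative u (ennreal z)) (at z within {0..})" if "z \<in> {0..}" for z
        using that by (intro has_field_derivative_at_within[OF dU]) auto
    qed (use x \<epsilon>(1)[of n] c in auto)
    then show ?thesis using \<epsilon>(1)[of n] by (simp add: f_def right_average_def abs_divide divide_le_eq flip: x_def)
  qed
  let ?W = "LINT v:{0<..}|lebesgue. w v"
  let ?C = "C1 * M powr (8 / 3 - \<sigma>)"
  have Lf: "(\<lambda>n. jump_gen G (clip M) (f n) V) \<longlonglongrightarrow> jump_gen G (clip M) u V" for V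
    by (rule jump_gen_tendsto[where V = "\<lambda>_. V", OF G_meas X_space_C[OF fX] X_space_C[OF u] w(1)])
      (auto intro!: jump fX fm f_tendsto)
  have Lfb: "\<bar>jump_gen G (clip M) (f n) V\<bar> \<le> ?W" for n V
    by (rule jump_gen_bound[OF G_meas X_space_C[OF fX] w(1) jump[OF fX fm]])
  have Ld: "\<bar>jump_operator G (?d n) V\<bar> \<le> \<epsilon> n * ?C" for n V
    by (rule jump_operator_lipschitz_bound[OF dX M _ dlip]) (use \<epsilon>(1)[of n] in auto)
  have dj: "\<bar>G v * (root 3 (clip M V) + root 3 v)\<^sup>2 * (?d n (V + ennreal v) - ?d n V)\<bar> \<le> \<epsilon> n * lipw M v"
    if "0 < v" for v V n
    by (rule lipschitz_jump_le[OF dX M _ dlip that]) (use \<epsilon>(1)[of n] in auto)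
  have iw: "set_integrable lebesgue {0<..} (\<lambda>v. \<epsilon> n * lipw M v)" for n
    using lipw(1)[OF M] by simp
  have L\<psi>: "jump_operator G (\<psi> n) V = jump_operator G (f n) V - jump_operator G (?d n) V" for n V
    using jump_operator_diff[OF fX[of n] dX[of n] M w(1) iw[of n] jump[OF fX fm] dj, of V] by simp
  show ?thesis
  proof (rule that[of \<psi> "(c + M) + (?W + ?C)"])
    have C0: "0 \<le> ?C" using C1_nonneg by simp
    have W0: "0 \<le> ?W" using Lfb[of 0 0] by linarith
    have e: "\<epsilon> n * M \<le> M" "\<epsilon> n * ?C \<le> ?C" for n
      using \<epsilon>[of n] M C0 by (auto intro: mult_left_le_one_le)
    show "\<bar>\<psi> n V\<bar> \<le> (c + M) + (?W + ?C)" for n V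
      using f_bound[of n V] dle[of n V] e[of n] C0 W0 by linarith
    show "\<bar>jump_operator G (\<psi> n) V\<bar> \<le> (c + M) + (?W + ?C)" for n V
      using Lfb[of n V] Ld[of n V] e[of n] c(1) M
      unfolding L\<psi>[of n V] jump_operator_eq_jump_gen[OF fX less_imp_le[OF M]] by linarith
    have d0: "(\<lambda>n. ?d n V) \<longlonglongrightarrow> 0" for V
    proof (rule Lim_null_comparison[OF always_eventually])
      show "\<forall>n. norm (?d n V) \<le> \<epsilon> n * M" using dle by simp
      show "(\<lambda>n. \<epsilon> n * M) \<longlonglongrightarrow> 0" using tendsto_mult[OF \<epsilon>0 tendsto_const[of M]] by simp
    qed
    show "(\<lambda>n. \<psi> n V) \<longlonglongrightarrow> u V" for V
      using tendsto_diff[OF f_tendsto[of V] d0[of V]] by simp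
    have Ld0: "(\<lambda>n. jump_operator G (?d n) V) \<longlonglongrightarrow> 0" for V
    proof (rule Lim_null_comparison[OF always_eventually])
      show "\<forall>n. norm (jump_operator G (?d n) V) \<le> \<epsilon> n * ?C" using Ld by simp
      show "(\<lambda>n. \<epsilon> n * ?C) \<longlonglongrightarrow> 0" using tendsto_mult[OF \<epsilon>0 tendsto_const[of ?C]] by simp
    qed
    show "(\<lambda>n. jump_operator G (\<psi> n) V) \<longlonglongrightarrow> jump_operator G u V" for V
      using tendsto_diff[OF Lf[of V] Ld0[of V]]
      unfolding L\<psi> jump_operator_eq_jump_gen[OF fX less_imp_le[OF M]] jump_operator_eq_jump_gen[OF u less_imp_le[OF M]]
      by simp
    show "jump_operator G u \<in> C_compact"
      by (rule jump_operator_C[OF u M w(1) jump[OF u mod]])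
    have "jump_operator G (\<psi> n) = (\<lambda>V. jump_operator G (f n) V - jump_operator G (?d n) V)" for n
      using L\<psi> by blast
    moreover have "jump_operator G (f n) \<in> C_compact" for n
      by (rule jump_operator_C[OF fX M w(1) jump[OF fX fm]])
    moreover have "jump_operator G (?d n) \<in> C_compact" for n
      by (rule jump_operator_C[OF dX M iw dj])
    ultimately show "jump_operator G (\<psi> n) \<in> C_compact" for n
      using C_compact_diff by simp
  qed (use \<psi> in auto)
qed

end

section \<open>Existence and uniqueness from a generator approximation\<close>

lemma halfline_deriv_1:
  assumes "halfline_deriv 0 \<psi> differentiable (at v within {0..})"
  shows "((\<lambda>v. \<psi> (ennreal v)) has_real_derivative halfline_deriv 1 \<psi> v) (at v within {0..})"
  using assms by (simp add: halfline_deriv_def has_real_derivative_iff_has_vector_derivative vector_derivative_works)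

lemma halfline_lipschitz:
  assumes d: "\<And>v. 0 \<le> v \<Longrightarrow> halfline_deriv 0 \<psi> differentiable (at v within {0..})"
    and B: "\<And>v. 0 \<le> v \<Longrightarrow> \<bar>halfline_deriv 1 \<psi> v\<bar> \<le> B" and xy: "0 \<le> x" "x \<le> y"
  shows "\<bar>\<psi> (ennreal y) - \<psi> (ennreal x)\<bar> \<le> B * (y - x)"
proof -
  have "norm (\<psi> (ennreal y) - \<psi> (ennreal x)) \<le> B * norm (y - x)"
  proof (rule field_differentiable_bound[where S = "{0..}" and f' = "halfline_deriv 1 \<psi>" and f = "\<lambda>v. \<psi> (ennreal v)"])
    show "((\<lambda>v. \<psi> (ennreal v)) has_real_derivative halfline_deriv 1 \<psi> z) (at z within {0..})" if "z \<in> {0..}" for z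
      using that by (intro halfline_deriv_1 d) auto
  qed (use xy B in auto)
  then show ?thesis using xy by simp
qed

lemma C_infty_compactD:
  assumes "\<psi> \<in> C_infty_compact"
  shows "0 \<le> v \<Longrightarrow> halfline_deriv k \<psi> differentiable (at v within {0..})"
  using assms by (simp add: C_infty_compact_def)

lemma smooth_deriv_bounded:
  assumes \<psi>: "\<psi> \<in> C_infty_compact"
  obtains B where "0 \<le> B" "\<And>v. 0 \<le> v \<Longrightarrow> \<bar>halfline_deriv k \<psi> v\<bar> \<le> B"
proof -
  obtain l where l: "(halfline_deriv k \<psi> \<longlongrightarrow> l) at_top"
    using \<psi> unfolding C_infty_compact_def by blast
  have "\<forall>\<^sub>F v in at_top. dist (halfline_deriv k \<psi> v) l < 1" by (rule tendstoD[OF l]) simp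
  then obtain N where N: "\<And>v. N \<le> v \<Longrightarrow> dist (halfline_deriv k \<psi> v) l < 1"
    by (auto simp: eventually_at_top_linorder)
  have "continuous_on {0..} (halfline_deriv k \<psi>)"
    unfolding continuous_on_eq_continuous_within
    by (intro ballI differentiable_imp_continuous_within C_infty_compactD[OF \<psi>]) auto
  then have "continuous_on {0..\<bar>N\<bar>} (halfline_deriv k \<psi>)" by (rule continuous_on_subset) auto
  then have "bounded (halfline_deriv k \<psi> ` {0..\<bar>N\<bar>})"
    by (intro compact_imp_bounded compact_continuous_image) auto
  then obtain b where "\<forall>x\<in>halfline_deriv k \<psi> ` {0..\<bar>N\<bar>}. norm x \<le> b"
    unfolding bounded_iff by blast
  then have b: "\<bar>halfline_deriv k \<psi> v\<bar> \<le> b" if "v \<in> {0..\<bar>N\<bar>}" for v using that by simp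
  have b0: "0 \<le> b" using b[of 0] by simp
  show ?thesis
  proof (rule that[of "b + \<bar>l\<bar> + 1"])
    show "\<bar>halfline_deriv k \<psi> v\<bar> \<le> b + \<bar>l\<bar> + 1" if v: "0 \<le> v" for v
    proof (cases "v \<le> \<bar>N\<bar>")
      case True
      then show ?thesis using b[of v] v by simp
    next
      case False
      then have "\<bar>halfline_deriv k \<psi> v - l\<bar> < 1" using N[of v] by (simp add: dist_real_def)
      then show ?thesis using b0 by linarith
    qed
  qed (use b0 in auto)
qed

lemma smooth_lipschitz:
  assumes \<psi>: "\<psi> \<in> C_infty_compact"
  obtains B where "0 \<le> B" "\<And>x y. 0 \<le> x \<Longrightarrow> x \<le> y \<Longrightarrow> \<bar>\<psi> (ennreal y) - \<psi> (ennreal x)\<bar> \<le> B * (y - x)"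
proof -
  obtain B where B: "0 \<le> B" "\<And>v. 0 \<le> v \<Longrightarrow> \<bar>halfline_deriv 1 \<psi> v\<bar> \<le> B"
    using smooth_deriv_bounded[OF \<psi>] by blast
  show ?thesis
    by (rule that[OF B(1)], rule halfline_lipschitz[OF C_infty_compactD[OF \<psi>] B(2)])
qed

lemma zero_smooth: "(\<lambda>_. 0) \<in> C_infty_compact \<inter> X_space M"
proof
  show "(\<lambda>_. 0) \<in> C_infty_compact"
    by (rule C_infty_compactI[of "\<lambda>_ _. 0"]) (auto intro: exI[of _ 0])
  show "(\<lambda>_. 0) \<in> X_space M" by (auto simp: X_space_def constant_on_def)
qed

lemma functional_continuous:
  assumes l: "\<And>t. t \<in> X \<Longrightarrow> bounded_functional m (l t)"
    and cont: "\<And>\<psi>. \<psi> \<in> C_compact \<Longrightarrow> continuous_on X (\<lambda>t. l t \<psi>)"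
    and u: "\<And>t. t \<in> X \<Longrightarrow> u t \<in> C_compact"
    and lim: "\<And>s e. s \<in> X \<Longrightarrow> e > 0 \<Longrightarrow> \<forall>\<^sub>F t in at s within X. \<forall>V. \<bar>u t V - u s V\<bar> \<le> e"
  shows "continuous_on X (\<lambda>t. l t (u t))"
  unfolding continuous_on_def
proof
  fix s assume s: "s \<in> X"
  have m: "0 \<le> m" using bounded_functional_nonneg[OF l[OF s]] .
  have 1: "((\<lambda>t. l t (u t) - l t (u s)) \<longlongrightarrow> 0) (at s within X)"
  proof (rule tendstoI)
    fix e :: real assume e: "e > 0"
    then have "e / (m + 1) > 0" using m by simp
    from lim[OF s this] have "\<forall>\<^sub>F t in at s within X. t \<in> X \<and> (\<forall>V. \<bar>u t V - u s V\<bar> \<le> e / (m + 1))"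
      by (intro eventually_conj) (auto simp: eventually_at_filter)
    then show "\<forall>\<^sub>F t in at s within X. dist (l t (u t) - l t (u s)) 0 < e"
    proof eventually_elim
      case (elim t)
      have "\<bar>l t (u t) - l t (u s)\<bar> \<le> m * (e / (m + 1))"
        using elim s by (intro bounded_functional_dist[OF l] u) auto
      also have "\<dots> < e" using m e by (simp add: field_simps)
      finally show ?case by simp
    qed
  qed
  have 2: "((\<lambda>t. l t (u s)) \<longlongrightarrow> l s (u s)) (at s within X)"
    using cont[OF u[OF s]] s by (simp add: continuous_on_def)
  show "((\<lambda>t. l t (u t)) \<longlongrightarrow> l s (u s)) (at s within X)"
    using tendsto_add[OF 1 2] by simp
qed

lemma bounded_functional_mono:
  assumes "bounded_functional m l" "m \<le> m'"
  shows "bounded_functional m' l"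
  unfolding bounded_functional_def
proof (intro conjI ballI allI impI)
  fix \<phi> \<psi> a b assume "\<phi> \<in> C_compact" "\<psi> \<in> C_compact"
  then show "l (\<lambda>V. a * \<phi> V + b * \<psi> V) = a * l \<phi> + b * l \<psi>"
    by (rule bounded_functionalD(1)[OF assms(1)])
next
  fix \<phi> c assume \<phi>: "\<phi> \<in> C_compact" "\<forall>V. \<bar>\<phi> V\<bar> \<le> c"
  then have "\<bar>l \<phi>\<bar> \<le> m * c" by (intro bounded_functionalD(2)[OF assms(1)]) auto
  also have "\<dots> \<le> m' * c"
    using \<phi>(2) assms(2) bounded_by_nonneg[of \<phi> c] by (intro mult_right_mono) auto
  finally show "\<bar>l \<phi>\<bar> \<le> m' * c" .
qed

text \<open>\<open>D_seq\<close> asks for bounded pointwise convergence of test functions and of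
  their images, which is enough against finite measures. \<open>lip_D\<close> is the link in the
  other direction: it places smooth test functions, and the ramps that detect mass at \<infinity>,
  in some \<open>D i\<close>.\<close>

locale jump_evolution = jump_kernel \<sigma> C G + generator_approximation P lam "jump_operator G" D n0 del
  for \<sigma> C G P lam and D :: "'i \<Rightarrow> (ennreal \<Rightarrow> real) set" and n0 del +
  assumes D_seq: "\<phi> \<in> D i \<Longrightarrow> \<exists>M>0. \<exists>\<psi> K. (\<forall>n. \<psi> n \<in> C_infty_compact \<inter> X_space M) \<and>
      (\<forall>n V. \<bar>\<psi> n V\<bar> \<le> K) \<and> (\<forall>V. (\<lambda>n. \<psi> n V) \<longlonglongrightarrow> \<phi> V) \<and>
      (\<forall>n V. \<bar>jump_operator G (\<psi> n) V\<bar> \<le> K) \<and>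
      (\<forall>V. (\<lambda>n. jump_operator G (\<psi> n) V) \<longlonglongrightarrow> jump_operator G \<phi> V) \<and>
      (\<forall>n. jump_operator G (\<psi> n) \<in> C_compact)"
    and lip_D: "0 < M \<Longrightarrow> \<phi> \<in> X_space M \<Longrightarrow> 0 \<le> B \<Longrightarrow>
      (\<And>x y. 0 \<le> x \<Longrightarrow> x \<le> y \<Longrightarrow> \<bar>\<phi> (ennreal y) - \<phi> (ennreal x)\<bar> \<le> B * (y - x)) \<Longrightarrow> \<exists>i. \<phi> \<in> D i"
begin

abbreviation "L \<equiv> jump_operator G"

lemma weak_solution_radon: "weak_solution G f0 f \<Longrightarrow> 0 \<le> t \<Longrightarrow> f t \<in> radon_measures"
proof -
  assume "weak_solution G f0 f" and t: "0 \<le> t"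
  then have "continuous_map (top_of_set {0..t+1}) weak_topology f" by (simp add: weak_solution_def)
  then show ?thesis using t unfolding continuous_map_weak_topology_iff by auto
qed

lemma weak_solution_continuous:
  assumes "weak_solution G f0 f" "\<psi> \<in> C_compact"
  shows "continuous_on {0..T} (\<lambda>t. \<integral>V. \<psi> V \<partial>f t)"
proof (cases "0 < T")
  case True
  then have "continuous_map (top_of_set {0..T}) weak_topology f" using assms(1) by (simp add: weak_solution_def)
  then show ?thesis using assms(2) unfolding continuous_map_weak_topology_iff by auto
next
  case False
  then have "{0..T} \<subseteq> {0}" by auto
  then show ?thesis by (rule continuous_on_subset[OF continuous_on_sing])
qed

lemma weak_solution_smooth:
  assumes f: "weak_solution G f0 f" and \<psi>: "\<psi> \<in> C_infty_compact \<inter> X_space M" and M: "0 < M" and t: "0 \<le> t"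
  shows "(\<integral>V. \<psi> V \<partial>f t) - (\<integral>V. \<psi> V \<partial>f 0) = (LBINT s:{0..t}. (\<integral>V. L \<psi> V \<partial>f s))"
\<comment> \<open>Weak solutions are tested on intervals with T > 0, so t = 0 is treated apart; both
  sides are then 0.\<close>
proof (cases "t = 0")
  case True
  have "(LBINT s:{0..0}. (\<integral>V. L \<psi> V \<partial>f s)) = 0"
    unfolding set_lebesgue_integral_def
    by (rule integral_eq_zero_AE) (auto intro!: AE_I'[of "{0::real}"])
  then show ?thesis using True by simp
next
  case False
  have tf: "test_function t (\<lambda>_. \<psi>) (\<lambda>_ _. 0)"
    unfolding test_function_def
  proof (intro conjI exI[of _ M] ballI)
    show "smooth_tendsto (\<lambda>s V. (\<psi> V - \<psi> V) / (s - s')) (\<lambda>_. 0) (at s' within {0..t})" for s'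
      by (simp add: smooth_tendsto_def uniform_limit_const)
    show "smooth_tendsto (\<lambda>_ _. 0) (\<lambda>_. 0) (at s' within {0..t})" for s'
      by (simp add: smooth_tendsto_def uniform_limit_const)
  qed (use M \<psi> zero_smooth in auto)
  have "0 < t" using t False by simp
  from f[unfolded weak_solution_def, THEN conjunct2, THEN spec, THEN mp, OF this, THEN conjunct2,
      THEN spec, THEN spec, THEN mp, OF tf]
  show ?thesis by simp
qed

text \<open>The total mass is the integral of the continuous function 1, hence continuous in time
  and bounded on [0, T].\<close>

lemma weak_solution_bounded_functional:
  assumes f: "weak_solution G f0 f"
  obtains m where "\<And>t. t \<in> {0..T} \<Longrightarrow> bounded_functional m (\<lambda>\<psi>. \<integral>V. \<psi> V \<partial>f t)"
proof -
  have "continuous_on {0..T} (\<lambda>t. \<integral>V. (1::real) \<partial>f t)"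
    using weak_solution_continuous[OF f C_compact_const[of 1]] .
  then have "bounded ((\<lambda>t. \<integral>V. (1::real) \<partial>f t) ` {0..T})"
    by (intro compact_imp_bounded compact_continuous_image) auto
  then obtain m where "\<forall>x\<in>(\<lambda>t. \<integral>V. (1::real) \<partial>f t) ` {0..T}. norm x \<le> m"
    unfolding bounded_iff by blast
  then have m: "\<bar>\<integral>V. (1::real) \<partial>f t\<bar> \<le> m" if "t \<in> {0..T}" for t using that by (simp del: lebesgue_integral_const)
  show ?thesis
  proof (rule that)
    fix t assume t: "t \<in> {0..T}"
    then have r: "f t \<in> radon_measures" using weak_solution_radon[OF f] by auto
    have "measure (f t) UNIV \<le> m" using m[OF t] radon_measuresD(2)[OF r] by simp
    then show "bounded_functional m (\<lambda>\<psi>. \<integral>V. \<psi> V \<partial>f t)"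
      by (rule bounded_functional_mono[OF radon_bounded_functional[OF r]])
  qed
qed

text \<open>Carries the weak identity from smooth functions to the classes that the approximating
  semigroups leave invariant, so that Duhamel's formula can be applied to a weak solution.\<close>

lemma weak_solution_D:
  assumes f: "weak_solution G f0 f" and \<phi>: "\<phi> \<in> D i" and t: "0 \<le> t"
  shows "(\<integral>V. \<phi> V \<partial>f t) - (\<integral>V. \<phi> V \<partial>f 0) = (LBINT s:{0..t}. (\<integral>V. L \<phi> V \<partial>f s))"
proof -
  obtain M \<psi> K where M: "M > 0" and \<psi>: "\<And>n. \<psi> n \<in> C_infty_compact \<inter> X_space M"
    and b: "\<And>n V. \<bar>\<psi> n V\<bar> \<le> K" and lim: "\<And>V. (\<lambda>n. \<psi> n V) \<longlonglongrightarrow> \<phi> V"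
    and bL: "\<And>n V. \<bar>L (\<psi> n) V\<bar> \<le> K" and limL: "\<And>V. (\<lambda>n. L (\<psi> n) V) \<longlonglongrightarrow> L \<phi> V"
    and LC: "\<And>n. L (\<psi> n) \<in> C_compact"
    using D_seq[OF \<phi>] by blast
  have conv: "(\<lambda>n. \<integral>V. q n V \<partial>f s) \<longlonglongrightarrow> (\<integral>V. r V \<partial>f s)"
    if "0 \<le> s" "\<And>n. q n \<in> C_compact" "r \<in> C_compact" "\<And>n V. \<bar>q n V\<bar> \<le> K" "\<And>V. (\<lambda>n. q n V) \<longlonglongrightarrow> r V"
    for q r s
  proof (rule integral_dominated_convergence[where w = "\<lambda>_. K"])
    have R: "f s \<in> radon_measures" by (rule weak_solution_radon[OF f that(1)])
    then interpret finite_measure "f s" by (rule radon_measuresD)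
    show "integrable (f s) (\<lambda>_. K)" by simp
    show "r \<in> borel_measurable (f s)" "\<And>n. q n \<in> borel_measurable (f s)"
      using radon_integrable[OF R] that by blast+
  qed (use that in auto)
  have \<psi>C: "\<psi> n \<in> C_compact" for n using \<psi>[of n] X_space_C by blast
  have 1: "(\<lambda>n. (\<integral>V. \<psi> n V \<partial>f t) - (\<integral>V. \<psi> n V \<partial>f 0)) \<longlonglongrightarrow> (\<integral>V. \<phi> V \<partial>f t) - (\<integral>V. \<phi> V \<partial>f 0)"
    by (intro tendsto_diff conv \<psi>C D_C[OF \<phi>] b lim t order_refl)
  obtain m where m: "\<And>s. s \<in> {0..t} \<Longrightarrow> bounded_functional m (\<lambda>\<psi>. \<integral>V. \<psi> V \<partial>f s)"
    using weak_solution_bounded_functional[OF f] by blast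
  have cm: "(\<lambda>s. indicator {0..t} s *\<^sub>R (\<integral>V. q V \<partial>f s)) \<in> borel_measurable lborel" if "q \<in> C_compact" for q
    using borel_integrable_atLeastAtMost'[OF weak_solution_continuous[OF f that, of t]]
    unfolding set_integrable_def by blast
  have 2: "(\<lambda>n. LBINT s:{0..t}. (\<integral>V. L (\<psi> n) V \<partial>f s)) \<longlonglongrightarrow> (LBINT s:{0..t}. (\<integral>V. L \<phi> V \<partial>f s))"
    unfolding set_lebesgue_integral_def
  proof (rule integral_dominated_convergence[where w = "\<lambda>s. indicator {0..t} s *\<^sub>R (m * K)"])
    show "integrable lborel (\<lambda>s. indicator {0..t} s *\<^sub>R (m * K))"
      using borel_integrable_atLeastAtMost'[of 0 t "\<lambda>_. m * K"] by (simp add: set_integrable_def)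
    show "AE s in lborel. (\<lambda>n. indicator {0..t} s *\<^sub>R (\<integral>V. L (\<psi> n) V \<partial>f s)) \<longlonglongrightarrow> indicator {0..t} s *\<^sub>R (\<integral>V. L \<phi> V \<partial>f s)"
    proof (intro AE_I2)
      fix s
      show "(\<lambda>n. indicator {0..t} s *\<^sub>R (\<integral>V. L (\<psi> n) V \<partial>f s)) \<longlonglongrightarrow> indicator {0..t} s *\<^sub>R (\<integral>V. L \<phi> V \<partial>f s)"
      proof (cases "s \<in> {0..t}")
        case True
        then have "(\<lambda>n. \<integral>V. L (\<psi> n) V \<partial>f s) \<longlonglongrightarrow> (\<integral>V. L \<phi> V \<partial>f s)"
          by (intro conv LC L_C[OF \<phi>] bL limL) auto
        then show ?thesis using True by simp
      qed simp
    qed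
    show "AE s in lborel. norm (indicator {0..t} s *\<^sub>R (\<integral>V. L (\<psi> n) V \<partial>f s)) \<le> indicator {0..t} s *\<^sub>R (m * K)" for n
    proof (intro AE_I2)
      fix s
      show "norm (indicator {0..t} s *\<^sub>R (\<integral>V. L (\<psi> n) V \<partial>f s)) \<le> indicator {0..t} s *\<^sub>R (m * K)"
      proof (cases "s \<in> {0..t}")
        case True
        then have "\<bar>\<integral>V. L (\<psi> n) V \<partial>f s\<bar> \<le> m * K" by (intro bounded_functionalD(2)[OF m] LC bL) auto
        then show ?thesis using True by simp
      qed simp
    qed
    show "(\<lambda>s. indicator {0..t} s *\<^sub>R (\<integral>V. L \<phi> V \<partial>f s)) \<in> borel_measurable lborel"
      by (rule cm[OF L_C[OF \<phi>]])
    show "(\<lambda>s. indicator {0..t} s *\<^sub>R (\<integral>V. L (\<psi> n) V \<partial>f s)) \<in> borel_measurable lborel" for n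
      by (rule cm[OF LC])
  qed
  have "(\<integral>V. \<psi> n V \<partial>f t) - (\<integral>V. \<psi> n V \<partial>f 0) = (LBINT s:{0..t}. (\<integral>V. L (\<psi> n) V \<partial>f s))" for n
    by (rule weak_solution_smooth[OF f \<psi> M t])
  then show ?thesis using LIMSEQ_unique[OF 1] 2 by simp
qed

text \<open>\<open>L \<phi>\<close> is continuous on [0, \<infinity>], so its integral against
  \<open>f t\<close> is continuous in time and the integrated identity can be differentiated at
  every t.\<close>

lemma weak_solution_deriv:
  assumes f: "weak_solution G f0 f" and \<phi>: "\<phi> \<in> D i" and t: "t \<in> {0..T}"
  shows "((\<lambda>t. \<integral>V. \<phi> V \<partial>f t) has_real_derivative (\<integral>V. L \<phi> V \<partial>f t)) (at t within {0..T})"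
proof -
  let ?k = "\<lambda>s. \<integral>V. L \<phi> V \<partial>f s"
  have c: "continuous_on {0..s} ?k" for s by (rule weak_solution_continuous[OF f L_C[OF \<phi>]])
  have eq: "(\<integral>V. \<phi> V \<partial>f s) = (\<integral>V. \<phi> V \<partial>f 0) + integral {0..s} ?k" if "s \<in> {0..T}" for s
    using weak_solution_D[OF f \<phi>, of s] that set_borel_integral_eq_integral(2)[OF borel_integrable_atLeastAtMost'[OF c[of s]]]
    by simp
  have "((\<lambda>s. (\<integral>V. \<phi> V \<partial>f 0) + integral {0..s} ?k) has_real_derivative ?k t) (at t within {0..T})"
    using integral_has_real_derivative[OF c t] by (auto intro!: derivative_eq_intros)
  from has_field_derivative_transform_within[OF this zero_less_one t]
  show ?thesis by (simp only: eq)
qed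

lemma smooth_D: "0 < M \<Longrightarrow> \<psi> \<in> C_infty_compact \<Longrightarrow> \<psi> \<in> X_space M \<Longrightarrow> \<exists>i. \<psi> \<in> D i"
  using smooth_lipschitz lip_D by (metis (no_types))

text \<open>Time differentiability in \<open>C\<^sup>1\<close> of the test functions makes \<open>t \<mapsto> L (\<phi> t)\<close> continuous in the sup norm.\<close>

lemma test_function_estimates:
  assumes tf: "test_function T \<phi> \<phi>'" and s: "s \<in> {0..T}" and e: "0 < e"
  shows "\<forall>\<^sub>F t in at s within {0..T}. \<forall>V. \<bar>(\<phi> t V - \<phi> s V) / (t - s) - \<phi>' s V\<bar> \<le> e"
    and "\<forall>\<^sub>F t in at s within {0..T}. \<forall>V. \<bar>\<phi>' t V - \<phi>' s V\<bar> \<le> e"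
    and "\<forall>\<^sub>F t in at s within {0..T}. \<forall>V. \<bar>L (\<phi> t) V - L (\<phi> s) V\<bar> \<le> e"
proof -
  obtain M where M: "0 < M" and sm: "\<And>t. t \<in> {0..T} \<Longrightarrow> \<phi> t \<in> C_infty_compact \<and> \<phi> t \<in> X_space M"
    "\<And>t. t \<in> {0..T} \<Longrightarrow> \<phi>' t \<in> C_infty_compact \<and> \<phi>' t \<in> X_space M"
    using tf unfolding test_function_def by blast
  have t1: "smooth_tendsto (\<lambda>t V. (\<phi> t V - \<phi> s V) / (t - s)) (\<phi>' s) (at s within {0..T})"
    and t2: "smooth_tendsto \<phi>' (\<phi>' s) (at s within {0..T})"
    using tf s unfolding test_function_def by auto
  have inX: "\<forall>\<^sub>F t in at s within {0..T}. t \<in> {0..T} \<and> t \<noteq> s"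
    by (auto simp: eventually_at_filter)
  have clipV: "q V = q (ennreal (clip M V))" if "q \<in> X_space M" for q V
    using X_space_clip[OF that] M by simp
  have "\<forall>\<^sub>F t in at s within {0..T}. \<forall>v\<in>{0..}. dist (halfline_deriv 0 (\<lambda>V. (\<phi> t V - \<phi> s V) / (t - s)) v) (halfline_deriv 0 (\<phi>' s) v) < e"
    using t1 e by (intro uniform_limitD) (auto simp: smooth_tendsto_def)
  with inX show "\<forall>\<^sub>F t in at s within {0..T}. \<forall>V. \<bar>(\<phi> t V - \<phi> s V) / (t - s) - \<phi>' s V\<bar> \<le> e"
  proof eventually_elim
    case (elim t)
    show ?case
    proof
      fix V
      have "dist (halfline_deriv 0 (\<lambda>V. (\<phi> t V - \<phi> s V) / (t - s)) (clip M V)) (halfline_deriv 0 (\<phi>' s) (clip M V)) < e"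
        using elim(2) by simp
      moreover have "\<phi> t V = \<phi> t (ennreal (clip M V))" "\<phi> s V = \<phi> s (ennreal (clip M V))" "\<phi>' s V = \<phi>' s (ennreal (clip M V))"
        using clipV sm elim(1) s by blast+
      ultimately show "\<bar>(\<phi> t V - \<phi> s V) / (t - s) - \<phi>' s V\<bar> \<le> e"
        by (simp add: halfline_deriv_def dist_real_def)
    qed
  qed
  have "\<forall>\<^sub>F t in at s within {0..T}. \<forall>v\<in>{0..}. dist (halfline_deriv 0 (\<phi>' t) v) (halfline_deriv 0 (\<phi>' s) v) < e"
    using t2 e by (intro uniform_limitD) (auto simp: smooth_tendsto_def)
  with inX show "\<forall>\<^sub>F t in at s within {0..T}. \<forall>V. \<bar>\<phi>' t V - \<phi>' s V\<bar> \<le> e"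
  proof eventually_elim
    case (elim t)
    show ?case
    proof
      fix V
      have "dist (halfline_deriv 0 (\<phi>' t) (clip M V)) (halfline_deriv 0 (\<phi>' s) (clip M V)) < e"
        using elim(2) by simp
      moreover have "\<phi>' t V = \<phi>' t (ennreal (clip M V))" "\<phi>' s V = \<phi>' s (ennreal (clip M V))"
        using clipV sm elim(1) s by blast+
      ultimately show "\<bar>\<phi>' t V - \<phi>' s V\<bar> \<le> e" by (simp add: halfline_deriv_def dist_real_def)
    qed
  qed
  obtain B where B: "0 \<le> B" "\<And>v. 0 \<le> v \<Longrightarrow> \<bar>halfline_deriv 1 (\<phi>' s) v\<bar> \<le> B"
    using smooth_deriv_bounded sm(2)[OF s] by blast
  let ?C = "C1 * M powr (8 / 3 - \<sigma>)"
  \<comment> \<open>First derivatives of the difference quotients are uniformly close to that of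
    \<open>\<phi>' s\<close>, which gives them Lipschitz constant B + 1 for t near s. Hence
    \<open>\<phi> t - \<phi> s\<close> has Lipschitz constant
    \<open>(B + 1) * \<bar>t - s\<bar>\<close>, and the jump operator turns this into a sup bound
    with factor \<open>?C\<close>.\<close>
  define K where "K = (B + 1) * ?C + 1"
  have K: "0 < K" using B C1_nonneg by (auto simp: K_def intro!: add_nonneg_pos mult_nonneg_nonneg)
  have "\<forall>\<^sub>F t in at s within {0..T}. \<forall>v\<in>{0..}. dist (halfline_deriv 1 (\<lambda>V. (\<phi> t V - \<phi> s V) / (t - s)) v) (halfline_deriv 1 (\<phi>' s) v) < 1"
    using t1 by (intro uniform_limitD) (auto simp: smooth_tendsto_def)
  moreover have "\<forall>\<^sub>F t in at s within {0..T}. dist t s < e / K"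
    using e K by (intro tendstoD[OF tendsto_ident_at]) simp
  ultimately show "\<forall>\<^sub>F t in at s within {0..T}. \<forall>V. \<bar>L (\<phi> t) V - L (\<phi> s) V\<bar> \<le> e"
    using inX
  proof eventually_elim
    case (elim t)
    let ?q = "\<lambda>V. (\<phi> t V - \<phi> s V) / (t - s)"
    have t: "t \<in> {0..T}" "t \<noteq> s" using elim by auto
    have q1: "\<bar>halfline_deriv 1 ?q v\<bar> \<le> B + 1" if "0 \<le> v" for v
    proof -
      have "\<bar>halfline_deriv 1 ?q v - halfline_deriv 1 (\<phi>' s) v\<bar> < 1"
        using elim(1) that by (simp add: dist_real_def)
      then show ?thesis using B(2)[OF that] by linarith
    qed
    have qd: "halfline_deriv 0 ?q differentiable (at v within {0..})" if "0 \<le> v" for v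
    proof -
      have "((\<lambda>v. (\<phi> t (ennreal v) - \<phi> s (ennreal v)) / (t - s)) has_real_derivative
          (halfline_deriv 1 (\<phi> t) v - halfline_deriv 1 (\<phi> s) v) / (t - s)) (at v within {0..})"
        using sm(1) t s that by (intro DERIV_cdivide DERIV_diff halfline_deriv_1 C_infty_compactD) auto
      then show ?thesis by (auto simp: halfline_deriv_def real_differentiable_def)
    qed
    have lip: "\<bar>(\<phi> t (ennreal y) - \<phi> s (ennreal y)) - (\<phi> t (ennreal x) - \<phi> s (ennreal x))\<bar> \<le> ((B + 1) * \<bar>t - s\<bar>) * (y - x)"
      if xy: "0 \<le> x" "x \<le> y" for x y
    proof -
      have "\<bar>?q (ennreal y) - ?q (ennreal x)\<bar> \<le> (B + 1) * (y - x)"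
        by (rule halfline_lipschitz[OF qd q1 xy])
      moreover have "?q (ennreal y) - ?q (ennreal x) =
        ((\<phi> t (ennreal y) - \<phi> s (ennreal y)) - (\<phi> t (ennreal x) - \<phi> s (ennreal x))) / (t - s)"
        by (simp only: diff_divide_distrib)
      ultimately show ?thesis using t(2) by (simp add: abs_divide divide_le_eq mult_ac)
    qed
    obtain B1 where B1: "0 \<le> B1" "\<And>x y. 0 \<le> x \<Longrightarrow> x \<le> y \<Longrightarrow> \<bar>\<phi> t (ennreal y) - \<phi> t (ennreal x)\<bar> \<le> B1 * (y - x)"
      using smooth_lipschitz sm(1)[OF t(1)] by blast
    obtain B2 where B2: "0 \<le> B2" "\<And>x y. 0 \<le> x \<Longrightarrow> x \<le> y \<Longrightarrow> \<bar>\<phi> s (ennreal y) - \<phi> s (ennreal x)\<bar> \<le> B2 * (y - x)"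
      using smooth_lipschitz sm(1)[OF s] by blast
    have X: "\<phi> t \<in> X_space M" "\<phi> s \<in> X_space M" using sm(1) t s by auto
    show ?case
    proof
      fix V
      have "L (\<lambda>V. \<phi> t V - \<phi> s V) V = L (\<phi> t) V - L (\<phi> s) V"
        by (rule jump_operator_diff[OF X M _ _ lipschitz_jump_le[OF X(1) M B1] lipschitz_jump_le[OF X(2) M B2]])
          (use lipw(1)[OF M] in auto)
      moreover have "\<bar>L (\<lambda>V. \<phi> t V - \<phi> s V) V\<bar> \<le> ((B + 1) * \<bar>t - s\<bar>) * ?C"
        by (rule jump_operator_lipschitz_bound[OF X_space_diff[OF X] M _ lip]) (use B in auto)
      moreover have "((B + 1) * \<bar>t - s\<bar>) * ?C \<le> K * \<bar>t - s\<bar>"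
      proof -
        have "((B + 1) * \<bar>t - s\<bar>) * ?C = ((B + 1) * ?C) * \<bar>t - s\<bar>" by simp
        also have "\<dots> \<le> K * \<bar>t - s\<bar>" by (intro mult_right_mono) (auto simp: K_def)
        finally show ?thesis .
      qed
      moreover have "K * \<bar>t - s\<bar> \<le> e" using elim(2) K by (simp add: dist_real_def field_simps)
      ultimately show "\<bar>L (\<phi> t) V - L (\<phi> s) V\<bar> \<le> e" by linarith
    qed
  qed
qed

text \<open>Time-dependent test functions reduce to fixed ones: the product rule adds the term with
  \<phi>', and integrating the derivative over [0, T] gives the weak identity.\<close>

lemma weak_solutionI:
  assumes f0: "f 0 = f0" and f: "\<And>t. 0 \<le> t \<Longrightarrow> f t \<in> radon_measures"
    and l: "\<And>t. 0 \<le> t \<Longrightarrow> bounded_functional m (\<lambda>\<psi>. \<integral>V. \<psi> V \<partial>f t)"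
    and cont: "\<And>\<psi> T. \<psi> \<in> C_compact \<Longrightarrow> continuous_on {0..T} (\<lambda>t. \<integral>V. \<psi> V \<partial>f t)"
    and deriv: "\<And>\<psi> i t T. \<psi> \<in> D i \<Longrightarrow> t \<in> {0..T} \<Longrightarrow>
      ((\<lambda>t. \<integral>V. \<psi> V \<partial>f t) has_real_derivative (\<integral>V. L \<psi> V \<partial>f t)) (at t within {0..T})"
  shows "weak_solution G f0 f"
  unfolding weak_solution_def
proof (intro conjI allI impI)
  show "f 0 = f0" by (rule f0)
  fix T :: real assume T: "0 < T"
  show "continuous_map (top_of_set {0..T}) weak_topology f"
    unfolding continuous_map_weak_topology_iff using f cont by auto
  fix \<phi> \<phi>' assume tf: "test_function T \<phi> \<phi>'"
  obtain M where M: "0 < M" and sm: "\<And>t. t \<in> {0..T} \<Longrightarrow> \<phi> t \<in> C_infty_compact \<and> \<phi> t \<in> X_space M"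
    "\<And>t. t \<in> {0..T} \<Longrightarrow> \<phi>' t \<in> C_infty_compact \<and> \<phi>' t \<in> X_space M"
    using tf unfolding test_function_def by blast
  have C: "\<phi> t \<in> C_compact" "\<phi>' t \<in> C_compact" if "t \<in> {0..T}" for t
    using sm[OF that] X_space_C by blast+
  have LC: "L (\<phi> t) \<in> C_compact" if "t \<in> {0..T}" for t
    using smooth_D[OF M] sm(1)[OF that] L_C by blast
  have lT: "bounded_functional m (\<lambda>\<psi>. \<integral>V. \<psi> V \<partial>f t)" if "t \<in> {0..T}" for t using that l by auto
  let ?F = "\<lambda>t. \<integral>V. \<phi> t V \<partial>f t" and ?a = "\<lambda>t. \<integral>V. \<phi>' t V \<partial>f t" and ?b = "\<lambda>t. \<integral>V. L (\<phi> t) V \<partial>f t"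
  have dF: "(?F has_real_derivative ?b t + ?a t) (at t within {0..T})" if t: "t \<in> {0..T}" for t
  proof (rule functional_product_rule[where m = m and l = "\<lambda>t \<psi>. \<integral>V. \<psi> V \<partial>f t" and u = \<phi> and w = "\<phi>' t", OF lT t])
    show "((\<lambda>s. \<integral>V. \<phi>' t V \<partial>f s) \<longlongrightarrow> \<integral>V. \<phi>' t V \<partial>f t) (at t within {0..T})"
      using cont[OF C(2)[OF t], of T] t by (simp add: continuous_on_def)
    obtain i where "\<phi> t \<in> D i" using smooth_D[OF M] sm(1)[OF t] by blast
    then show "((\<lambda>s. \<integral>V. \<phi> t V \<partial>f s) has_real_derivative ?b t) (at t within {0..T})" using t by (rule deriv)
  qed (use t C test_function_estimates(1)[OF tf t] in auto)
  have ca: "continuous_on {0..T} ?a"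
    by (rule functional_continuous[where m = m and l = "\<lambda>t \<psi>. \<integral>V. \<psi> V \<partial>f t", OF lT cont C(2) test_function_estimates(2)[OF tf]])
  have cb: "continuous_on {0..T} ?b"
    by (rule functional_continuous[where m = m and l = "\<lambda>t \<psi>. \<integral>V. \<psi> V \<partial>f t" and u = "\<lambda>t. L (\<phi> t)", OF lT cont LC test_function_estimates(3)[OF tf]])
  have "((\<lambda>t. ?b t + ?a t) has_integral (?F T - ?F 0)) {0..T}"
    using T dF by (intro fundamental_theorem_of_calculus)
      (auto simp flip: has_real_derivative_iff_has_vector_derivative)
  then have "?F T - ?F 0 = integral {0..T} (\<lambda>t. ?b t + ?a t)" by (simp add: integral_unique)
  also have "\<dots> = integral {0..T} ?b + integral {0..T} ?a"
    by (intro integral_add integrable_continuous_interval ca cb)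
  also have "integral {0..T} ?a = (LBINT t:{0..T}. ?a t)"
    using set_borel_integral_eq_integral(2)[OF borel_integrable_atLeastAtMost'[OF ca]] by simp
  also have "integral {0..T} ?b = (LBINT t:{0..T}. ?b t)"
    using set_borel_integral_eq_integral(2)[OF borel_integrable_atLeastAtMost'[OF cb]] by simp
  finally show "?F T - ?F 0 - (LBINT t:{0..T}. ?a t) = (LBINT t:{0..T}. ?b t)" by simp
qed

theorem evolution:
  assumes f0: "f0 \<in> radon_measures"
  shows "\<exists>f. weak_solution G f0 f \<and> (\<forall>g. weak_solution G f0 g \<longrightarrow> (\<forall>t\<ge>0. g t = f t)) \<and>
    (emeasure f0 {\<infinity>} = 0 \<longrightarrow> (\<forall>t\<ge>0. emeasure (f t) {\<infinity>} = 0))"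
proof -
  define m where "m = measure f0 UNIV"
  interpret generator_approximation_functional P lam L D n0 del m "\<lambda>\<psi>. \<integral>V. \<psi> V \<partial>f0"
    by unfold_locales (auto simp: m_def intro: radon_bounded_functional[OF f0])
  \<comment> \<open>At t = 0 the measure is taken to be f0 itself, since a weak solution must start
    exactly there; the representation theorem supplies the measures at later times.\<close>
  have "\<exists>\<mu>. \<mu> \<in> radon_measures \<and> (\<forall>\<phi>\<in>C_compact. (\<integral>V. \<phi> V \<partial>\<mu>) = L_sol t \<phi>) \<and> (t = 0 \<longrightarrow> \<mu> = f0)" if t: "0 \<le> t" for t
  proof (cases "t = 0")
    case True
    then show ?thesis using f0 L_sol_0 by (intro exI[of _ f0]) auto
  next
    case False
    then show ?thesis using radon_representation[OF L_sol_bounded[OF t] L_sol_pos[OF _ _ t]] by blast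
  qed
  then obtain f where f: "\<And>t. 0 \<le> t \<Longrightarrow> f t \<in> radon_measures"
    and int: "\<And>t \<phi>. 0 \<le> t \<Longrightarrow> \<phi> \<in> C_compact \<Longrightarrow> (\<integral>V. \<phi> V \<partial>f t) = L_sol t \<phi>" and f_0: "f 0 = f0"
    by (metis order_refl)
  have bf: "bounded_functional m (\<lambda>\<psi>. \<integral>V. \<psi> V \<partial>f t)" if "0 \<le> t" for t
    using L_sol_bounded[OF that] unfolding bounded_functional_def
    by (simp add: int[OF that] C_compact_lin)
  have ws: "weak_solution G f0 f"
  proof (rule weak_solutionI[where f = f and m = m, OF f_0])
    show "f t \<in> radon_measures" if "0 \<le> t" for t by (rule f[OF that])
    show "bounded_functional m (\<lambda>\<psi>. \<integral>V. \<psi> V \<partial>f t)" if "0 \<le> t" for t by (rule bf[OF that])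
    show "continuous_on {0..T} (\<lambda>t. \<integral>V. \<psi> V \<partial>f t)" if "\<psi> \<in> C_compact" for \<psi> T
      by (rule continuous_on_eq[OF L_sol_continuous[OF that]]) (simp add: int that)
    show "((\<lambda>t. \<integral>V. \<psi> V \<partial>f t) has_real_derivative (\<integral>V. L \<psi> V \<partial>f t)) (at t within {0..T})"
      if "\<psi> \<in> D i" "t \<in> {0..T}" for \<psi> i t T
    proof -
      have "((\<lambda>t. L_sol t \<psi>) has_real_derivative (\<integral>V. L \<psi> V \<partial>f t)) (at t within {0..T})"
        using L_sol_deriv[OF that] int[of t "L \<psi>"] L_C[OF that(1)] that(2) by simp
      from has_field_derivative_transform_within[OF this zero_less_one that(2)]
      show ?thesis using int D_C[OF that(1)] by simp
    qed
  qed
  moreover have "g t = f t" if g: "weak_solution G f0 g" and t: "0 \<le> t" for g t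
  proof (rule radon_measure_eqI[OF weak_solution_radon[OF g t] f[OF t]])
    fix \<psi> assume \<psi>: "\<psi> \<in> C_compact"
    obtain m' where m': "\<And>s. s \<in> {0..t} \<Longrightarrow> bounded_functional m' (\<lambda>\<psi>. \<integral>V. \<psi> V \<partial>g s)"
      using weak_solution_bounded_functional[OF g] by blast
    have "g 0 = f0" using g by (simp add: weak_solution_def)
    then have "(\<integral>V. \<psi> V \<partial>g t) = L_sol t \<psi>"
      using L_sol_unique[where l = "\<lambda>t \<psi>. \<integral>V. \<psi> V \<partial>g t", OF t m' weak_solution_continuous[OF g] weak_solution_deriv[OF g] _ \<psi>]
      by simp
    then show "(\<integral>V. \<psi> V \<partial>g t) = (\<integral>V. \<psi> V \<partial>f t)" using int[OF t \<psi>] by simp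
  qed
  moreover have "emeasure (f t) {\<infinity>} = 0" if z: "emeasure f0 {\<infinity>} = 0" and t: "0 \<le> t" for t
  proof -
    \<comment> \<open>These ramps equal 1 at \<infinity> and decrease pointwise to the indicator of
      {\<infinity>}. Their integral against \<open>f t\<close> dominates the mass at \<infinity>,
      and their integral against f0 tends to the initial mass there.\<close>
    define r where "r n V = clip (real (Suc n)) V / real (Suc n)" for n V
    have rX: "r n \<in> X_space (real (Suc n))" for n
      unfolding r_def by (rule clip_in_X_space) (auto intro!: continuous_intros)
    have rlip: "\<bar>r n (ennreal y) - r n (ennreal x)\<bar> \<le> (1 / real (Suc n)) * (y - x)" if "0 \<le> x" "x \<le> y" for n x y
      using that by (auto simp: r_def min_def simp flip: diff_divide_distrib intro!: divide_right_mono simp del: of_nat_Suc)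
    have rb: "0 \<le> r n V" "r n V \<le> 1" for n V
      unfolding r_def by (simp_all add: clip_le divide_le_eq del: of_nat_Suc)
    have rtop: "r n top = 1" for n by (simp add: r_def clip_ge del: of_nat_Suc)
    have rC: "r n \<in> C_compact" for n by (rule X_space_C[OF rX])
    have est: "measure (f t) {\<infinity>} \<le> (\<integral>V. r n V \<partial>f0) + m * C1 * real (Suc n) powr (5 / 3 - \<sigma>) * t" for n
    proof -
      obtain i where i: "r n \<in> D i" using lip_D[OF _ rX _ rlip] by fastforce
      have Lb: "\<bar>L (r n) V\<bar> \<le> C1 * real (Suc n) powr (5 / 3 - \<sigma>)" for V
      proof -
        have "\<bar>L (r n) V\<bar> \<le> (1 / real (Suc n)) * (C1 * real (Suc n) powr (8 / 3 - \<sigma>))"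
          by (rule jump_operator_lipschitz_bound[OF rX _ _ rlip]) auto
        also have "real (Suc n) powr (8 / 3 - \<sigma>) = real (Suc n) powr (1 + (5 / 3 - \<sigma>))" by simp
        also have "\<dots> = real (Suc n) * real (Suc n) powr (5 / 3 - \<sigma>)" by (subst powr_add) simp
        finally show ?thesis by simp
      qed
      have "norm (L_sol t (r n) - L_sol 0 (r n)) \<le> m * (C1 * real (Suc n) powr (5 / 3 - \<sigma>)) * norm (t - 0)"
      proof (rule field_differentiable_bound[where S = "{0..t}" and f' = "\<lambda>s. L_sol s (L (r n))"])
        show "((\<lambda>s. L_sol s (r n)) has_real_derivative L_sol z (L (r n))) (at z within {0..t})" if "z \<in> {0..t}" for z
          using that by (rule L_sol_deriv[OF i])
        show "norm (L_sol z (L (r n))) \<le> m * (C1 * real (Suc n) powr (5 / 3 - \<sigma>))" if "z \<in> {0..t}" for z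
          using bounded_functionalD(2)[OF L_sol_bounded L_C[OF i] Lb] that by simp
      qed (use t in auto)
      then have "(\<integral>V. r n V \<partial>f t) \<le> (\<integral>V. r n V \<partial>f0) + m * C1 * real (Suc n) powr (5 / 3 - \<sigma>) * t"
        using t L_sol_0[OF rC] by (simp add: int[OF t rC] mult.assoc abs_le_iff del: of_nat_Suc)
      moreover have "measure (f t) {\<infinity>} \<le> (\<integral>V. r n V \<partial>f t)"
      proof -
        note R = radon_measuresD[OF f[OF t]]
        interpret finite_measure "f t" by (rule R)
        have s: "{\<infinity>} \<in> sets (f t)" using R by simp
        have "(\<integral>V. indicator {\<infinity>} V \<partial>f t) \<le> (\<integral>V. r n V \<partial>f t)"
          using rb rtop by (intro integral_mono integrable_real_indicator s radon_integrable[OF f[OF t] rC])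
            (auto simp: indicator_def less_top[symmetric] emeasure_finite)
        then show ?thesis using R by simp
      qed
      ultimately show ?thesis by linarith
    qed
    have lim1: "(\<lambda>n. \<integral>V. r n V \<partial>f0) \<longlonglongrightarrow> 0"
    proof -
      note R = radon_measuresD[OF f0]
      interpret finite_measure f0 by (rule R)
      have "(\<lambda>n. \<integral>V. r n V \<partial>f0) \<longlonglongrightarrow> (\<integral>V. indicator {\<infinity>} V \<partial>f0)"
      proof (rule integral_dominated_convergence[where w = "\<lambda>_. 1"])
        show "(\<lambda>V. indicator {\<infinity>} V :: real) \<in> borel_measurable f0" using R by (intro borel_measurable_indicator) simp
        show "r n \<in> borel_measurable f0" for n using radon_integrable[OF f0 rC] by blast
        show "AE V in f0. (\<lambda>n. r n V) \<longlonglongrightarrow> indicator {\<infinity>} V"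
        proof (rule AE_I2)
          fix V
          show "(\<lambda>n. r n V) \<longlonglongrightarrow> indicator {\<infinity>} V"
          proof (cases V)
            case (real x)
            have "(\<lambda>n. x * (1 / real (Suc n))) \<longlonglongrightarrow> x * 0"
              using LIMSEQ_Suc[OF lim_1_over_n[where 'a=real]] by (intro tendsto_mult tendsto_const)
            then have x0: "(\<lambda>n. x / real (Suc n)) \<longlonglongrightarrow> 0" by simp
            have rx: "norm (r n V) \<le> x / real (Suc n)" for n
              using real by (auto simp: r_def intro!: divide_right_mono simp del: of_nat_Suc)
            have "(\<lambda>n. r n V) \<longlonglongrightarrow> 0"
              by (rule Lim_null_comparison[OF always_eventually x0]) (use rx in blast)
            then show ?thesis using real by simp
          next
            case top
            then show ?thesis by (simp add: rtop)
          qed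
        qed
      qed (use rb in auto)
      moreover have "(\<integral>V. indicator {\<infinity>} V \<partial>f0) = (0::real)"
        using z R by (simp add: measure_def)
      ultimately show ?thesis by simp
    qed
    have lim2: "(\<lambda>n. real (Suc n) powr (5 / 3 - \<sigma>)) \<longlonglongrightarrow> 0"
      using \<sigma> by (intro tendsto_neg_powr filterlim_compose[OF filterlim_real_sequentially filterlim_Suc]) auto
    have "(\<lambda>n. (\<integral>V. r n V \<partial>f0) + m * C1 * real (Suc n) powr (5 / 3 - \<sigma>) * t) \<longlonglongrightarrow> 0 + m * C1 * 0 * t"
      by (intro tendsto_add tendsto_mult tendsto_const lim1 lim2)
    then have "measure (f t) {\<infinity>} \<le> 0"
      using est by (intro LIMSEQ_le_const) auto
    then have "measure (f t) {\<infinity>} = 0" using measure_nonneg[of "f t" "{\<infinity>}"] by linarith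
    then show ?thesis
      using finite_measure.emeasure_eq_measure[OF radon_measuresD(3)[OF f[OF t]]] by simp
  qed
  ultimately show ?thesis by blast
qed

end

section \<open>Integrable kernels\<close>

lemma X_space_mono:
  assumes "u \<in> X_space M" "M \<le> N"
  shows "u \<in> X_space N"
proof -
  have "u V = u (ennreal M)" if "ennreal N \<le> V" for V
    using X_space_const[OF assms(1) order_trans[OF ennreal_leI[OF assms(2)] that] order_refl] .
  then show ?thesis
    using X_space_C[OF assms(1)] unfolding X_space_def constant_on_def by blast
qed

definition halfline_lip :: "real \<Rightarrow> (ennreal \<Rightarrow> real) \<Rightarrow> bool" where
  "halfline_lip B \<phi> \<longleftrightarrow> (\<forall>x y. 0 \<le> x \<longrightarrow> x \<le> y \<longrightarrow> \<bar>\<phi> (ennreal y) - \<phi> (ennreal x)\<bar> \<le> B * (y - x))"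

lemma halfline_lipD: "halfline_lip B \<phi> \<Longrightarrow> 0 \<le> x \<Longrightarrow> x \<le> y \<Longrightarrow> \<bar>\<phi> (ennreal y) - \<phi> (ennreal x)\<bar> \<le> B * (y - x)"
  unfolding halfline_lip_def by blast

lemma halfline_lip_clip: "0 \<le> M \<Longrightarrow> halfline_lip 1 (clip M)"
  unfolding halfline_lip_def by auto

lemma halfline_lip_add:
  assumes "halfline_lip B f" "halfline_lip B' g"
  shows "halfline_lip (B + B') (\<lambda>V. f V + g V)"
  unfolding halfline_lip_def
proof (intro allI impI)
  fix x y :: real assume xy: "0 \<le> x" "x \<le> y"
  show "\<bar>f (ennreal y) + g (ennreal y) - (f (ennreal x) + g (ennreal x))\<bar> \<le> (B + B') * (y - x)"
    using halfline_lipD[OF assms(1) xy] halfline_lipD[OF assms(2) xy] by (simp add: distrib_right)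
qed

lemma halfline_lip_mult:
  assumes "halfline_lip B f" "halfline_lip B' g" "\<And>V. \<bar>f V\<bar> \<le> K" "\<And>V. \<bar>g V\<bar> \<le> K'"
  shows "halfline_lip (K * B' + K' * B) (\<lambda>V. f V * g V)"
  unfolding halfline_lip_def
proof (intro allI impI)
  fix x y :: real assume xy: "0 \<le> x" "x \<le> y"
  have "f (ennreal y) * g (ennreal y) - f (ennreal x) * g (ennreal x)
    = f (ennreal y) * (g (ennreal y) - g (ennreal x)) + g (ennreal x) * (f (ennreal y) - f (ennreal x))"
    by (simp add: algebra_simps)
  also have "\<bar>\<dots>\<bar> \<le> \<bar>f (ennreal y)\<bar> * \<bar>g (ennreal y) - g (ennreal x)\<bar> + \<bar>g (ennreal x)\<bar> * \<bar>f (ennreal y) - f (ennreal x)\<bar>"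
    by (rule order_trans[OF abs_triangle_ineq]) (simp add: abs_mult)
  also have "\<dots> \<le> K * (B' * (y - x)) + K' * (B * (y - x))"
    using assms bounded_by_nonneg[OF assms(3)] bounded_by_nonneg[OF assms(4)]
    by (intro add_mono mult_mono halfline_lipD xy) auto
  finally show "\<bar>f (ennreal y) * g (ennreal y) - f (ennreal x) * g (ennreal x)\<bar> \<le> (K * B' + K' * B) * (y - x)"
    by (simp add: algebra_simps)
qed

lemma halfline_lip_mono: "halfline_lip B f \<Longrightarrow> B \<le> B' \<Longrightarrow> halfline_lip B' f"
  unfolding halfline_lip_def by (meson diff_ge_0_iff_ge mult_right_mono order_trans)

definition lip_X :: "(ennreal \<Rightarrow> real) set" where
  "lip_X = {\<psi>. \<exists>M B. 0 < M \<and> 0 \<le> B \<and> \<psi> \<in> X_space M \<and> halfline_lip B \<psi>}"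

lemma lip_XI: "0 < M \<Longrightarrow> \<psi> \<in> X_space M \<Longrightarrow> halfline_lip B \<psi> \<Longrightarrow> \<psi> \<in> lip_X"
  unfolding lip_X_def using halfline_lip_mono[of B \<psi> "max 0 B"] by (intro CollectI exI[of _ M] exI[of _ "max 0 B"]) auto

lemma X_space_op:
  assumes "f \<in> X_space M" "g \<in> X_space N"
  shows "(\<lambda>V. f V + g V) \<in> X_space (max M N)" "(\<lambda>V. f V * g V) \<in> X_space (max M N)"
proof -
  let ?m = "max M N"
  have fg: "f \<in> X_space ?m" "g \<in> X_space ?m" using assms by (auto intro: X_space_mono)
  have eq: "f V = f (ennreal ?m)" "g V = g (ennreal ?m)" if "ennreal ?m \<le> V" for V
    using X_space_const[OF fg(1) that order_refl] X_space_const[OF fg(2) that order_refl] by auto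
  have "f V + g V = f (ennreal ?m) + g (ennreal ?m)" "f V * g V = f (ennreal ?m) * g (ennreal ?m)"
    if "ennreal ?m \<le> V" for V
    using eq[OF that] by simp_all
  moreover have "(\<lambda>V. f V + g V) \<in> C_compact" "(\<lambda>V. f V * g V) \<in> C_compact"
    using fg[THEN X_space_C] unfolding C_compact_def by (auto intro: continuous_on_add continuous_on_mult)
  ultimately show "(\<lambda>V. f V + g V) \<in> X_space ?m" "(\<lambda>V. f V * g V) \<in> X_space ?m"
    unfolding X_space_def constant_on_def by blast+
qed

text \<open>Stone-Weierstrass on the compact space [0, \<infinity>]. Sums and products of Lipschitz
  functions that are constant from some point on are of the same kind, and
  \<open>clip (x + 1)\<close> separates the finite point x from everything above it, \<infinity>
  included. Both kernels use this dense class.\<close>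

lemma lip_X_dense:
  assumes "\<phi> \<in> C_compact" "0 < e"
  shows "\<exists>\<psi>\<in>lip_X. \<forall>V. \<bar>\<phi> V - \<psi> V\<bar> \<le> e"
proof -
  interpret function_ring_on lip_X "UNIV :: ennreal set"
  proof
    show "compact (UNIV :: ennreal set)" by (rule compact_UNIV)
    show "continuous_on UNIV f" if "f \<in> lip_X" for f
      using that X_space_C unfolding lip_X_def C_compact_def by blast
    show "(\<lambda>_. c) \<in> lip_X" for c
      by (rule lip_XI[of 1 _ 0]) (auto simp: X_space_def constant_on_def halfline_lip_def)
  next
    fix f g assume "f \<in> lip_X" "g \<in> lip_X"
    then obtain M B N B' where f: "0 < M" "f \<in> X_space M" "halfline_lip B f"
      and g: "0 < N" "g \<in> X_space N" "halfline_lip B' g" unfolding lip_X_def by blast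
    obtain K where K: "\<And>V. \<bar>f V\<bar> \<le> K" using C_compact_bounded[OF X_space_C[OF f(2)]] by blast
    obtain K' where K': "\<And>V. \<bar>g V\<bar> \<le> K'" using C_compact_bounded[OF X_space_C[OF g(2)]] by blast
    have m: "0 < max M N" using f by auto
    show "(\<lambda>V. f V + g V) \<in> lip_X"
      by (rule lip_XI[OF m X_space_op(1)[OF f(2) g(2)] halfline_lip_add[OF f(3) g(3)]])
    show "(\<lambda>V. f V * g V) \<in> lip_X"
      by (rule lip_XI[OF m X_space_op(2)[OF f(2) g(2)] halfline_lip_mult[OF f(3) g(3) K K']])
  next
    have sep: "\<exists>f\<in>lip_X. f V \<noteq> f W" if VW: "V < W" for V W
    proof -
      obtain x where x: "V = ennreal x" "0 \<le> x" using VW by (cases V) auto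
      have cX: "clip (x + 1) \<in> X_space (x + 1)"
        using clip_in_X_space[of "x + 1" "\<lambda>x. x"] x by simp
      have "clip (x + 1) V = x" using x by simp
      moreover have "x < clip (x + 1) W"
      proof (cases W)
        case (real y)
        then have "x < y" using VW x by (simp add: ennreal_less_iff)
        then show ?thesis using real x by simp
      next
        case top
        then show ?thesis using x by (simp add: clip_ge)
      qed
      ultimately show ?thesis
        using lip_XI[OF _ cX halfline_lip_clip] x by (intro bexI[of _ "clip (x + 1)"]) auto
    qed
    fix V W :: ennreal assume "V \<noteq> W"
    then consider "V < W" | "W < V" by (meson linorder_neqE)
    then show "\<exists>f\<in>lip_X. f V \<noteq> f W"
    proof cases
      case 2
      then obtain f where "f \<in> lip_X" "f W \<noteq> f V" using sep by blast
      then show ?thesis by (intro bexI[of _ f]) auto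
    qed (rule sep)
  qed
  obtain F where F: "F \<in> (UNIV :: nat set) \<rightarrow> lip_X" "LIM n sequentially. F n :> uniformly_on UNIV \<phi>"
    using Stone_Weierstrass[of \<phi>] assms(1) unfolding C_compact_def by blast
  have "\<forall>\<^sub>F n in sequentially. \<forall>V\<in>UNIV. dist (F n V) (\<phi> V) < e"
    using assms(2) by (intro uniform_limitD[OF F(2)])
  then obtain n where "\<forall>V\<in>UNIV. dist (F n V) (\<phi> V) < e"
    by (auto simp: eventually_sequentially)
  then show ?thesis using F(1)
    by (intro bexI[of _ "F n"]) (auto simp: dist_real_def abs_minus_commute intro: less_imp_le)
qed

locale integrable_kernel = jump_kernel +
  assumes G_integrable: "set_integrable lebesgue {0<..} G"
begin

text \<open>For v up to max N 1 the squared factor is bounded and integrability of \<open>G\<close>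
  suffices; for larger v the power bound leaves v powr (2/3 - \<sigma>), integrable because \<sigma>
  > 5/3.\<close>

lemma rate_integrable: "set_integrable lebesgue {0<..} (\<lambda>v. G v * (root 3 N + root 3 v)\<^sup>2)" if N: "0 \<le> N"
proof (rule set_integrable_bound)
  let ?N = "max N 1"
  show "set_integrable lebesgue {0<..} (\<lambda>v. 4 * ?N powr (2 / 3) * G v + lipw ?N v)"
    by (intro set_integral_add(1) set_integrable_mult_right G_integrable lipw(1)) auto
  show "set_borel_measurable lebesgue {0<..} (\<lambda>v. G v * (root 3 N + root 3 v)\<^sup>2)"
    by (intro set_borel_measurable_mult G_meas continuous_borel_lebesgue continuous_intros)
  have "G v * (root 3 N + root 3 v)\<^sup>2 \<le> 4 * ?N powr (2 / 3) * G v + lipw ?N v" if v: "0 < v" for v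
  proof (cases "v \<le> ?N")
    case True
    have "G v * (root 3 N + root 3 v)\<^sup>2 \<le> G v * (4 * ?N powr (2 / 3))"
      using True N v G_nonneg[OF v] by (intro mult_left_mono root3_sum_square_le) auto
    moreover have "0 \<le> lipw ?N v" using C_nonneg by (simp add: lipw_def)
    ultimately show ?thesis by (simp add: mult_ac)
  next
    case False
    have "G v * (root 3 N + root 3 v)\<^sup>2 \<le> (C * v powr (- \<sigma>)) * (4 * v powr (2 / 3))"
      using False N v G_nonneg[OF v] G_le[OF v] C_nonneg by (intro mult_mono root3_sum_square_le) auto
    also have "\<dots> = 4 * C * 1 * v powr (2 / 3 - \<sigma>)" by (simp add: mult_ac flip: powr_add)
    also have "\<dots> \<le> 4 * C * ?N * v powr (2 / 3 - \<sigma>)"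
      using C_nonneg by (intro mult_right_mono mult_left_mono) auto
    also have "\<dots> = lipw ?N v" using False by (simp add: lipw_def)
    finally have "G v * (root 3 N + root 3 v)\<^sup>2 \<le> lipw ?N v" .
    moreover have "0 \<le> 4 * ?N powr (2 / 3) * G v" using G_nonneg[OF v] by simp
    ultimately show ?thesis by linarith
  qed
  then show "AE v in lebesgue. v \<in> {0<..} \<longrightarrow> norm (G v * (root 3 N + root 3 v)\<^sup>2) \<le> norm (4 * ?N powr (2 / 3) * G v + lipw ?N v)"
    using G_nonneg by (intro AE_I2) (auto simp: abs_mult intro: order_trans[OF _ abs_ge_self])
qed

text \<open>The added 1 keeps the clock rate positive even if the total jump rate is 0.\<close>

definition lam :: "nat \<Rightarrow> real" where
  "lam n = (LINT v:{0<..}|lebesgue. G v * (root 3 (real (Suc n)) + root 3 v)\<^sup>2) + 1"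

lemma bounded_jumps: "bounded_jumps G (clip (real (Suc n))) (real (Suc n)) (lam n)"
proof
  have "0 \<le> (LINT v:{0<..}|lebesgue. G v * (root 3 (real (Suc n)) + root 3 v)\<^sup>2)"
    unfolding set_lebesgue_integral_def using G_nonneg
    by (intro integral_nonneg_AE AE_I2) (auto simp: indicator_def)
  then show "0 < lam n" by (simp add: lam_def)
qed (auto simp: lam_def G_meas G_nonneg continuous_clip clip_le rate_integrable simp del: of_nat_Suc)

sublocale J: bounded_jumps G "clip (real (Suc n))" "real (Suc n)" "lam n" for n
  by (rule bounded_jumps)

text \<open>With a finite total rate, the sup bound K already provides an integrable majorant, so
  the class carries no modulus. As soon as M \<le> n + 1 the truncated generator coincides with the
  jump operator on the class, and the error sequence is identically 0.\<close>

definition D :: "real \<times> real \<Rightarrow> (ennreal \<Rightarrow> real) set" where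
  "D = (\<lambda>(M, K). {u. 0 < M \<and> u \<in> X_space M \<and> (\<forall>V. \<bar>u V\<bar> \<le> K)})"

lemma D_iff: "u \<in> D i \<longleftrightarrow> 0 < fst i \<and> u \<in> X_space (fst i) \<and> (\<forall>V. \<bar>u V\<bar> \<le> snd i)"
  by (simp add: D_def split_beta)

lemma lip_X_D:
  assumes "\<psi> \<in> lip_X"
  shows "\<exists>i. \<psi> \<in> D i"
proof -
  obtain M where M: "0 < M" "\<psi> \<in> X_space M" using assms unfolding lip_X_def by blast
  obtain K where "\<And>V. \<bar>\<psi> V\<bar> \<le> K" using C_compact_bounded[OF X_space_C[OF M(2)]] by blast
  then have "\<psi> \<in> D (M, K)" using M by (simp add: D_iff)
  then show ?thesis ..
qed

lemma evolution_integrable: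
  assumes f0: "f0 \<in> radon_measures"
  shows "\<exists>f. weak_solution G f0 f \<and> (\<forall>g. weak_solution G f0 g \<longrightarrow> (\<forall>t\<ge>0. g t = f t)) \<and>
    (emeasure f0 {\<infinity>} = 0 \<longrightarrow> (\<forall>t\<ge>0. emeasure (f t) {\<infinity>} = 0))"
proof -
  have seq: "\<exists>\<psi> K'. (\<forall>n. \<psi> n \<in> C_infty_compact \<inter> X_space M) \<and>
      (\<forall>n V. \<bar>\<psi> n V\<bar> \<le> K') \<and> (\<forall>V. (\<lambda>n. \<psi> n V) \<longlonglongrightarrow> u V) \<and>
      (\<forall>n V. \<bar>jump_operator G (\<psi> n) V\<bar> \<le> K') \<and>
      (\<forall>V. (\<lambda>n. jump_operator G (\<psi> n) V) \<longlonglongrightarrow> jump_operator G u V) \<and>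
      (\<forall>n. jump_operator G (\<psi> n) \<in> C_compact) \<and> jump_operator G u \<in> C_compact"
    if u: "u \<in> X_space M" "0 < M" "\<And>V. \<bar>u V\<bar> \<le> K" for u M K
  proof -
    have K: "0 \<le> K" by (rule bounded_by_nonneg[OF u(3)])
    show ?thesis
    proof (rule smooth_sequence[OF u(1,2), where m = "\<lambda>_ _. 2 * K" and w = "\<lambda>v. (G v * (root 3 M + root 3 v)\<^sup>2) * (2 * K)"])
      show "\<bar>u (ennreal (x + v)) - u (ennreal x)\<bar> \<le> 2 * K" for x v
        using u(3)[of "ennreal (x + v)"] u(3)[of "ennreal x"] by linarith
      show "set_integrable lebesgue {0<..} (\<lambda>v. (G v * (root 3 M + root 3 v)\<^sup>2) * (2 * K))"
        using u(2) by (intro set_integrable_mult_left rate_integrable) auto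
      show "0 \<le> (G v * (root 3 M + root 3 v)\<^sup>2) * (2 * K)" if "0 < v" for v
        using G_nonneg[OF that] K by simp
      show "G v * (root 3 x + root 3 v)\<^sup>2 * (2 * K) \<le> (G v * (root 3 M + root 3 v)\<^sup>2) * (2 * K)"
        if "0 \<le> x" "x \<le> M" "0 < v" for x v
        using that G_nonneg[OF that(3)] K
        by (intro mult_right_mono mult_left_mono power_mono add_mono) (auto intro: add_nonneg_nonneg)
    next
      fix \<psi> K'
      assume "\<And>n. \<psi> n \<in> C_infty_compact \<inter> X_space M" "\<And>n V. \<bar>\<psi> n V\<bar> \<le> K'"
        "\<And>V. (\<lambda>n. \<psi> n V) \<longlonglongrightarrow> u V" "\<And>n V. \<bar>jump_operator G (\<psi> n) V\<bar> \<le> K'"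
        "\<And>V. (\<lambda>n. jump_operator G (\<psi> n) V) \<longlonglongrightarrow> jump_operator G u V"
        "jump_operator G u \<in> C_compact" "\<And>n. jump_operator G (\<psi> n) \<in> C_compact"
      then show ?thesis by (intro exI[of _ \<psi>] exI[of _ K'] conjI allI)
    qed simp
  qed
  interpret jump_evolution \<sigma> C G J.P lam D "\<lambda>i. nat \<lceil>fst i\<rceil>" "\<lambda>_ _. 0"
  proof
    show "\<phi> \<in> C_compact" if "\<phi> \<in> D i" for \<phi> i using that X_space_C by (auto simp: D_iff)
    show "J.S n t \<phi> \<in> D i" if "\<phi> \<in> D i" "nat \<lceil>fst i\<rceil> \<le> n" "0 \<le> t" for \<phi> i n t
    proof -
      have \<phi>: "0 < fst i" "\<phi> \<in> X_space (fst i)" "\<And>V. \<bar>\<phi> V\<bar> \<le> snd i" using that(1) by (auto simp: D_iff)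
      show ?thesis unfolding D_iff
        using \<phi>(1) J.S_X_space[OF \<phi>(2) that(3) J.P_X_space] J.S_bound[OF X_space_C[OF \<phi>(2)] \<phi>(3) that(3)] by blast
    qed
    show "jump_operator G \<phi> \<in> C_compact" if "\<phi> \<in> D i" for \<phi> i
      using that seq[of \<phi> "fst i" "snd i"] by (auto simp: D_iff)
    show "\<bar>jump_operator G \<phi> V - J.A n \<phi> V\<bar> \<le> 0" if "\<phi> \<in> D i" "nat \<lceil>fst i\<rceil> \<le> n" for \<phi> i n V
    proof -
      have "fst i \<le> real (Suc n)" using that(2) by linarith
      then have "\<phi> \<in> X_space (real (Suc n))" using that(1) by (auto simp: D_iff intro: X_space_mono)
      then show ?thesis by (simp add: J.A_eq jump_operator_eq_jump_gen del: of_nat_Suc)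
    qed
    show "(\<lambda>_. 0) \<longlonglongrightarrow> (0::real)" by simp
    show "\<exists>i. \<exists>\<psi>\<in>D i. \<forall>V. \<bar>\<phi> V - \<psi> V\<bar> \<le> e" if "\<phi> \<in> C_compact" "0 < e" for \<phi> e
      using lip_X_dense[OF that] lip_X_D by blast
    show "\<exists>M>0. \<exists>\<psi> K. (\<forall>n. \<psi> n \<in> C_infty_compact \<inter> X_space M) \<and>
      (\<forall>n V. \<bar>\<psi> n V\<bar> \<le> K) \<and> (\<forall>V. (\<lambda>n. \<psi> n V) \<longlonglongrightarrow> \<phi> V) \<and>
      (\<forall>n V. \<bar>jump_operator G (\<psi> n) V\<bar> \<le> K) \<and>
      (\<forall>V. (\<lambda>n. jump_operator G (\<psi> n) V) \<longlonglongrightarrow> jump_operator G \<phi> V) \<and>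
      (\<forall>n. jump_operator G (\<psi> n) \<in> C_compact)" if "\<phi> \<in> D i" for \<phi> i
      using that seq[of \<phi> "fst i" "snd i"] unfolding D_iff by blast
    show "\<exists>i. \<phi> \<in> D i" if "0 < M" "\<phi> \<in> X_space M" "0 \<le> B"
      "\<And>x y. 0 \<le> x \<Longrightarrow> x \<le> y \<Longrightarrow> \<bar>\<phi> (ennreal y) - \<phi> (ennreal x)\<bar> \<le> B * (y - x)" for M \<phi> B
      using that by (intro lip_X_D lip_XI[of M _ B]) (auto simp: halfline_lip_def)
  qed
  show ?thesis by (rule evolution[OF f0])
qed

end

section \<open>The power kernel\<close>

text \<open>Jumps smaller than the fraction \<nu> of the volume scale \<open>\<epsilon> n\<close>
  will be discarded in the approximation. The two numerical conditions are those that give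
  \<open>scaled_generator_nondecreasing\<close> its sign.\<close>

locale power_kernel = scaling_exponents +
  fixes \<nu> :: real
  assumes \<nu>: "0 < \<nu>" "\<nu> \<le> 1" "4 * \<nu> powr (2 - \<sigma>) \<le> 1 / 2" and \<eta>K: "\<eta> * K0 \<le> 1 / 2"
begin

abbreviation "r \<equiv> root 3"

lemma G_infty_meas: "set_borel_measurable lebesgue {0<..} (G_infty \<sigma>)"
proof -
  have "(\<lambda>v. indicator {0<..} v *\<^sub>R G_infty \<sigma> v) \<in> borel_measurable lborel"
    unfolding G_infty_def by measurable
  then show ?thesis unfolding set_borel_measurable_def by (rule measurable_completion)
qed

sublocale K: jump_kernel \<sigma> 1 "G_infty \<sigma>"
  using \<sigma> G_infty_meas by unfold_locales (auto simp: G_infty_def)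

text \<open>With m = max x v the product is of order v powr (1 - \<sigma>) * m powr (\<alpha> -
  1/3). As \<alpha> \<le> 1/3, the worst case is m = v, and the exponents add up to \<eta> - 1,
  which is integrable at 0 thanks to \<eta> > 0.\<close>

lemma increment_small:
  assumes "0 \<le> x" "0 < v"
  shows "v powr (- \<sigma>) * (r x + r v)\<^sup>2 * ((x + v) powr \<alpha> - x powr \<alpha>) \<le> 4 * v powr (\<eta> - 1)"
proof -
  define m where "m = max x v"
  have m: "0 < m" "x \<le> m" "v \<le> m" using assms by (auto simp: m_def)
  have "v powr (- \<sigma>) * (r x + r v)\<^sup>2 * ((x + v) powr \<alpha> - x powr \<alpha>)
      \<le> v powr (- \<sigma>) * (4 * m powr (2 / 3)) * (v * m powr (\<alpha> - 1))"
    using assms m \<alpha> powr_increment_le[of x v \<alpha>]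
    by (intro mult_mono mult_left_mono root3_sum_square_le) (auto simp: m_def powr_mono2)
  also have "\<dots> = 4 * (v powr (- \<sigma>) * v) * (m powr (2 / 3) * m powr (\<alpha> - 1))" by simp
  also have "m powr (2 / 3) * m powr (\<alpha> - 1) = m powr (\<alpha> - 1 / 3)" by (simp flip: powr_add)
  also have "v powr (- \<sigma>) * v = v powr (1 - \<sigma>)"
    using assms by (simp add: powr_diff powr_minus divide_inverse)
  also have "4 * v powr (1 - \<sigma>) * m powr (\<alpha> - 1 / 3) \<le> 4 * v powr (1 - \<sigma>) * v powr (\<alpha> - 1 / 3)"
    using assms m \<alpha> by (intro mult_left_mono powr_mono2') auto
  also have "\<dots> = 4 * v powr (1 - \<sigma> + (\<alpha> - 1 / 3))" by (simp only: powr_add mult.assoc)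
  also have "1 - \<sigma> + (\<alpha> - 1 / 3) = \<eta> - 1" by (simp add: \<alpha>_eq)
  finally show ?thesis .
qed

definition Hf :: "real \<Rightarrow> real \<Rightarrow> real" where "Hf M x = min x (2 * M) powr \<alpha>"

text \<open>The modulus on [0, \<infinity>]; \<open>Hf\<close> is its form on the reals. Functions
  of the class are constant beyond \<open>M\<close>, while the cap is at 2 * M: the ratio 2 * M / V
  then stays at least 2 for V \<le> M, away from the singularity of \<open>Q\<close> at 0.\<close>

definition H :: "real \<Rightarrow> ennreal \<Rightarrow> real" where "H M V = clip (2 * M) V powr \<alpha>"

lemma H_ennreal: "0 \<le> M \<Longrightarrow> 0 \<le> x \<Longrightarrow> H M (ennreal x) = Hf M x"
  by (simp add: H_def Hf_def)

lemma H_X: "0 \<le> M \<Longrightarrow> H M \<in> X_space (2 * M)"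
  unfolding H_def using \<alpha> by (intro clip_in_X_space continuous_on_powr') (auto intro!: continuous_intros)

lemma H_C: "0 \<le> M \<Longrightarrow> H M \<in> C_compact"
  by (rule X_space_C[OF H_X])

lemma H_mono: "0 \<le> M \<Longrightarrow> V \<le> W \<Longrightarrow> H M V \<le> H M W"
  unfolding H_def using \<alpha> by (intro powr_mono2 clip_mono) auto

lemma Hf_mono: "0 \<le> M \<Longrightarrow> 0 \<le> x \<Longrightarrow> x \<le> y \<Longrightarrow> Hf M x \<le> Hf M y"
  unfolding Hf_def using \<alpha> by (intro powr_mono2) auto

lemma Hf_increment_antimono:
  "0 \<le> x \<Longrightarrow> x \<le> y \<Longrightarrow> 0 \<le> v \<Longrightarrow> Hf M (y + v) - Hf M y \<le> Hf M (x + v) - Hf M x"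
  unfolding Hf_def using \<alpha> by (intro powr_min_increment_antimono) auto

lemma Hf_increment_le:
  assumes "0 \<le> x" "x \<le> M" "0 \<le> v"
  shows "Hf M (x + v) - Hf M x \<le> (x + v) powr \<alpha> - x powr \<alpha>" "Hf M (x + v) - Hf M x \<le> (2 * M) powr \<alpha>"
proof -
  have "Hf M (x + v) \<le> (x + v) powr \<alpha>" "Hf M (x + v) \<le> (2 * M) powr \<alpha>"
    using assms \<alpha> unfolding Hf_def by (auto intro!: powr_mono2)
  moreover have "Hf M x = x powr \<alpha>" using assms by (simp add: Hf_def min_def)
  moreover have "0 \<le> x powr \<alpha>" by simp
  ultimately show "Hf M (x + v) - Hf M x \<le> (x + v) powr \<alpha> - x powr \<alpha>" "Hf M (x + v) - Hf M x \<le> (2 * M) powr \<alpha>"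
    by linarith+
qed

definition hw :: "real \<Rightarrow> real \<Rightarrow> real" where
  "hw M v = (if v \<le> M then 4 * v powr (\<eta> - 1) else 4 * (2 * M) powr \<alpha> * v powr (2 / 3 - \<sigma>))"

lemma hw_nonneg: "0 \<le> hw M v" by (simp add: hw_def)

lemma hw_integrable:
  assumes M: "0 < M"
  shows "set_integrable lebesgue {0<..} (hw M)"
proof -
  have 1: "((\<lambda>v. 4 * v powr (\<eta> - 1)) has_integral 4 * (M powr (\<eta> - 1 + 1) / (\<eta> - 1 + 1))) {0..M}"
    using \<eta> M by (intro has_integral_mult_right has_integral_powr_from_0) auto
  have 2: "((\<lambda>v. 4 * (2 * M) powr \<alpha> * v powr (2 / 3 - \<sigma>)) has_integral
      4 * (2 * M) powr \<alpha> * (- (M powr (2 / 3 - \<sigma> + 1)) / (2 / 3 - \<sigma> + 1))) {M..}"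
    using \<sigma> M by (intro has_integral_mult_right has_integral_powr_to_inf) auto
  show ?thesis using two_piece_integral(1)[OF M 1 2] by (simp add: hw_def[abs_def])
qed

lemma hw_bound:
  assumes "0 \<le> x" "x \<le> M" "0 < v"
  shows "v powr (- \<sigma>) * (r x + r v)\<^sup>2 * (Hf M (x + v) - Hf M x) \<le> hw M v"
proof (cases "v \<le> M")
  case True
  have "v powr (- \<sigma>) * (r x + r v)\<^sup>2 * (Hf M (x + v) - Hf M x)
    \<le> v powr (- \<sigma>) * (r x + r v)\<^sup>2 * ((x + v) powr \<alpha> - x powr \<alpha>)"
    using assms by (intro mult_left_mono Hf_increment_le) auto
  also have "\<dots> \<le> 4 * v powr (\<eta> - 1)" using assms by (intro increment_small) auto
  finally show ?thesis using True by (simp add: hw_def)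
next
  case False
  have "v powr (- \<sigma>) * (r x + r v)\<^sup>2 * (Hf M (x + v) - Hf M x)
    \<le> v powr (- \<sigma>) * (4 * v powr (2 / 3)) * (2 * M) powr \<alpha>"
    using assms False Hf_mono[of M x "x + v"]
    by (intro mult_mono mult_left_mono Hf_increment_le root3_sum_square_le) auto
  also have "\<dots> = 4 * (2 * M) powr \<alpha> * (v powr (- \<sigma>) * v powr (2 / 3))" by simp
  also have "v powr (- \<sigma>) * v powr (2 / 3) = v powr (2 / 3 - \<sigma>)" by (simp flip: powr_add)
  finally show ?thesis using False by (simp add: hw_def)
qed

section \<open>Truncated kernels and frozen rates\<close>

definition \<epsilon> :: "nat \<Rightarrow> real" where "\<epsilon> n = 1 / real (Suc n)"

text \<open>Removing small jumps makes the total rate finite. A cutoff proportional to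
  \<open>\<epsilon> n\<close> gives \<nu> * \<epsilon> n / x \<le> \<nu> for every x \<ge>
  \<epsilon> n, as the scaled inequality demands.\<close>

definition Gn :: "nat \<Rightarrow> real \<Rightarrow> real" where
  "Gn n v = (if v \<le> \<nu> * \<epsilon> n then 0 else v powr (- \<sigma>))"

text \<open>Freezing the volume from below at \<open>\<epsilon> n\<close> makes the rate constant on
  [0, \<epsilon> n], where monotonicity of the generator applied to \<open>H\<close> then follows
  from concavity; \<open>clip\<close> bounds the rate from above.\<close>

definition cn :: "nat \<Rightarrow> ennreal \<Rightarrow> real" where
  "cn n V = max (clip (real (Suc n)) V) (\<epsilon> n)"

lemma \<epsilon>: "0 < \<epsilon> n" "\<epsilon> n \<le> 1" by (auto simp: \<epsilon>_def)

lemma \<tau>: "0 < \<nu> * \<epsilon> n" "\<nu> * \<epsilon> n \<le> \<epsilon> n"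
  using \<nu> \<epsilon>[of n] by (auto simp: mult_left_le_one_le)

lemma Gn_meas: "set_borel_measurable lebesgue {0<..} (Gn n)"
proof -
  have "(\<lambda>v. indicator {0<..} v *\<^sub>R Gn n v) \<in> borel_measurable lborel"
    unfolding Gn_def by measurable
  then show ?thesis unfolding set_borel_measurable_def by (rule measurable_completion)
qed

lemma Gn_nonneg: "0 \<le> Gn n v" by (simp add: Gn_def)

lemma rate_integrable:
  assumes N: "0 \<le> N"
  shows "set_integrable lebesgue {0<..} (\<lambda>v. Gn n v * (r N + r v)\<^sup>2)"
proof (rule set_integrable_bound)
  let ?g = "\<lambda>v. 4 * N powr (2 / 3) * v powr (- \<sigma>) + 4 * v powr (2 / 3 - \<sigma>)"
  let ?w = "\<lambda>v. if v \<le> \<nu> * \<epsilon> n then 0 else ?g v"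
  have g: "(?g has_integral 4 * N powr (2 / 3) * (- ((\<nu> * \<epsilon> n) powr (- \<sigma> + 1)) / (- \<sigma> + 1))
      + 4 * (- ((\<nu> * \<epsilon> n) powr (2 / 3 - \<sigma> + 1)) / (2 / 3 - \<sigma> + 1))) {\<nu> * \<epsilon> n..}"
    using \<sigma> \<tau>(1) by (intro has_integral_add has_integral_mult_right has_integral_powr_to_inf) auto
  show "set_integrable lebesgue {0<..} ?w"
    by (rule two_piece_integral(1)[OF \<tau>(1) has_integral_0 g]) auto
  show "set_borel_measurable lebesgue {0<..} (\<lambda>v. Gn n v * (r N + r v)\<^sup>2)"
    by (intro set_borel_measurable_mult Gn_meas continuous_borel_lebesgue continuous_intros)
  have "Gn n v * (r N + r v)\<^sup>2 \<le> ?w v" if v: "0 < v" for v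
  proof (cases "v \<le> \<nu> * \<epsilon> n")
    case False
    have "(r N + r v)\<^sup>2 \<le> 4 * max N v powr (2 / 3)"
      using N v by (intro root3_sum_square_le) auto
    also have "\<dots> \<le> 4 * N powr (2 / 3) + 4 * v powr (2 / 3)" by (simp add: max_def)
    finally have "v powr (- \<sigma>) * (r N + r v)\<^sup>2 \<le> v powr (- \<sigma>) * (4 * N powr (2 / 3) + 4 * v powr (2 / 3))"
      by (intro mult_left_mono) auto
    also have "\<dots> = 4 * N powr (2 / 3) * v powr (- \<sigma>) + 4 * (v powr (- \<sigma>) * v powr (2 / 3))"
      by (simp add: algebra_simps)
    also have "v powr (- \<sigma>) * v powr (2 / 3) = v powr (2 / 3 - \<sigma>)" by (simp flip: powr_add)
    finally show ?thesis using False by (simp add: Gn_def)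
  qed (simp add: Gn_def)
  then show "AE v in lebesgue. v \<in> {0<..} \<longrightarrow> norm (Gn n v * (r N + r v)\<^sup>2) \<le> norm (?w v)"
    using Gn_nonneg by (intro AE_I2) (auto simp del: if_image_distrib intro!: order_trans[OF _ abs_ge_self])
qed

definition lam :: "nat \<Rightarrow> real" where
  "lam n = (LINT v:{0<..}|lebesgue. Gn n v * (r (real (Suc n)) + r v)\<^sup>2) + 1"

lemma bounded_jumps: "bounded_jumps (Gn n) (cn n) (real (Suc n)) (lam n)"
proof
  have "0 \<le> (LINT v:{0<..}|lebesgue. Gn n v * (r (real (Suc n)) + r v)\<^sup>2)"
    unfolding set_lebesgue_integral_def using Gn_nonneg
    by (intro integral_nonneg_AE AE_I2) (auto simp: indicator_def)
  then show "0 < lam n" by (simp add: lam_def)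
  show "continuous_on UNIV (cn n)"
    unfolding cn_def by (intro continuous_on_max continuous_clip continuous_on_const)
  show "0 \<le> cn n V" for V by (simp add: cn_def le_max_iff_disj)
  show "cn n V \<le> real (Suc n)" for V
    using \<epsilon>(2)[of n] clip_le[of "real (Suc n)" V] by (simp add: cn_def)
  show "set_integrable lebesgue {0<..} (\<lambda>v. Gn n v * (r (real (Suc n)) + r v)\<^sup>2)"
    by (rule rate_integrable) simp
qed (simp_all add: lam_def Gn_meas Gn_nonneg)

sublocale J: bounded_jumps "Gn n" "cn n" "real (Suc n)" "lam n" for n
  by (rule bounded_jumps)

lemma cn_mono: "mono (cn n)"
  unfolding cn_def by (intro monoI max.mono clip_mono) auto

lemma jump_H_formula:
  assumes \<Psi>: "\<And>y. c < y \<Longrightarrow> (\<Psi> has_real_derivative k y) (at y)" and c: "0 < c" "c < \<nu> * \<epsilon> n / x"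
    and x: "\<epsilon> n \<le> x" "x \<le> M" and M: "M \<le> real (Suc n)"
  shows "jump_gen (Gn n) (cn n) (H M) (ennreal x) =
    x powr \<eta> * (\<Psi> (2 * M / x - 1) - \<Psi> (\<nu> * \<epsilon> n / x) + ((2 * M / x) powr \<alpha> - 1) * Q (2 * M / x - 1))"
proof -
  have x0: "0 < x" using \<epsilon>(1)[of n] x by linarith
  let ?f = "\<lambda>v. v powr (- \<sigma>) * (x powr (1 / 3) + v powr (1 / 3))\<^sup>2 * (min (x + v) (2 * M) powr \<alpha> - x powr \<alpha>)"
  have cx: "cn n (ennreal x) = x" using x x0 M by (simp add: cn_def)
  have nn: "0 \<le> ?f v" if "\<nu> * \<epsilon> n < v" for v
  proof -
    have "0 < v" using \<tau>(1)[of n] that by linarith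
    then have "x powr \<alpha> \<le> min (x + v) (2 * M) powr \<alpha>" using x x0 \<alpha> by (intro powr_mono2) auto
    then show ?thesis by simp
  qed
  have "jump_gen (Gn n) (cn n) (H M) (ennreal x) = (LINT v:{0<..}|lebesgue. if v \<le> \<nu> * \<epsilon> n then 0 else ?f v)"
    unfolding jump_gen_def
  proof (rule set_lebesgue_integral_cong)
    show "\<forall>v. v \<in> {0<..} \<longrightarrow> Gn n v * (r (cn n (ennreal x)) + r v)\<^sup>2 * (H M (ennreal x + ennreal v) - H M (ennreal x))
      = (if v \<le> \<nu> * \<epsilon> n then 0 else ?f v)"
    proof (intro allI impI)
      fix v :: real assume "v \<in> {0<..}"
      then have v: "0 < v" by simp
      have "H M (ennreal x + ennreal v) = min (x + v) (2 * M) powr \<alpha>" "H M (ennreal x) = x powr \<alpha>"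
        using x x0 v by (simp_all add: H_ennreal Hf_def min_def flip: ennreal_plus)
      moreover have "r x = x powr (1 / 3)" "r v = v powr (1 / 3)" using x0 v by (simp_all add: root_powr_inverse)
      ultimately show "Gn n v * (r (cn n (ennreal x)) + r v)\<^sup>2 * (H M (ennreal x + ennreal v) - H M (ennreal x))
        = (if v \<le> \<nu> * \<epsilon> n then 0 else ?f v)"
        by (simp add: Gn_def cx)
    qed
  qed simp
  also have "\<dots> = 0 + x powr \<eta> * (\<Psi> (2 * M / x - 1) - \<Psi> (\<nu> * \<epsilon> n / x) + ((2 * M / x) powr \<alpha> - 1) * Q (2 * M / x - 1))"
    by (rule two_piece_integral(2)[OF \<tau>(1) has_integral_0 truncated_generator_has_integral[OF \<Psi> c x0 x(2)]])
      (use x \<tau>(2)[of n] nn in auto)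
  finally show ?thesis by simp
qed

text \<open>On [0, \<epsilon> n] the rate is frozen and increments of the concave modulus decrease.
  On [\<epsilon> n, M] the scaled inequality applies with b = 2 * M / x, which decreases in x. The
  two ranges are joined at \<epsilon> n.\<close>

lemma jump_H_antimono:
  assumes M: "\<epsilon> n \<le> M" "M \<le> real (Suc n)" and VW: "V \<le> W" "W \<le> ennreal M"
  shows "jump_gen (Gn n) (cn n) (H M) W \<le> jump_gen (Gn n) (cn n) (H M) V"
proof -
  let ?F = "\<lambda>x. jump_gen (Gn n) (cn n) (H M) (ennreal x)"
  have M0: "0 < M" using \<epsilon>(1)[of n] M by linarith
  have low: "?F y \<le> ?F x" if xy: "0 \<le> x" "x \<le> y" "y \<le> \<epsilon> n" for x y
    unfolding jump_gen_def
  proof (intro set_integral_mono J.jump_integrable H_C)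
    fix v :: real assume "v \<in> {0<..}"
    then have v: "0 < v" by simp
    have c: "cn n (ennreal x) = \<epsilon> n" "cn n (ennreal y) = \<epsilon> n"
      using xy by (auto simp: cn_def max_def min_def)
    have "H M (ennreal y + ennreal v) - H M (ennreal y) \<le> H M (ennreal x + ennreal v) - H M (ennreal x)"
      using xy v M0 Hf_increment_antimono[of x y v M] by (simp add: H_ennreal flip: ennreal_plus)
    then show "Gn n v * (r (cn n (ennreal y)) + r v)\<^sup>2 * (H M (ennreal y + ennreal v) - H M (ennreal y))
      \<le> Gn n v * (r (cn n (ennreal x)) + r v)\<^sup>2 * (H M (ennreal x + ennreal v) - H M (ennreal x))"
      unfolding c using Gn_nonneg by (intro mult_left_mono) auto
  qed (use M0 in auto)
  have high: "?F y \<le> ?F x" if xy: "\<epsilon> n \<le> x" "x \<le> y" "y \<le> M" for x y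
  proof -
    have x0: "0 < x" "0 < y" using \<epsilon>(1)[of n] xy by linarith+
    \<comment> \<open>One constant serves both as the lower end of the primitive and as \<kappa>:
      with b = 2 * M / x the scaled cutoff \<nu> * \<epsilon> n / x equals c * b.\<close>
    define c where "c = \<nu> * \<epsilon> n / (2 * M)"
    have c: "0 < c" using \<tau>(1) M0 by (simp add: c_def)
    obtain \<Psi> where \<Psi>: "\<And>y. c < y \<Longrightarrow> (\<Psi> has_real_derivative k y) (at y)"
      using primitive_exists[OF c] by blast
    have c1: "c < \<nu> * \<epsilon> n / z" if "0 < z" "z \<le> M" for z
      unfolding c_def using that M0 \<tau>(1)[of n] by (intro divide_strict_left_mono) auto
    let ?B = "\<lambda>b. b powr (- \<eta>) * (\<Psi> (b - 1) - \<Psi> (c * b) + (b powr \<alpha> - 1) * Q (b - 1))"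
    have F: "?F z = (2 * M) powr \<eta> * ?B (2 * M / z)" if z: "\<epsilon> n \<le> z" "z \<le> M" for z
    proof -
      have z0: "0 < z" using z \<epsilon>(1)[of n] by linarith
      have "c * (2 * M / z) = \<nu> * \<epsilon> n / z" using M0 by (simp add: c_def)
      moreover have "(2 * M) powr \<eta> * (2 * M / z) powr (- \<eta>) = z powr \<eta>"
        using z0 M0 by (simp add: powr_divide powr_minus field_simps)
      ultimately show ?thesis
        using jump_H_formula[OF \<Psi> c c1[OF z0 z(2)] z M(2)] by (simp only: mult.assoc[symmetric])
    qed
    have "?B (2 * M / y) \<le> ?B (2 * M / x)"
    proof (rule scaled_generator_nondecreasing[OF \<Psi> c \<eta>K \<nu>(2,3)])
      show "2 \<le> 2 * M / y" using xy x0 by (simp add: le_divide_eq)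
      show "2 * M / y \<le> 2 * M / x" using xy x0 M0 by (intro divide_left_mono) auto
      show "c < c * (2 * M / y)" using c1[OF x0(2) xy(3)] M0 by (simp add: c_def)
      have "\<nu> * \<epsilon> n \<le> \<nu> * x" using \<nu> xy by (intro mult_left_mono) auto
      then show "c * (2 * M / x) \<le> \<nu>" using x0 M0 by (simp add: c_def divide_le_eq)
    qed
    then show ?thesis using F[of x] F[of y] xy by (simp add: mult_left_mono)
  qed
  have all: "?F y \<le> ?F x" if xy: "0 \<le> x" "x \<le> y" "y \<le> M" for x y
  proof -
    consider "y \<le> \<epsilon> n" | "\<epsilon> n \<le> x" | "x \<le> \<epsilon> n" "\<epsilon> n \<le> y" by linarith
    then show ?thesis
    proof cases
      case 3
      then have "?F y \<le> ?F (\<epsilon> n)" using xy by (intro high) auto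
      also have "\<dots> \<le> ?F x" using 3 xy by (intro low) auto
      finally show ?thesis .
    qed (use low high xy in auto)
  qed
  obtain y where y: "W = ennreal y" "0 \<le> y" "y \<le> M"
    using VW(2) M0 by (cases W) (auto simp: top_unique)
  obtain x where x: "V = ennreal x" "0 \<le> x" "x \<le> y"
    using VW(1) y by (cases V) (auto simp: top_unique)
  show ?thesis unfolding x y by (rule all[OF x(2,3) y(3)])
qed

text \<open>The index is (M, K). The modulus condition says that K * H + u and K * H - u are both
  monotone, the form in which it passes through \<open>P_mono\<close>.\<close>

definition D :: "real \<times> real \<Rightarrow> (ennreal \<Rightarrow> real) set" where
  "D i = {u. 0 < fst i \<and> 0 \<le> snd i \<and> u \<in> X_space (fst i) \<and>
     (\<forall>V W. V \<le> W \<longrightarrow> \<bar>u W - u V\<bar> \<le> snd i * (H (fst i) W - H (fst i) V))}"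

definition n0 :: "real \<times> real \<Rightarrow> nat" where "n0 i = nat \<lceil>max (fst i) (1 / fst i)\<rceil>"

lemma n0:
  assumes "n0 (M, K) \<le> n" "0 < M"
  shows "M \<le> real (Suc n)" "\<epsilon> n \<le> M"
proof -
  have "max M (1 / M) \<le> real n" using assms(1) by (simp add: n0_def)
  then have m: "M \<le> real (Suc n)" "1 / M \<le> real (Suc n)" by simp_all
  then show "M \<le> real (Suc n)" by simp
  show "\<epsilon> n \<le> M" using m(2) assms(2) by (simp add: \<epsilon>_def divide_le_eq mult.commute)
qed

text \<open>K * H plus or minus u stays monotone under \<open>P\<close>, so increments of
  \<open>P u\<close> are at most K times those of \<open>P H\<close>. On [0, M] the latter are at
  most those of \<open>H\<close>, because the generator applied to \<open>H\<close> is nonincreasing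
  there. Hence K is preserved by every step, for all n from \<open>n0\<close> on.\<close>

lemma P_D:
  assumes u: "u \<in> D (M, K)" and n: "n0 (M, K) \<le> n"
  shows "J.P n u \<in> D (M, K)"
proof -
  have M: "0 < M" and K: "0 \<le> K" and X: "u \<in> X_space M"
    and d: "\<And>V W. V \<le> W \<Longrightarrow> \<bar>u W - u V\<bar> \<le> K * (H M W - H M V)" using u by (auto simp: D_def)
  note uC = X_space_C[OF X]
  have HC: "H M \<in> C_compact" using M by (intro H_C) simp
  have lin: "J.P n (\<lambda>V. K * H M V + a * u V) = (\<lambda>V. K * J.P n (H M) V + a * J.P n u V)" for a
    by (rule J.P_lin[OF HC uC])
  have mono: "mono (\<lambda>V. K * H M V + a * u V)" if a: "\<bar>a\<bar> = 1" for a
  proof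
    fix V W :: ennreal assume VW: "V \<le> W"
    have "\<bar>a * (u W - u V)\<bar> \<le> K * (H M W - H M V)" using d[OF VW] a by (simp add: abs_mult)
    then show "K * H M V + a * u V \<le> K * H M W + a * u W" by (simp add: right_diff_distrib abs_le_iff)
  qed
  have PH: "J.P n (H M) W - J.P n (H M) V \<le> H M W - H M V" if "V \<le> W" "W \<le> ennreal M" for V W
  proof -
    have "jump_gen (Gn n) (cn n) (H M) W / lam n \<le> jump_gen (Gn n) (cn n) (H M) V / lam n"
      using jump_H_antimono[OF n0(2,1)[OF n M] that] J.lam(1)[of n] by (intro divide_right_mono) auto
    then show ?thesis by (simp add: J.P_def)
  qed
  have dP: "\<bar>J.P n u W - J.P n u V\<bar> \<le> K * (H M W - H M V)" if VW: "V \<le> W" "W \<le> ennreal M" for V W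
  proof -
    have "a * (J.P n u V - J.P n u W) \<le> K * (J.P n (H M) W - J.P n (H M) V)" if "\<bar>a\<bar> = 1" for a
    proof -
      have "mono (J.P n (\<lambda>V. K * H M V + a * u V))"
        by (rule J.P_mono[OF C_compact_lin[OF HC uC] mono[OF that] cn_mono])
      from monoD[OF this VW(1)] show ?thesis unfolding lin by (simp add: algebra_simps)
    qed
    from this[of 1] this[of "-1"] have "\<bar>J.P n u W - J.P n u V\<bar> \<le> K * (J.P n (H M) W - J.P n (H M) V)"
      by (simp add: abs_le_iff)
    also have "\<dots> \<le> K * (H M W - H M V)" using PH[OF VW] K by (intro mult_left_mono)
    finally show ?thesis .
  qed
  have PX: "J.P n u \<in> X_space M" by (rule J.P_X_space[OF X])
  \<comment> \<open>The comparison of \<open>P H\<close> with \<open>H\<close> covers [0, M]. Beyond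
    \<open>M\<close> the function \<open>P u\<close> is constant while \<open>H\<close> does not
    decrease, so \<open>M\<close> can stand in for the larger point.\<close>
  have "\<bar>J.P n u W - J.P n u V\<bar> \<le> K * (H M W - H M V)" if VW: "V \<le> W" for V W
  proof (cases "W \<le> ennreal M")
    case False
    then have W: "J.P n u W = J.P n u (ennreal M)" "ennreal M \<le> W"
      using X_space_const[OF PX, of W "ennreal M"] by auto
    show ?thesis
    proof (cases "V \<le> ennreal M")
      case True
      have "\<bar>J.P n u W - J.P n u V\<bar> \<le> K * (H M (ennreal M) - H M V)" unfolding W(1) by (rule dP[OF True order_refl])
      also have "\<dots> \<le> K * (H M W - H M V)" using H_mono[OF _ W(2), of M] M K by (intro mult_left_mono) auto
      finally show ?thesis .
    next
      case False
      then have "J.P n u V = J.P n u (ennreal M)" using X_space_const[OF PX, of V "ennreal M"] by auto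
      then show ?thesis using W(1) K H_mono[OF _ VW, of M] M by simp
    qed
  qed (rule dP[OF VW])
  then show ?thesis using M K PX by (simp add: D_def)
qed

lemma S_D:
  assumes u: "u \<in> D (M, K)" and n: "n0 (M, K) \<le> n" and t: "0 \<le> t"
  shows "J.S n t u \<in> D (M, K)"
proof -
  have M: "0 < M" "0 \<le> K" and X: "u \<in> X_space M" using u by (auto simp: D_def)
  have Pk: "(J.P n ^^ k) u \<in> D (M, K)" for k by (induction k) (auto intro: u P_D n)
  have "\<bar>J.S n t u W - J.S n t u V\<bar> \<le> K * (H M W - H M V)" if "V \<le> W" for V W
    by (rule J.S_increment_bound[OF X_space_C[OF X] t]) (use Pk that in \<open>simp add: D_def\<close>)
  then show ?thesis using M J.S_X_space[OF X t J.P_X_space] by (simp add: D_def)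
qed

lemma D_modulus:
  assumes u: "u \<in> D (M, K)" and x: "0 \<le> x" "0 \<le> v"
  shows "\<bar>u (ennreal (x + v)) - u (ennreal x)\<bar> \<le> K * (Hf M (x + v) - Hf M x)"
proof -
  have "ennreal x \<le> ennreal (x + v)" using x by (intro ennreal_leI) auto
  then have "\<bar>u (ennreal (x + v)) - u (ennreal x)\<bar> \<le> K * (H M (ennreal (x + v)) - H M (ennreal x))"
    using u by (auto simp: D_def)
  then show ?thesis using u x by (simp add: H_ennreal D_def del: ennreal_plus)
qed

text \<open>Majorant, per unit of K, of the difference between the true and the approximate jump
  integrand: below the cutoff the whole integrand is lost, above it the change of rate caused by
  freezing the volume counts. \<open>E0\<close> is the integral after the factor \<epsilon> n powr
  \<eta> has been scaled out.\<close>

definition ew :: "nat \<Rightarrow> real \<Rightarrow> real" where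
  "ew n v = (if v \<le> \<nu> * \<epsilon> n then 4 * v powr (\<eta> - 1)
     else \<epsilon> n powr (2 / 3) * v powr (\<alpha> - \<sigma>) + 2 * \<epsilon> n powr (1 / 3) * v powr (\<alpha> + 1 / 3 - \<sigma>))"

definition E0 :: real where
  "E0 = 4 * (\<nu> powr \<eta> / \<eta>) + \<nu> powr (\<eta> - 2 / 3) / (2 / 3 - \<eta>) + 2 * (\<nu> powr (\<eta> - 1 / 3) / (1 / 3 - \<eta>))"

lemma ew:
  shows "set_integrable lebesgue {0<..} (ew n)" and "(LINT v:{0<..}|lebesgue. ew n v) = E0 * \<epsilon> n powr \<eta>"
proof -
  let ?\<tau> = "\<nu> * \<epsilon> n"
  let ?I = "4 * (?\<tau> powr \<eta> / \<eta>)"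
  let ?J = "\<epsilon> n powr (2 / 3) * (?\<tau> powr (\<eta> - 2 / 3) / (2 / 3 - \<eta>)) + 2 * \<epsilon> n powr (1 / 3) * (?\<tau> powr (\<eta> - 1 / 3) / (1 / 3 - \<eta>))"
  have 1: "((\<lambda>v. 4 * v powr (\<eta> - 1)) has_integral ?I) {0..?\<tau>}"
    using \<eta> \<tau>(1)[of n] has_integral_powr_from_0[of "\<eta> - 1" ?\<tau>] by (intro has_integral_mult_right) auto
  have t: "((\<lambda>v. v powr e) has_integral (?\<tau> powr (e + 1) / (- e - 1))) {?\<tau>..}" if "e < -1" for e
  proof -
    have "- (?\<tau> powr (e + 1)) / (e + 1) = ?\<tau> powr (e + 1) / (- e - 1)"
      using that by (simp add: divide_simps) (simp add: algebra_simps)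
    then show ?thesis using has_integral_powr_to_inf[OF that \<tau>(1)[of n]] by simp
  qed
  have e: "\<alpha> - \<sigma> + 1 = \<eta> - 2 / 3" "- (\<alpha> - \<sigma>) - 1 = 2 / 3 - \<eta>"
    "\<alpha> + 1 / 3 - \<sigma> + 1 = \<eta> - 1 / 3" "- (\<alpha> + 1 / 3 - \<sigma>) - 1 = 1 / 3 - \<eta>" by (simp_all add: \<alpha>_eq)
  have t1: "((\<lambda>v. v powr (\<alpha> - \<sigma>)) has_integral (?\<tau> powr (\<eta> - 2 / 3) / (2 / 3 - \<eta>))) {?\<tau>..}"
  proof -
    have "\<alpha> - \<sigma> < -1" using e(1) \<eta> by linarith
    from t[OF this] show ?thesis unfolding e .
  qed
  have t2: "((\<lambda>v. v powr (\<alpha> + 1 / 3 - \<sigma>)) has_integral (?\<tau> powr (\<eta> - 1 / 3) / (1 / 3 - \<eta>))) {?\<tau>..}"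
  proof -
    have "\<alpha> + 1 / 3 - \<sigma> < -1" using e(3) \<eta> by linarith
    from t[OF this] show ?thesis unfolding e .
  qed
  have 2: "((\<lambda>v. \<epsilon> n powr (2 / 3) * v powr (\<alpha> - \<sigma>) + 2 * \<epsilon> n powr (1 / 3) * v powr (\<alpha> + 1 / 3 - \<sigma>)) has_integral ?J) {?\<tau>..}"
    by (intro has_integral_add has_integral_mult_right t1 t2)
  show "set_integrable lebesgue {0<..} (ew n)"
    using two_piece_integral(1)[OF \<tau>(1) 1 2] by (simp add: ew_def[abs_def])
  have "(LINT v:{0<..}|lebesgue. ew n v) = ?I + ?J"
    using two_piece_integral(2)[OF \<tau>(1) 1 2] by (simp add: ew_def[abs_def])
  also have "\<dots> = E0 * \<epsilon> n powr \<eta>"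
  proof -
    have p: "?\<tau> powr a = \<nu> powr a * \<epsilon> n powr a" for a
      using \<nu> \<epsilon>(1)[of n] by (simp add: powr_mult)
    have q: "\<epsilon> n powr (2 / 3) * \<epsilon> n powr (\<eta> - 2 / 3) = \<epsilon> n powr \<eta>"
      "\<epsilon> n powr (1 / 3) * \<epsilon> n powr (\<eta> - 1 / 3) = \<epsilon> n powr \<eta>"
      by (simp_all flip: powr_add)
    have "?J = (\<epsilon> n powr (2 / 3) * \<epsilon> n powr (\<eta> - 2 / 3)) * (\<nu> powr (\<eta> - 2 / 3) / (2 / 3 - \<eta>))
      + 2 * ((\<epsilon> n powr (1 / 3) * \<epsilon> n powr (\<eta> - 1 / 3)) * (\<nu> powr (\<eta> - 1 / 3) / (1 / 3 - \<eta>)))"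
      unfolding p by (simp add: mult_ac)
    then show ?thesis unfolding q p[of \<eta>] E0_def by (simp add: algebra_simps)
  qed
  finally show "(LINT v:{0<..}|lebesgue. ew n v) = E0 * \<epsilon> n powr \<eta>" .
qed

lemma ew_nonneg: "0 \<le> ew n v" by (simp add: ew_def)

lemma jump_bounds:
  assumes u: "u \<in> D (M, K)" and n: "n0 (M, K) \<le> n" and v: "0 < v"
  defines "I \<equiv> \<lambda>V. u (V + ennreal v) - u V"
  shows "\<bar>v powr (- \<sigma>) * (r (clip M V) + r v)\<^sup>2 * I V\<bar> \<le> K * hw M v"
    and "\<bar>v powr (- \<sigma>) * (r (clip M V) + r v)\<^sup>2 * I V - Gn n v * (r (cn n V) + r v)\<^sup>2 * I V\<bar> \<le> K * ew n v"
proof -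
  have M: "0 < M" and K: "0 \<le> K" and X: "u \<in> X_space M" using u by (auto simp: D_def)
  have "\<bar>v powr (- \<sigma>) * (r (clip M V) + r v)\<^sup>2 * I V\<bar> \<le> K * hw M v \<and>
    \<bar>v powr (- \<sigma>) * (r (clip M V) + r v)\<^sup>2 * I V - Gn n v * (r (cn n V) + r v)\<^sup>2 * I V\<bar> \<le> K * ew n v"
  proof (cases "V < ennreal M")
    case False
    then have "I V = 0"
      using X_space_const[OF X, of "V + ennreal v" V] by (simp add: I_def add_increasing2)
    then show ?thesis using K hw_nonneg ew_nonneg by simp
  next
    case True
    then obtain x where x: "V = ennreal x" "0 \<le> x" "x < M"
      by (cases V) (auto simp: ennreal_less_iff)
    have c: "clip M V = x" "cn n V = max x (\<epsilon> n)"
      using x n0(1)[OF n M] by (auto simp: cn_def)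
    define d where "d = Hf M (x + v) - Hf M x"
    have d: "0 \<le> d" "d \<le> (x + v) powr \<alpha> - x powr \<alpha>"
      using Hf_mono[of M x "x + v"] Hf_increment_le(1)[of x M v] x v M by (auto simp: d_def)
    have "V + ennreal v = ennreal (x + v)" using x v by simp
    then have I: "\<bar>I V\<bar> \<le> K * d"
      using D_modulus[OF u x(2), of v] v by (simp add: I_def d_def x(1))
    let ?s = "v powr (- \<sigma>) * (r x + r v)\<^sup>2"
    have first: "\<bar>?s * I V\<bar> \<le> K * (?s * d)"
      using mult_left_mono[OF I, of ?s] by (simp add: abs_mult mult_ac)
    also have "\<dots> \<le> K * hw M v"
      using hw_bound[of x M v] x v K by (intro mult_left_mono) (auto simp: d_def)
    finally have 1: "\<bar>?s * I V\<bar> \<le> K * hw M v" .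
    have "\<bar>?s * I V - Gn n v * (r (max x (\<epsilon> n)) + r v)\<^sup>2 * I V\<bar> \<le> K * ew n v"
    proof (cases "v \<le> \<nu> * \<epsilon> n")
      case True
      have "?s * d \<le> ?s * ((x + v) powr \<alpha> - x powr \<alpha>)" using d by (intro mult_left_mono) auto
      also have "\<dots> \<le> 4 * v powr (\<eta> - 1)" using x v by (intro increment_small) auto
      finally have "K * (?s * d) \<le> K * (4 * v powr (\<eta> - 1))" using K by (intro mult_left_mono)
      then show ?thesis using True first by (simp add: Gn_def ew_def)
    next
      case False
      let ?c = "max x (\<epsilon> n)"
      have "0 \<le> ew n v" by (rule ew_nonneg)
      \<comment> \<open>For x \<le> \<epsilon> n the change of the square is largest at x = 0, which
        gives the bound; for x > \<epsilon> n the volume is not altered.\<close>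
      have diff: "0 \<le> (r ?c + r v)\<^sup>2 - (r x + r v)\<^sup>2" "(r ?c + r v)\<^sup>2 - (r x + r v)\<^sup>2 \<le> \<epsilon> n powr (2 / 3) + 2 * \<epsilon> n powr (1 / 3) * v powr (1 / 3)"
      proof -
        have "(r x + r v)\<^sup>2 \<le> (r ?c + r v)\<^sup>2"
          using x v by (intro power_mono add_mono) (auto intro: add_nonneg_nonneg)
        then show "0 \<le> (r ?c + r v)\<^sup>2 - (r x + r v)\<^sup>2" by simp
        show "(r ?c + r v)\<^sup>2 - (r x + r v)\<^sup>2 \<le> \<epsilon> n powr (2 / 3) + 2 * \<epsilon> n powr (1 / 3) * v powr (1 / 3)"
        proof (cases "x \<le> \<epsilon> n")
          case True
          have e: "r (\<epsilon> n) = \<epsilon> n powr (1 / 3)" "r v = v powr (1 / 3)"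
            using \<epsilon>(1)[of n] v by (simp_all add: root_powr_inverse)
          have e2: "\<epsilon> n powr (1 / 3) * \<epsilon> n powr (1 / 3) = \<epsilon> n powr (2 / 3)" by (simp flip: powr_add)
          have "(r v)\<^sup>2 \<le> (r x + r v)\<^sup>2" using x v by (intro power_mono) auto
          then have "(r ?c + r v)\<^sup>2 - (r x + r v)\<^sup>2 \<le> (r (\<epsilon> n) + r v)\<^sup>2 - (r v)\<^sup>2"
            using True by (simp add: max_absorb2)
          also have "\<dots> = r (\<epsilon> n) * r (\<epsilon> n) + 2 * r (\<epsilon> n) * r v" by (simp add: power2_eq_square algebra_simps)
          finally show ?thesis unfolding e e2 .
        next
          case False
          then show ?thesis by (simp add: max_absorb1)
        qed
      qed
      have Kd: "K * d \<le> K * v powr \<alpha>"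
        using d(2) powr_subadditive[of x v \<alpha>] x v \<alpha> K by (intro mult_left_mono) auto
      have "\<bar>?s * I V - Gn n v * (r ?c + r v)\<^sup>2 * I V\<bar> = v powr (- \<sigma>) * ((r ?c + r v)\<^sup>2 - (r x + r v)\<^sup>2) * \<bar>I V\<bar>"
      proof -
        have "?s * I V - Gn n v * (r ?c + r v)\<^sup>2 * I V = - (v powr (- \<sigma>) * ((r ?c + r v)\<^sup>2 - (r x + r v)\<^sup>2) * I V)"
          using False by (simp add: Gn_def algebra_simps)
        also have "\<bar>\<dots>\<bar> = v powr (- \<sigma>) * ((r ?c + r v)\<^sup>2 - (r x + r v)\<^sup>2) * \<bar>I V\<bar>"
          using diff(1) by (simp only: abs_minus_cancel abs_mult abs_of_nonneg powr_ge_zero)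
        finally show ?thesis .
      qed
      also have "\<dots> \<le> v powr (- \<sigma>) * (\<epsilon> n powr (2 / 3) + 2 * \<epsilon> n powr (1 / 3) * v powr (1 / 3)) * (K * v powr \<alpha>)"
        using diff I Kd K by (intro mult_mono mult_left_mono order_trans[OF I Kd]) auto
      also have "\<dots> = K * (\<epsilon> n powr (2 / 3) * (v powr \<alpha> * v powr (- \<sigma>)) + 2 * \<epsilon> n powr (1 / 3) * (v powr \<alpha> * v powr (1 / 3) * v powr (- \<sigma>)))"
        by (simp add: algebra_simps)
      also have "\<dots> = K * ew n v"
        using False by (simp add: ew_def flip: powr_add)
      finally show ?thesis .
    qed
    then show ?thesis using 1 unfolding c by blast
  qed
  then show "\<bar>v powr (- \<sigma>) * (r (clip M V) + r v)\<^sup>2 * I V\<bar> \<le> K * hw M v"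
    "\<bar>v powr (- \<sigma>) * (r (clip M V) + r v)\<^sup>2 * I V - Gn n v * (r (cn n V) + r v)\<^sup>2 * I V\<bar> \<le> K * ew n v"
    by blast+
qed

lemma jump_error:
  assumes u: "u \<in> D (M, K)" and n: "n0 (M, K) \<le> n"
  shows "\<bar>jump_operator (G_infty \<sigma>) u V - jump_gen (Gn n) (cn n) u V\<bar> \<le> K * (E0 * \<epsilon> n powr \<eta>)"
proof -
  have M: "0 < M" and X: "u \<in> X_space M" using u by (auto simp: D_def)
  note uC = X_space_C[OF X]
  let ?f = "\<lambda>v. G_infty \<sigma> v * (r (clip M V) + r v)\<^sup>2 * (u (V + ennreal v) - u V)"
  let ?g = "\<lambda>v. Gn n v * (r (cn n V) + r v)\<^sup>2 * (u (V + ennreal v) - u V)"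
  have f: "set_integrable lebesgue {0<..} ?f"
    by (rule set_integrable_jump_bound[OF G_infty_meas uC, of "\<lambda>v. K * hw M v"])
      (use hw_integrable[OF M] jump_bounds(1)[OF u n] in \<open>auto simp: G_infty_def\<close>)
  have g: "set_integrable lebesgue {0<..} ?g" by (rule J.jump_integrable[OF uC])
  have eq: "jump_operator (G_infty \<sigma>) u V - jump_gen (Gn n) (cn n) u V = (LINT v:{0<..}|lebesgue. ?f v - ?g v)"
    using M unfolding jump_operator_eq_jump_gen[OF X less_imp_le[OF M]] jump_gen_def
    by (intro set_integral_diff(2)[symmetric] f g)
  have "\<bar>LINT v:{0<..}|lebesgue. ?f v - ?g v\<bar> \<le> (LINT v:{0<..}|lebesgue. K * ew n v)"
  proof (rule set_lebesgue_integral_abs_bound[OF set_integral_diff(1)[OF f g]])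
    show "set_integrable lebesgue {0<..} (\<lambda>v. K * ew n v)" by (rule set_integrable_mult_right) (rule ew(1))
    show "\<bar>?f v - ?g v\<bar> \<le> K * ew n v" if "v \<in> {0<..}" for v
      using jump_bounds(2)[OF u n, of v V] that unfolding G_infty_def greaterThan_iff .
  qed
  also have "\<dots> = K * (E0 * \<epsilon> n powr \<eta>)" by (simp add: ew(2))
  finally show ?thesis unfolding eq .
qed

text \<open>The slope of the power on (0, M] is smallest at \<open>M\<close>; a start at 0, where
  the power is not differentiable, is handled directly. This converts Lipschitz bounds into bounds
  by the modulus.\<close>

lemma powr_increment_ge:
  assumes "0 \<le> x" "x \<le> y" "y \<le> M" "0 < M"
  shows "(\<alpha> * M powr (\<alpha> - 1)) * (y - x) \<le> y powr \<alpha> - x powr \<alpha>"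
proof (cases "x = 0")
  case True
  show ?thesis
  proof (cases "y = 0")
    case False
    then have y: "0 < y" using assms True by simp
    have "(\<alpha> * M powr (\<alpha> - 1)) * y \<le> (1 * y powr (\<alpha> - 1)) * y"
      using \<alpha> assms y by (intro mult_right_mono mult_mono powr_mono2') auto
    also have "\<dots> = y powr \<alpha>" using y by (simp add: powr_diff)
    finally show ?thesis using True by simp
  qed (use True in simp)
next
  case False
  have "(\<alpha> * M powr (\<alpha> - 1)) * y - (\<alpha> * M powr (\<alpha> - 1)) * x \<le> y powr \<alpha> - x powr \<alpha>"
  proof (rule derivative_compare[OF assms(2), where f' = "\<lambda>_. \<alpha> * M powr (\<alpha> - 1)" and g' = "\<lambda>z. \<alpha> * z powr (\<alpha> - 1)"])
    fix z assume z: "x \<le> z" "z \<le> y"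
    then have z0: "0 < z" using False assms by simp
    show "((\<lambda>z. (\<alpha> * M powr (\<alpha> - 1)) * z) has_real_derivative \<alpha> * M powr (\<alpha> - 1)) (at z)"
      using DERIV_cmult_Id[of "\<alpha> * M powr (\<alpha> - 1)"] by simp
    show "((\<lambda>z. z powr \<alpha>) has_real_derivative \<alpha> * z powr (\<alpha> - 1)) (at z)"
      by (rule has_real_derivative_powr[OF z0])
    show "\<alpha> * M powr (\<alpha> - 1) \<le> \<alpha> * z powr (\<alpha> - 1)"
      using z z0 assms \<alpha> by (intro mult_left_mono powr_mono2') auto
  qed
  then show ?thesis by (simp add: right_diff_distrib)
qed

text \<open>A Lipschitz constant B becomes the modulus constant B / q, with q the least slope of the
  \<alpha>-th power on (0, M]. Hence the classes contain the smooth test functions and are dense in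
  the continuous functions.\<close>

lemma lip_X_D:
  assumes "\<psi> \<in> lip_X"
  shows "\<exists>i. \<psi> \<in> D i"
proof -
  obtain M B where M: "0 < M" and B: "0 \<le> B" and X: "\<psi> \<in> X_space M" and lip: "halfline_lip B \<psi>"
    using assms unfolding lip_X_def by blast
  define q where "q = \<alpha> * M powr (\<alpha> - 1)"
  have q: "0 < q" using \<alpha> M by (simp add: q_def)
  have "\<bar>\<psi> W - \<psi> V\<bar> \<le> (B / q) * (H M W - H M V)" if VW: "V \<le> W" for V W
  proof -
    let ?a = "clip M V" and ?b = "clip M W"
    have ab: "?a \<le> ?b" "?b \<le> M" using VW M by (auto intro: clip_mono clip_le)
    have "\<bar>\<psi> W - \<psi> V\<bar> = \<bar>\<psi> (ennreal ?b) - \<psi> (ennreal ?a)\<bar>"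
      using X_space_clip[OF X, of V] X_space_clip[OF X, of W] M by simp
    also have "\<dots> \<le> B * (?b - ?a)" by (rule halfline_lipD[OF lip clip_nonneg ab(1)])
    also have "\<dots> = (B / q) * (q * (?b - ?a))" using q by simp
    also have "\<dots> \<le> (B / q) * (?b powr \<alpha> - ?a powr \<alpha>)"
      using powr_increment_ge[OF clip_nonneg ab M] B q by (intro mult_left_mono) (auto simp: q_def)
    also have "\<dots> \<le> (B / q) * (H M W - H M V)"
    proof (intro mult_left_mono)
      show "?b powr \<alpha> - ?a powr \<alpha> \<le> H M W - H M V"
      proof (cases "V \<le> ennreal M")
        case True
        have "min V (ennreal M) = min V (ennreal (2 * M))"
          using True M order_trans[OF True ennreal_leI[of M "2 * M"]] by (simp add: min_absorb1)
        then have "?a = clip (2 * M) V" by (simp add: clip_def)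
        moreover have "?b powr \<alpha> \<le> clip (2 * M) W powr \<alpha>"
        proof (rule powr_mono2)
          have "min W (ennreal M) \<le> min W (ennreal (2 * M))" using M by (intro min.mono ennreal_leI) auto
          then show "?b \<le> clip (2 * M) W"
            unfolding clip_def by (intro enn2real_mono) (auto simp: min_less_iff_disj)
        qed (use \<alpha> in auto)
        ultimately show ?thesis by (simp add: H_def)
      next
        case False
        then have "?a = M" "?b = M" using M VW by (auto intro!: clip_ge)
        then show ?thesis using H_mono[OF _ VW, of M] M by simp
      qed
    qed (use B q in auto)
    finally show ?thesis .
  qed
  then have "\<psi> \<in> D (M, B / q)" using M B X q by (simp add: D_def)
  then show ?thesis ..
qed

lemma evolution_power:
  assumes f0: "f0 \<in> radon_measures"
  shows "\<exists>f. weak_solution (G_infty \<sigma>) f0 f \<and> (\<forall>g. weak_solution (G_infty \<sigma>) f0 g \<longrightarrow> (\<forall>t\<ge>0. g t = f t)) \<and>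
    (emeasure f0 {\<infinity>} = 0 \<longrightarrow> (\<forall>t\<ge>0. emeasure (f t) {\<infinity>} = 0))"
proof -
  let ?L = "jump_operator (G_infty \<sigma>)"
  have seq: "\<exists>\<psi> K'. (\<forall>n. \<psi> n \<in> C_infty_compact \<inter> X_space M) \<and>
      (\<forall>n V. \<bar>\<psi> n V\<bar> \<le> K') \<and> (\<forall>V. (\<lambda>n. \<psi> n V) \<longlonglongrightarrow> u V) \<and>
      (\<forall>n V. \<bar>?L (\<psi> n) V\<bar> \<le> K') \<and> (\<forall>V. (\<lambda>n. ?L (\<psi> n) V) \<longlonglongrightarrow> ?L u V) \<and>
      (\<forall>n. ?L (\<psi> n) \<in> C_compact) \<and> ?L u \<in> C_compact"
    if u: "u \<in> D (M, K)" for u M K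
  proof -
    have M: "0 < M" and K: "0 \<le> K" and X: "u \<in> X_space M" using u by (auto simp: D_def)
    show ?thesis
    proof (rule K.smooth_sequence[OF X M, where m = "\<lambda>x v. K * (Hf M (x + v) - Hf M x)" and w = "\<lambda>v. K * hw M v"])
      show "\<bar>u (ennreal (x + v)) - u (ennreal x)\<bar> \<le> K * (Hf M (x + v) - Hf M x)" if "0 \<le> x" "0 \<le> v" for x v
        by (rule D_modulus[OF u that])
      show "K * (Hf M (y + v) - Hf M y) \<le> K * (Hf M (x + v) - Hf M x)" if "0 \<le> x" "x \<le> y" "0 \<le> v" for x y v
        using Hf_increment_antimono[OF that] K by (rule mult_left_mono)
      show "set_integrable lebesgue {0<..} (\<lambda>v. K * hw M v)" using hw_integrable[OF M] by simp
      show "0 \<le> K * hw M v" for v using K hw_nonneg by simp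
      show "G_infty \<sigma> v * (r x + r v)\<^sup>2 * (K * (Hf M (x + v) - Hf M x)) \<le> K * hw M v"
        if "0 \<le> x" "x \<le> M" "0 < v" for x v
        using mult_left_mono[OF hw_bound[OF that] K] by (simp add: G_infty_def mult_ac)
    next
      fix \<psi> K'
      assume "\<And>n. \<psi> n \<in> C_infty_compact \<inter> X_space M" "\<And>n V. \<bar>\<psi> n V\<bar> \<le> K'"
        "\<And>V. (\<lambda>n. \<psi> n V) \<longlonglongrightarrow> u V" "\<And>n V. \<bar>?L (\<psi> n) V\<bar> \<le> K'"
        "\<And>V. (\<lambda>n. ?L (\<psi> n) V) \<longlonglongrightarrow> ?L u V"
        "?L u \<in> C_compact" "\<And>n. ?L (\<psi> n) \<in> C_compact"
      then show ?thesis by (intro exI[of _ \<psi>] exI[of _ K'] conjI allI)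
    qed
  qed
  interpret jump_evolution \<sigma> 1 "G_infty \<sigma>" J.P lam D n0 "\<lambda>i n. snd i * (E0 * \<epsilon> n powr \<eta>)"
  proof
    show "\<phi> \<in> C_compact" if "\<phi> \<in> D i" for \<phi> i using that X_space_C by (auto simp: D_def)
    show "J.S n t \<phi> \<in> D i" if "\<phi> \<in> D i" "n0 i \<le> n" "0 \<le> t" for \<phi> i n t
      using S_D[of \<phi> "fst i" "snd i" n t] that by simp
    show "?L \<phi> \<in> C_compact" if "\<phi> \<in> D i" for \<phi> i
      using that seq[of \<phi> "fst i" "snd i"] by auto
    show "\<bar>?L \<phi> V - J.A n \<phi> V\<bar> \<le> snd i * (E0 * \<epsilon> n powr \<eta>)" if "\<phi> \<in> D i" "n0 i \<le> n" for \<phi> i n V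
      using jump_error[of \<phi> "fst i" "snd i" n V] that by (simp add: J.A_eq)
    show "(\<lambda>n. snd i * (E0 * \<epsilon> n powr \<eta>)) \<longlonglongrightarrow> 0" for i
    proof -
      have "(\<lambda>n. real (Suc n) powr (- \<eta>)) \<longlonglongrightarrow> 0"
        using \<eta> by (intro tendsto_neg_powr filterlim_compose[OF filterlim_real_sequentially filterlim_Suc]) auto
      moreover have "\<epsilon> n powr \<eta> = real (Suc n) powr (- \<eta>)" for n
        by (simp add: \<epsilon>_def powr_divide powr_minus_divide del: of_nat_Suc)
      ultimately have "(\<lambda>n. \<epsilon> n powr \<eta>) \<longlonglongrightarrow> 0" by simp
      from tendsto_mult[OF tendsto_const[of "snd i"] tendsto_mult[OF tendsto_const[of E0] this]]
      show ?thesis by simp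
    qed
    show "\<exists>i. \<exists>\<psi>\<in>D i. \<forall>V. \<bar>\<phi> V - \<psi> V\<bar> \<le> e" if "\<phi> \<in> C_compact" "0 < e" for \<phi> e
      using lip_X_dense[OF that] lip_X_D by blast
    show "\<exists>M>0. \<exists>\<psi> K. (\<forall>n. \<psi> n \<in> C_infty_compact \<inter> X_space M) \<and>
      (\<forall>n V. \<bar>\<psi> n V\<bar> \<le> K) \<and> (\<forall>V. (\<lambda>n. \<psi> n V) \<longlonglongrightarrow> \<phi> V) \<and>
      (\<forall>n V. \<bar>?L (\<psi> n) V\<bar> \<le> K) \<and> (\<forall>V. (\<lambda>n. ?L (\<psi> n) V) \<longlonglongrightarrow> ?L \<phi> V) \<and>
      (\<forall>n. ?L (\<psi> n) \<in> C_compact)" if "\<phi> \<in> D i" for \<phi> i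
    proof -
      have "0 < fst i" using that by (simp add: D_def)
      then show ?thesis using seq[of \<phi> "fst i" "snd i"] that unfolding prod.collapse by blast
    qed
    show "\<exists>i. \<phi> \<in> D i" if "0 < M" "\<phi> \<in> X_space M" "0 \<le> B"
      "\<And>x y. 0 \<le> x \<Longrightarrow> x \<le> y \<Longrightarrow> \<bar>\<phi> (ennreal y) - \<phi> (ennreal x)\<bar> \<le> B * (y - x)" for M \<phi> B
      using that by (intro lip_X_D lip_XI[of M _ B]) (auto simp: halfline_lip_def)
  qed
  show ?thesis by (rule evolution[OF f0])
qed

end

lemma power_kernel_exists:
  assumes "5 / 3 < \<sigma>" "\<sigma> < 2"
  obtains \<eta> \<nu> where "power_kernel \<sigma> \<eta> (\<sigma> - 5 / 3 + \<eta>) \<nu>"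
proof -
  \<comment> \<open>This repeats the constant of the scaling locale, which can be instantiated only
    after \<eta> is chosen; the value depends on \<sigma> alone.\<close>
  define K0 where "K0 = 18 + 4 / (2 - \<sigma>)"
  have K0: "0 < K0" using assms by (simp add: K0_def add_pos_pos)
  define \<eta> where "\<eta> = min (min (1 / 6) (2 - \<sigma>)) (1 / (2 * K0))"
  have \<eta>: "0 < \<eta>" "\<eta> \<le> 1 / 6" "\<eta> \<le> 2 - \<sigma>" "\<eta> \<le> 1 / (2 * K0)"
  proof -
    show "0 < \<eta>" using assms K0 by (simp add: \<eta>_def)
    show "\<eta> \<le> 1 / 6" unfolding \<eta>_def by (rule order_trans[OF min.cobounded1 min.cobounded1])
    show "\<eta> \<le> 2 - \<sigma>" unfolding \<eta>_def by (rule order_trans[OF min.cobounded1 min.cobounded2])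
    show "\<eta> \<le> 1 / (2 * K0)" unfolding \<eta>_def by (rule min.cobounded2)
  qed
  \<comment> \<open>Chosen so that 4 * \<nu> powr (2 - \<sigma>) is exactly 1/2.\<close>
  define \<nu> :: real where "\<nu> = (1 / 8) powr (1 / (2 - \<sigma>))"
  have \<nu>: "\<nu> powr (2 - \<sigma>) = 1 / 8" using assms by (simp add: \<nu>_def powr_powr)
  have exponents: "scaling_exponents \<sigma> \<eta> (\<sigma> - 5 / 3 + \<eta>)"
    using assms \<eta> by unfold_locales auto
  have "\<eta> * K0 \<le> 1 / 2" using \<eta>(4) K0 by (simp add: field_simps)
  moreover have "0 < \<nu>" "\<nu> \<le> 1" using assms by (simp_all add: \<nu>_def powr_le1)
  ultimately have "power_kernel \<sigma> \<eta> (\<sigma> - 5 / 3 + \<eta>) \<nu>"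
    using exponents \<nu>
    by (simp add: power_kernel_def power_kernel_axioms_def K0_def scaling_exponents.K0_def)
  then show ?thesis using that by blast
qed

theorem theorem2p3:
  fixes \<sigma> C\<^sub>0 :: real and G Gs :: "real \<Rightarrow> real" and f\<^sub>0 :: "ennreal measure"
  assumes "5 / 3 < \<sigma>" and "\<sigma> < 2"
    and "\<And>v. v > 0 \<Longrightarrow> 0 \<le> G v"
    and "G absolutely_integrable_on {0<..}"
    and "C\<^sub>0 > 0" and "\<And>v. v > 0 \<Longrightarrow> G v \<le> C\<^sub>0 * v powr (- \<sigma>)"
    and "((\<lambda>v. v powr \<sigma> * G v) \<longlongrightarrow> 1) at_top"
    and "Gs \<in> {G, G_infty \<sigma>}"
    and "f\<^sub>0 \<in> radon_measures"
  shows "\<exists>f. weak_solution Gs f\<^sub>0 f \<and>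
             (\<forall>g. weak_solution Gs f\<^sub>0 g \<longrightarrow> (\<forall>t\<ge>0. g t = f t)) \<and>
             (emeasure f\<^sub>0 {\<infinity>} = 0 \<longrightarrow> (\<forall>t\<ge>0. emeasure (f t) {\<infinity>} = 0))"
proof (cases "Gs = G")
  case True
  have "set_borel_measurable lebesgue {0<..} G"
    using assms(4) unfolding set_integrable_def set_borel_measurable_def by blast
  then interpret integrable_kernel \<sigma> C\<^sub>0 G
    using assms by unfold_locales auto
  show ?thesis unfolding True by (rule evolution_integrable[OF assms(9)])
next
  case False
  then have Gs: "Gs = G_infty \<sigma>" using assms(8) by simp
  obtain \<eta> \<nu> where "power_kernel \<sigma> \<eta> (\<sigma> - 5 / 3 + \<eta>) \<nu>"
    using power_kernel_exists[OF assms(1,2)] by blast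
  then interpret power_kernel \<sigma> \<eta> "\<sigma> - 5 / 3 + \<eta>" \<nu> .
  show ?thesis unfolding Gs by (rule evolution_power[OF assms(9)])
qed

end
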